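(* There exists an FPT algorithm for the Superset-Simultaneous-Dipaths problem parameterized by the number $\ell$ of multi-colored arcs, and an FPT algorithm for the Superset-Simultaneous-Paths problem parameterized by the number $\ell$ of multi-colored edges. In each case the algorithm takes $k\cdot 2^{\ell}$ executions of a shortest path algorithm in some subgraphs of the input graph with nonnegative cost function.
   Context: Superset-Simultaneous-Dipaths: the input is a positive integer $k$, a digraph $D=(V,A)$ with $A=A_1\cup\cdots\cup A_k$ (the color classes $A_i$ are not necessarily disjoint), two distinct vertices $s,t\in V$, and a conservative cost function $c\colon A\to\mathbb{R}$ (no directed cycle of negative total cost). The task is to find $A'\subseteq A$ of minimum cost $\sum_{a\in A'}c(a)$ such that $A'\cap A_i$ contains (the arc set of) an $s$-$t$ dipath for all $i\in\{1,\ldots,k\}$, or to determine that no such $A'$ exists. Superset-Simultaneous-Paths: the input is a positive integer $k$, an undirected graph $G=(V,E)$ with $E=E_1\cup\cdots\cup E_k$ (the $E_i$ not necessarily disjoint), two distinct vertices $s,t\in V$, and a nonnegative cost function $c\colon E\to\mathbb{R}_+$. The task is to find $E'\subseteq E$ of minimum cost such that $E'\cap E_i$ contains (the edge set of) an $s$-$t$ path for all $i\in\{1,\ldots,k\}$, or to determine that no such $E'$ exists. An arc (edge) is multi-colored if it belongs to at least two of the color classes. Graphs and digraphs are finite and may have parallel edges or arcs. An FPT algorithm with parameter $\ell$ is an algorithm with running time bounded by $f(\ell)\cdot\mathrm{poly}(N)$, where $N$ is the size of the input and $f\colon\mathbb{Z}_+\to\mathbb{Z}_+$ is an arbitrary computable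 function ($\mathbb{Z}_+$ is the set of nonnegative integers). *)

theory Defs
  imports
    "HOL-Computational_Algebra.Polynomial"
    "Graph_Theory.Digraph_Component"
begin

section \<open>Model of computation\<close>

text \<open>
  A WHILE language over binary trees (pure LISP data, as in Jones's WHILE language) whose atoms
  are real numbers.  Real costs are arbitrary reals, hence the unit-cost real-number model; the
  arithmetic is restricted to addition, subtraction and comparison, and the only constants are
  natural numbers.  Without multiplication and rounding the unit-cost measure
  does not hide superpolynomial work: on integer inputs each step lengthens the
  numbers by at most one bit (up to the bit-length of the finitely many literals), and trees are
  shared and compared only at atoms, so that the model is
  polynomially equivalent to Turing machines there.
\<close>

datatype data = Null | Num real | Pair data data

fun dsize :: "data \<Rightarrow> nat" where
  "dsize (Pair a b) = 1 + dsize a + dsize b"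
| "dsize _ = 1"

type_synonym vname = string
type_synonym state = "vname \<Rightarrow> data"

datatype exp =
    Var vname
  | NullE
  | Lit nat
  | PairE exp exp
  | Fst exp
  | Snd exp
  | Add exp exp
  | Sub exp exp
  | Leq exp exp

text \<open>\<^const>\<open>Null\<close> is the truth value false, and the result of ill-typed operations; all other
  values count as true.\<close>

fun fst_data :: "data \<Rightarrow> data" where
  "fst_data (Pair a b) = a"
| "fst_data _ = Null"

fun snd_data :: "data \<Rightarrow> data" where
  "snd_data (Pair a b) = b"
| "snd_data _ = Null"

fun add_data :: "data \<Rightarrow> data \<Rightarrow> data" where
  "add_data (Num x) (Num y) = Num (x + y)"
| "add_data _ _ = Null"

fun sub_data :: "data \<Rightarrow> data \<Rightarrow> data" where
  "sub_data (Num x) (Num y) = Num (x - y)"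
| "sub_data _ _ = Null"

fun leq_data :: "data \<Rightarrow> data \<Rightarrow> data" where
  "leq_data (Num x) (Num y) = (if x \<le> y then Num 1 else Null)"
| "leq_data _ _ = Null"

fun val :: "exp \<Rightarrow> state \<Rightarrow> data" where
  "val (Var x) s = s x"
| "val NullE s = Null"
| "val (Lit n) s = Num (real n)"
| "val (PairE a b) s = Pair (val a s) (val b s)"
| "val (Fst a) s = fst_data (val a s)"
| "val (Snd a) s = snd_data (val a s)"
| "val (Add a b) s = add_data (val a s) (val b s)"
| "val (Sub a b) s = sub_data (val a s) (val b s)"
| "val (Leq a b) s = leq_data (val a s) (val b s)"

fun steps :: "exp \<Rightarrow> nat" where
  "steps (PairE a b) = 1 + steps a + steps b"
| "steps (Fst a) = 1 + steps a"
| "steps (Snd a) = 1 + steps a"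
| "steps (Add a b) = 1 + steps a + steps b"
| "steps (Sub a b) = 1 + steps a + steps b"
| "steps (Leq a b) = 1 + steps a + steps b"
| "steps _ = 1"

datatype com =
    Skip
  | Assign vname exp
  | Seq com com
  | Cond exp com com
  | Loop exp com
  | Call vname exp

text \<open>A procedure is given by its runs \<open>B d n r\<close>: on input \<open>d\<close> it halts after \<open>n\<close> steps with
  output \<open>r\<close>.  In \<open>exec B c s q n s'\<close> the list \<open>q\<close> collects the inputs of all executions of the
  procedure \<open>B\<close>, and \<open>n\<close> is the number of steps, including those spent in \<open>B\<close>.\<close>

type_synonym procedure = "data \<Rightarrow> nat \<Rightarrow> data \<Rightarrow> bool"

inductive exec :: "procedure \<Rightarrow> com \<Rightarrow> state \<Rightarrow> data list \<Rightarrow> nat \<Rightarrow> state \<Rightarrow> bool"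
  for B :: procedure where
  Skip: "exec B Skip s [] 1 s"
| Assign: "exec B (Assign x e) s [] (1 + steps e) (s(x := val e s))"
| Seq: "exec B c1 s q1 n1 s1 \<Longrightarrow> exec B c2 s1 q2 n2 s2 \<Longrightarrow>
    exec B (Seq c1 c2) s (q1 @ q2) (1 + n1 + n2) s2"
| CondTrue: "val e s \<noteq> Null \<Longrightarrow> exec B c1 s q n s' \<Longrightarrow>
    exec B (Cond e c1 c2) s q (1 + steps e + n) s'"
| CondFalse: "val e s = Null \<Longrightarrow> exec B c2 s q n s' \<Longrightarrow>
    exec B (Cond e c1 c2) s q (1 + steps e + n) s'"
| LoopFalse: "val e s = Null \<Longrightarrow> exec B (Loop e c) s [] (1 + steps e) s"
| LoopTrue: "val e s \<noteq> Null \<Longrightarrow> exec B c s q1 n1 s1 \<Longrightarrow> exec B (Loop e c) s1 q2 n2 s2 \<Longrightarrow>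
    exec B (Loop e c) s (q1 @ q2) (1 + steps e + n1 + n2) s2"
| Call: "B (val e s) n r \<Longrightarrow>
    exec B (Call x e) s [val e s] (1 + steps e + n) (s(x := r))"

definition runs :: "procedure \<Rightarrow> com \<Rightarrow> data \<Rightarrow> data list \<Rightarrow> nat \<Rightarrow> data \<Rightarrow> bool" where
  "runs B c d q n r \<longleftrightarrow> (\<exists>s. exec B c ((\<lambda>_. Null)(''in'' := d)) q n s \<and> s ''out'' = r)"

text \<open>A program that performs no calls, viewed as a procedure.\<close>

definition proc :: "com \<Rightarrow> procedure" where
  "proc c d n r \<longleftrightarrow> runs (\<lambda>_ _ _. False) c d [] n r"

text \<open>The language is deterministic, so that the existential quantifiers over runs below
  speak about the unique run.\<close>

lemma exec_deterministic:
  assumes B: "\<And>d n r n' r'. B d n r \<Longrightarrow> B d n' r' \<Longrightarrow> n = n' \<and> r = r'"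
    and "exec B c s q n t" and "exec B c s q' n' t'"
  shows "q = q' \<and> n = n' \<and> t = t'"
  using assms(2,3)
proof (induction arbitrary: q' n' t' rule: exec.induct)
  case (Skip s)
  from Skip.prems show ?case by cases auto
next
  case (Assign x e s)
  from Assign.prems show ?case by cases auto
next
  case (Seq c1 s q1 n1 s1 c2 q2 n2 s2)
  from Seq.prems obtain r1 m1 t1 r2 m2 where
    "exec B c1 s r1 m1 t1" "exec B c2 t1 r2 m2 t'" "q' = r1 @ r2" "n' = 1 + m1 + m2"
    by cases
  with Seq.IH(1)[of r1 m1 t1] Seq.IH(2)[of r2 m2 t'] show ?case by simp
next
  case (CondTrue e s c1 q n s' c2)
  from CondTrue.prems CondTrue.hyps(1) obtain m where
    "exec B c1 s q' m t'" "n' = 1 + steps e + m"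
    by cases auto
  with CondTrue.IH[of q' m t'] show ?case by simp
next
  case (CondFalse e s c2 q n s' c1)
  from CondFalse.prems CondFalse.hyps(1) obtain m where
    "exec B c2 s q' m t'" "n' = 1 + steps e + m"
    by cases auto
  with CondFalse.IH[of q' m t'] show ?case by simp
next
  case (LoopFalse e s c)
  from LoopFalse.prems LoopFalse.hyps show ?case by cases auto
next
  case (LoopTrue e s c q1 n1 s1 q2 n2 s2)
  from LoopTrue.prems LoopTrue.hyps(1) obtain r1 m1 t1 r2 m2 where
    "exec B c s r1 m1 t1" "exec B (Loop e c) t1 r2 m2 t'" "q' = r1 @ r2"
    "n' = 1 + steps e + m1 + m2"
    by cases auto
  with LoopTrue.IH(1)[of r1 m1 t1] LoopTrue.IH(2)[of r2 m2 t'] show ?case by simp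
next
  case (Call e s n r x)
  from Call.prems obtain m u where "B (val e s) m u" "q' = [val e s]" "n' = 1 + steps e + m"
    "t' = s(x := u)"
    by cases
  with B[of "val e s" n r m u] Call.hyps show ?case by simp
qed

lemma runs_deterministic:
  assumes B: "\<And>d n r n' r'. B d n r \<Longrightarrow> B d n' r' \<Longrightarrow> n = n' \<and> r = r'"
    and "runs B c d q n r" and "runs B c d q' n' r'"
  shows "q = q' \<and> n = n' \<and> r = r'"
proof -
  let ?s = "(\<lambda>_. Null)(''in'' := d)"
  from assms(2,3) obtain s s' where s: "exec B c ?s q n s" "s ''out'' = r"
    and s': "exec B c ?s q' n' s'" "s' ''out'' = r'"
    by (auto simp only: runs_def)
  have "q = q' \<and> n = n' \<and> s = s'"
    by (rule exec_deterministic[OF _ s(1) s'(1)]) (rule B)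
  with s(2) s'(2) show ?thesis by simp
qed

lemma proc_deterministic:
  assumes "proc c d n r" and "proc c d n' r'"
  shows "n = n' \<and> r = r'"
proof -
  have "([] :: data list) = [] \<and> n = n' \<and> r = r'"
    by (rule runs_deterministic[OF _ assms[unfolded proc_def]]) simp
  then show ?thesis by simp
qed

text \<open>On natural-number input all values are integers, so this is ordinary computability.\<close>

definition computable :: "(nat \<Rightarrow> nat) \<Rightarrow> bool" where
  "computable f \<longleftrightarrow> (\<exists>c. \<forall>m. \<exists>n. proc c (Num (real m)) n (Num (real (f m))))"


section \<open>Problems and algorithms\<close>

text \<open>\<open>encodes X I d\<close>: the tree \<open>d\<close> is an encoding of the instance \<open>I\<close> (there may be
  several, as sets are presented by lists in any order); \<open>answers X I r\<close>: the output \<open>r\<close> is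
  correct for \<open>I\<close>.\<close>

record 'i problem =
  instances :: "'i set"
  encodes :: "'i \<Rightarrow> data \<Rightarrow> bool"
  answers :: "'i \<Rightarrow> data \<Rightarrow> bool"

definition solves :: "procedure \<Rightarrow> com \<Rightarrow> 'i problem \<Rightarrow> bool" where
  "solves B c X \<longleftrightarrow>
    (\<forall>I\<in>instances X. \<forall>d. encodes X I d \<longrightarrow> (\<exists>q n r. runs B c d q n r \<and> answers X I r))"

definition solves_in_time ::
    "procedure \<Rightarrow> com \<Rightarrow> 'i problem \<Rightarrow> ('i \<Rightarrow> nat \<Rightarrow> nat) \<Rightarrow> bool" where
  "solves_in_time B c X T \<longleftrightarrow>
    (\<forall>I\<in>instances X. \<forall>d. encodes X I d \<longrightarrow>
      (\<exists>q n r. runs B c d q n r \<and> answers X I r \<and> n \<le> T I (dsize d)))"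

definition algorithm :: "com \<Rightarrow> 'i problem \<Rightarrow> bool" where
  "algorithm c X \<longleftrightarrow>
    (\<forall>I\<in>instances X. \<forall>d. encodes X I d \<longrightarrow> (\<exists>n r. proc c d n r \<and> answers X I r))"

definition polynomial_algorithm :: "com \<Rightarrow> 'i problem \<Rightarrow> bool" where
  "polynomial_algorithm c X \<longleftrightarrow>
    (\<exists>p :: nat poly. \<forall>I\<in>instances X. \<forall>d. encodes X I d \<longrightarrow>
      (\<exists>n r. proc c d n r \<and> answers X I r \<and> n \<le> poly p (dsize d)))"

definition fpt_algorithm :: "procedure \<Rightarrow> com \<Rightarrow> 'i problem \<Rightarrow> ('i \<Rightarrow> nat) \<Rightarrow> bool" where
  "fpt_algorithm B c X \<kappa> \<longleftrightarrow>
    (\<exists>f (p :: nat poly). computable f \<and>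
      solves_in_time B c X (\<lambda>I N. f (\<kappa> I) * poly p N))"

text \<open>Every execution of \<open>c\<close> on an instance \<open>I\<close> of \<open>X\<close> executes \<open>B\<close> exactly \<open>m I\<close> times, each
  time on an instance of \<open>Y\<close> related to \<open>I\<close> by \<open>R\<close>.\<close>

definition executes ::
    "procedure \<Rightarrow> com \<Rightarrow> 'i problem \<Rightarrow> ('i \<Rightarrow> nat) \<Rightarrow> 'j problem \<Rightarrow> ('j \<Rightarrow> 'i \<Rightarrow> bool) \<Rightarrow> bool" where
  "executes B c X m Y R \<longleftrightarrow>
    (\<forall>I\<in>instances X. \<forall>d q n r. encodes X I d \<and> runs B c d q n r \<longrightarrow>
      length q = m I \<and> (\<forall>x\<in>set q. \<exists>J\<in>instances Y. encodes Y J x \<and> R J I))"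


section \<open>Undirected multigraphs\<close>

record ('v, 'e) ugraph =
  nodes :: "'v set"
  edges :: "'e set"
  ends :: "'e \<Rightarrow> 'v set"

definition fin_ugraph :: "('v, 'e) ugraph \<Rightarrow> bool" where
  "fin_ugraph G \<longleftrightarrow> finite (nodes G) \<and> finite (edges G) \<and>
    (\<forall>e\<in>edges G. \<exists>u\<in>nodes G. \<exists>v\<in>nodes G. ends G e = {u, v})"

definition usubgraph :: "('v, 'e) ugraph \<Rightarrow> ('v, 'e) ugraph \<Rightarrow> bool" where
  "usubgraph H G \<longleftrightarrow> nodes H \<subseteq> nodes G \<and> edges H \<subseteq> edges G \<and>
    (\<forall>e\<in>edges H. ends H e = ends G e) \<and> fin_ugraph H \<and> fin_ugraph G"

definition upath :: "('v, 'e) ugraph \<Rightarrow> 'v \<Rightarrow> 'e list \<Rightarrow> 'v \<Rightarrow> bool" where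
  "upath G u p v \<longleftrightarrow> (\<exists>vs. length vs = length p + 1 \<and> hd vs = u \<and> last vs = v \<and>
    distinct vs \<and> set vs \<subseteq> nodes G \<and> set p \<subseteq> edges G \<and>
    (\<forall>i<length p. ends G (p ! i) = {vs ! i, vs ! (i + 1)}))"


section \<open>Encodings\<close>

fun list_data :: "data list \<Rightarrow> data" where
  "list_data [] = Null"
| "list_data (d # ds) = Pair d (list_data ds)"

definition nat_data :: "nat \<Rightarrow> data" where
  "nat_data n = Num (real n)"

definition nats_data :: "nat list \<Rightarrow> data" where
  "nats_data ns = list_data (map nat_data ns)"

definition set_code :: "nat set \<Rightarrow> data \<Rightarrow> bool" where
  "set_code S d \<longleftrightarrow> (\<exists>xs. distinct xs \<and> set xs = S \<and> d = nats_data xs)"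

definition some_data :: "data \<Rightarrow> data" where
  "some_data d = Pair d Null"

definition digraph_code :: "(nat, nat) pre_digraph \<Rightarrow> (nat \<Rightarrow> real) \<Rightarrow> data \<Rightarrow> bool" where
  "digraph_code D c d \<longleftrightarrow> (\<exists>vs as. distinct vs \<and> set vs = verts D \<and> distinct as \<and> set as = arcs D \<and>
    d = Pair (nats_data vs)
      (list_data (map (\<lambda>a. list_data [nat_data a, nat_data (tail D a), nat_data (head D a), Num (c a)]) as)))"

definition ugraph_code :: "(nat, nat) ugraph \<Rightarrow> (nat \<Rightarrow> real) \<Rightarrow> data \<Rightarrow> bool" where
  "ugraph_code G c d \<longleftrightarrow> (\<exists>vs es x y. distinct vs \<and> set vs = nodes G \<and> distinct es \<and> set es = edges G \<and>
    (\<forall>e\<in>edges G. ends G e = {x e, y e}) \<and>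
    d = Pair (nats_data vs)
      (list_data (map (\<lambda>e. list_data [nat_data e, nat_data (x e), nat_data (y e), Num (c e)]) es)))"


section \<open>Shortest path problems\<close>

record 'g sp_instance =
  graph :: 'g
  source :: nat
  target :: nat
  cost :: "nat \<Rightarrow> real"

definition sp_code :: "('g \<Rightarrow> (nat \<Rightarrow> real) \<Rightarrow> data \<Rightarrow> bool) \<Rightarrow> 'g sp_instance \<Rightarrow> data \<Rightarrow> bool" where
  "sp_code gcode I d \<longleftrightarrow> (\<exists>g. gcode (graph I) (cost I) g \<and>
    d = list_data [nat_data (source I), nat_data (target I), g])"

text \<open>\<open>paths\<close> is the set of source-target paths, as lists of arcs or edges.\<close>

definition sp_answer :: "nat list set \<Rightarrow> (nat \<Rightarrow> real) \<Rightarrow> data \<Rightarrow> bool" where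
  "sp_answer paths c r \<longleftrightarrow>
    (if paths = {} then r = Null
     else \<exists>p\<in>paths. (\<forall>p'\<in>paths. sum_list (map c p) \<le> sum_list (map c p')) \<and> r = some_data (nats_data p))"

definition shortest_dipath :: "(nat, nat) pre_digraph sp_instance problem" where
  "shortest_dipath = \<lparr>
    instances = {I. fin_digraph (graph I) \<and> source I \<in> verts (graph I) \<and> target I \<in> verts (graph I) \<and>
      (\<forall>a\<in>arcs (graph I). 0 \<le> cost I a)},
    encodes = sp_code digraph_code,
    answers = (\<lambda>I. sp_answer {p. pre_digraph.apath (graph I) (source I) p (target I)} (cost I)) \<rparr>"

definition shortest_upath :: "(nat, nat) ugraph sp_instance problem" where
  "shortest_upath = \<lparr>
    instances = {I. fin_ugraph (graph I) \<and> source I \<in> nodes (graph I) \<and> target I \<in> nodes (graph I) \<and>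
      (\<forall>e\<in>edges (graph I). 0 \<le> cost I e)},
    encodes = sp_code ugraph_code,
    answers = (\<lambda>I. sp_answer {p. upath (graph I) (source I) p (target I)} (cost I)) \<rparr>"


section \<open>Superset simultaneous paths\<close>

text \<open>The colour classes \<open>A_1, ..., A_k\<close> form the list \<open>classes\<close> of length \<open>k\<close>; they need not be
  distinct.\<close>

record 'g ssp_instance = "'g sp_instance" +
  classes :: "nat set list"

definition multicolored :: "nat set list \<Rightarrow> nat set" where
  "multicolored As = {a. \<exists>i<length As. \<exists>j<length As. i \<noteq> j \<and> a \<in> As ! i \<and> a \<in> As ! j}"

definition num_colors :: "'g ssp_instance \<Rightarrow> nat" where
  "num_colors I = length (classes I)"

definition num_multicolored :: "'g ssp_instance \<Rightarrow> nat" where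
  "num_multicolored I = card (multicolored (classes I))"

definition conservative :: "('v, 'e) pre_digraph \<Rightarrow> ('e \<Rightarrow> real) \<Rightarrow> bool" where
  "conservative D c \<longleftrightarrow> (\<forall>p. pre_digraph.cycle D p \<longrightarrow> 0 \<le> sum_list (map c p))"

definition ssp_code :: "('g \<Rightarrow> (nat \<Rightarrow> real) \<Rightarrow> data \<Rightarrow> bool) \<Rightarrow> 'g ssp_instance \<Rightarrow> data \<Rightarrow> bool" where
  "ssp_code gcode I d \<longleftrightarrow> (\<exists>g cs. gcode (graph I) (cost I) g \<and> list_all2 set_code (classes I) cs \<and>
    d = list_data [nat_data (source I), nat_data (target I), g, list_data cs])"

definition ssp_feasible :: "nat set \<Rightarrow> nat list set \<Rightarrow> nat set list \<Rightarrow> nat set \<Rightarrow> bool" where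
  "ssp_feasible A paths As A' \<longleftrightarrow>
    A' \<subseteq> A \<and> (\<forall>i<length As. \<exists>p\<in>paths. set p \<subseteq> A' \<inter> As ! i)"

definition ssp_answer :: "nat set \<Rightarrow> nat list set \<Rightarrow> nat set list \<Rightarrow> (nat \<Rightarrow> real) \<Rightarrow> data \<Rightarrow> bool" where
  "ssp_answer A paths As c r \<longleftrightarrow>
    (if \<exists>A'. ssp_feasible A paths As A'
     then \<exists>A' d. ssp_feasible A paths As A' \<and>
       (\<forall>A''. ssp_feasible A paths As A'' \<longrightarrow> sum c A' \<le> sum c A'') \<and>
       set_code A' d \<and> r = some_data d
     else r = Null)"

definition superset_simultaneous_dipaths :: "(nat, nat) pre_digraph ssp_instance problem" where
  "superset_simultaneous_dipaths = \<lparr>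
    instances = {I. fin_digraph (graph I) \<and> classes I \<noteq> [] \<and> arcs (graph I) = \<Union>(set (classes I)) \<and>
      source I \<in> verts (graph I) \<and> target I \<in> verts (graph I) \<and> source I \<noteq> target I \<and>
      conservative (graph I) (cost I)},
    encodes = ssp_code digraph_code,
    answers = (\<lambda>I. ssp_answer (arcs (graph I))
      {p. pre_digraph.apath (graph I) (source I) p (target I)} (classes I) (cost I)) \<rparr>"

definition superset_simultaneous_paths :: "(nat, nat) ugraph ssp_instance problem" where
  "superset_simultaneous_paths = \<lparr>
    instances = {I. fin_ugraph (graph I) \<and> classes I \<noteq> [] \<and> edges (graph I) = \<Union>(set (classes I)) \<and>
      source I \<in> nodes (graph I) \<and> target I \<in> nodes (graph I) \<and> source I \<noteq> target I \<and>
      (\<forall>e\<in>edges (graph I). 0 \<le> cost I e)},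
    encodes = ssp_code ugraph_code,
    answers = (\<lambda>I. ssp_answer (edges (graph I))
      {p. upath (graph I) (source I) p (target I)} (classes I) (cost I)) \<rparr>"

end

theory Submission
  imports Defs
begin

text \<open>
  Let \<open>M\<close> be the set of multi-colored arcs.  For every \<open>X \<subseteq> M\<close>, the guess for \<open>A' \<inter> M\<close>, and every
  class \<open>A\<^sub>i\<close> compute a shortest path in \<open>A\<^sub>i - M \<union> A\<^sub>i \<inter> X\<close>, where arcs of \<open>X\<close> cost nothing and
  negative costs are raised to zero.  Together with \<open>X\<close> and all arcs of nonpositive cost, which a
  superset contains for free, the paths form a feasible set, and the cheapest of these sets is
  optimal, since arcs outside \<open>M\<close> belong to a single class.  The shortest path algorithm itself is Dijkstra's.

  Both programs are written in a small first-order functional language with folds, whose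
  translation into WHILE is proved correct and time preserving up to a constant factor.
\<close>

section \<open>A functional language compiled to WHILE\<close>

text \<open>The program is fixed before the shortest path algorithm is known, so it has to be
  correct whichever shortest path comes back, and the number of executions may not depend on the
  answers. Terms of the functional language therefore have three meanings, the value
  \<open>ev\<close>, the list of requests \<open>calls\<close> and the step count
  \<open>time\<close>, all computed from an oracle function \<open>R\<close>; the simulation theorem
  \<open>computes_to_com\<close> transfers all three to WHILE. A guess turns the shared arcs into a
  fixed cost, and what remains decouples into the k classes; this gives k requests for each of the
  2^l guesses. A request is never larger than the instance, so a polynomial bound for the shortest
  path algorithm carries over and only the factor 2^l is exponential. The program copies the ends of
  an arc without looking at them. Hence one term, \<open>t_superset\<close>, serves digraphs and
  undirected graphs, and its analysis in \<open>ssp_run\<close> sees a graph only as a list of arcs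
  and a set of paths that is cut down when arcs are deleted.\<close>

datatype unop = UFst | USnd
datatype binop = BPair | BAdd | BSub | BLeq

text \<open>Variables are de Bruijn levels: the environment is a list that grows at its right end.
  \<open>TFold l i b\<close> evaluates \<open>b\<close> with the accumulator and the current list element appended,
  \<open>TSub js t\<close> evaluates \<open>t\<close> in the environment consisting of the variables \<open>js\<close> only, and
  \<open>TOrc\<close> executes the procedure.\<close>

datatype tm =
    TVar nat
  | TNull
  | TLit nat
  | TUn unop tm
  | TBin binop tm tm
  | TIf tm tm tm
  | TLet tm tm
  | TFold tm tm tm
  | TSub "nat list" tm
  | TOrc tm

fun un_sem :: "unop \<Rightarrow> data \<Rightarrow> data" where
  "un_sem UFst = fst_data"
| "un_sem USnd = snd_data"

fun bin_sem :: "binop \<Rightarrow> data \<Rightarrow> data \<Rightarrow> data" where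
  "bin_sem BPair = Pair"
| "bin_sem BAdd = add_data"
| "bin_sem BSub = sub_data"
| "bin_sem BLeq = leq_data"

fun un_exp :: "unop \<Rightarrow> exp \<Rightarrow> exp" where
  "un_exp UFst = Fst"
| "un_exp USnd = Snd"

fun bin_exp :: "binop \<Rightarrow> exp \<Rightarrow> exp \<Rightarrow> exp" where
  "bin_exp BPair = PairE"
| "bin_exp BAdd = Add"
| "bin_exp BSub = Sub"
| "bin_exp BLeq = Leq"

text \<open>A loop over a non-\<open>Null\<close> atom runs once.\<close>

fun elems :: "data \<Rightarrow> data list" where
  "elems Null = []"
| "elems (Num _) = [Null]"
| "elems (Pair a b) = a # elems b"

text \<open>The accumulator is threaded through by \<open>f\<close>, because what an iteration
  requests, and in \<open>fold_time\<close> how long it takes, depends on the accumulator it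
  meets.\<close>

primrec fold_log :: "('x \<Rightarrow> 'b \<Rightarrow> 'b) \<Rightarrow> ('x \<Rightarrow> 'b \<Rightarrow> 'c list) \<Rightarrow> 'x list \<Rightarrow> 'b \<Rightarrow> 'c list" where
  "fold_log f g [] b = []"
| "fold_log f g (x # xs) b = g x b @ fold_log f g xs (f x b)"

primrec fold_time :: "('x \<Rightarrow> 'b \<Rightarrow> 'b) \<Rightarrow> ('x \<Rightarrow> 'b \<Rightarrow> nat) \<Rightarrow> 'x list \<Rightarrow> 'b \<Rightarrow> nat" where
  "fold_time f g [] b = 0"
| "fold_time f g (x # xs) b = 1 + g x b + fold_time f g xs (f x b)"

primrec ev :: "(data \<Rightarrow> data) \<Rightarrow> tm \<Rightarrow> data list \<Rightarrow> data" where
  "ev R (TVar i) env = env ! i"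
| "ev R TNull env = Null"
| "ev R (TLit n) env = Num (real n)"
| "ev R (TUn f t) env = un_sem f (ev R t env)"
| "ev R (TBin f t u) env = bin_sem f (ev R t env) (ev R u env)"
| "ev R (TIf c t u) env = (if ev R c env \<noteq> Null then ev R t env else ev R u env)"
| "ev R (TLet t u) env = ev R u (env @ [ev R t env])"
| "ev R (TFold l i b) env =
    fold (\<lambda>x acc. ev R b (env @ [acc, x])) (elems (ev R l env)) (ev R i env)"
| "ev R (TSub js t) env = ev R t (map ((!) env) js)"
| "ev R (TOrc t) env = R (ev R t env)"

text \<open>The initial value of a fold comes before its list, and only the chosen branch of a
  conditional contributes: the log is ordered exactly as in the compiled program.\<close>

primrec calls :: "(data \<Rightarrow> data) \<Rightarrow> tm \<Rightarrow> data list \<Rightarrow> data list" where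
  "calls R (TVar i) env = []"
| "calls R TNull env = []"
| "calls R (TLit n) env = []"
| "calls R (TUn f t) env = calls R t env"
| "calls R (TBin f t u) env = calls R t env @ calls R u env"
| "calls R (TIf c t u) env =
    calls R c env @ (if ev R c env \<noteq> Null then calls R t env else calls R u env)"
| "calls R (TLet t u) env = calls R t env @ calls R u (env @ [ev R t env])"
| "calls R (TFold l i b) env = calls R i env @ calls R l env @
    fold_log (\<lambda>x acc. ev R b (env @ [acc, x])) (\<lambda>x acc. calls R b (env @ [acc, x]))
      (elems (ev R l env)) (ev R i env)"
| "calls R (TSub js t) env = calls R t (map ((!) env) js)"
| "calls R (TOrc t) env = calls R t env @ [ev R t env]"

text \<open>A request counts as one step; the steps spent inside the procedure are accounted for
  separately by \<open>T\<close> in \<open>computes\<close>. \<open>TSub\<close> is free because it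
  only renames registers at compile time.\<close>

primrec time :: "(data \<Rightarrow> data) \<Rightarrow> tm \<Rightarrow> data list \<Rightarrow> nat" where
  "time R (TVar i) env = 1"
| "time R TNull env = 1"
| "time R (TLit n) env = 1"
| "time R (TUn f t) env = 1 + time R t env"
| "time R (TBin f t u) env = 1 + time R t env + time R u env"
| "time R (TIf c t u) env =
    1 + time R c env + (if ev R c env \<noteq> Null then time R t env else time R u env)"
| "time R (TLet t u) env = 1 + time R t env + time R u (env @ [ev R t env])"
| "time R (TFold l i b) env = 1 + time R i env + time R l env +
    fold_time (\<lambda>x acc. ev R b (env @ [acc, x])) (\<lambda>x acc. time R b (env @ [acc, x]))
      (elems (ev R l env)) (ev R i env)"
| "time R (TSub js t) env = time R t (map ((!) env) js)"
| "time R (TOrc t) env = 1 + time R t env"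

primrec scoped :: "nat \<Rightarrow> tm \<Rightarrow> bool" where
  "scoped k (TVar i) \<longleftrightarrow> i < k"
| "scoped k TNull \<longleftrightarrow> True"
| "scoped k (TLit n) \<longleftrightarrow> True"
| "scoped k (TUn f t) \<longleftrightarrow> scoped k t"
| "scoped k (TBin f t u) \<longleftrightarrow> scoped k t \<and> scoped k u"
| "scoped k (TIf c t u) \<longleftrightarrow> scoped k c \<and> scoped k t \<and> scoped k u"
| "scoped k (TLet t u) \<longleftrightarrow> scoped k t \<and> scoped (k + 1) u"
| "scoped k (TFold l i b) \<longleftrightarrow> scoped k l \<and> scoped k i \<and> scoped (k + 2) b"
| "scoped k (TSub js t) \<longleftrightarrow> (\<forall>j\<in>set js. j < k) \<and> scoped (length js) t"
| "scoped k (TOrc t) \<longleftrightarrow> scoped k t"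

primrec call_free :: "tm \<Rightarrow> bool" where
  "call_free (TVar i) \<longleftrightarrow> True"
| "call_free TNull \<longleftrightarrow> True"
| "call_free (TLit n) \<longleftrightarrow> True"
| "call_free (TUn f t) \<longleftrightarrow> call_free t"
| "call_free (TBin f t u) \<longleftrightarrow> call_free t \<and> call_free u"
| "call_free (TIf c t u) \<longleftrightarrow> call_free c \<and> call_free t \<and> call_free u"
| "call_free (TLet t u) \<longleftrightarrow> call_free t \<and> call_free u"
| "call_free (TFold l i b) \<longleftrightarrow> call_free l \<and> call_free i \<and> call_free b"
| "call_free (TSub js t) \<longleftrightarrow> call_free t"
| "call_free (TOrc t) \<longleftrightarrow> False"

lemma fold_log_Nil: "(\<And>x b. g x b = []) \<Longrightarrow> fold_log f g xs b = []"
  by (induction xs arbitrary: b) auto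

lemma calls_call_free: "call_free t \<Longrightarrow> calls R t env = []"
  by (induction t arbitrary: env) (auto intro!: fold_log_Nil)

section \<open>Compilation and its simulation theorem\<close>

definition reg :: "nat \<Rightarrow> vname" where
  "reg n = replicate n CHR ''x''"

lemma reg_inject [simp]: "reg m = reg n \<longleftrightarrow> m = n"
  unfolding reg_def by (metis length_replicate)

text \<open>\<open>to_com \<rho> n t\<close> leaves the value of \<open>t\<close> in register \<open>n\<close> and preserves all smaller registers;
  variable \<open>i\<close> is found in register \<open>\<rho> ! i\<close>.\<close>

primrec to_com :: "nat list \<Rightarrow> nat \<Rightarrow> tm \<Rightarrow> com" where
  "to_com \<rho> n (TVar i) = Assign (reg n) (Var (reg (\<rho> ! i)))"
| "to_com \<rho> n TNull = Assign (reg n) NullE"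
| "to_com \<rho> n (TLit m) = Assign (reg n) (Lit m)"
| "to_com \<rho> n (TUn f t) = Seq (to_com \<rho> n t) (Assign (reg n) (un_exp f (Var (reg n))))"
| "to_com \<rho> n (TBin f t u) = Seq (to_com \<rho> n t) (Seq (to_com \<rho> (n + 1) u)
    (Assign (reg n) (bin_exp f (Var (reg n)) (Var (reg (n + 1))))))"
| "to_com \<rho> n (TIf c t u) = Seq (to_com \<rho> n c) (Cond (Var (reg n)) (to_com \<rho> n t) (to_com \<rho> n u))"
| "to_com \<rho> n (TLet t u) = Seq (to_com \<rho> n t) (Seq (to_com (\<rho> @ [n]) (n + 1) u)
    (Assign (reg n) (Var (reg (n + 1)))))"
| "to_com \<rho> n (TFold l i b) = Seq (to_com \<rho> n i) (Seq (to_com \<rho> (n + 1) l)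
    (Loop (Var (reg (n + 1)))
      (Seq (Assign (reg (n + 2)) (Fst (Var (reg (n + 1)))))
      (Seq (Assign (reg (n + 1)) (Snd (Var (reg (n + 1)))))
      (Seq (to_com (\<rho> @ [n, n + 2]) (n + 3) b)
        (Assign (reg n) (Var (reg (n + 3)))))))))"
| "to_com \<rho> n (TSub js t) = to_com (map ((!) \<rho>) js) n t"
| "to_com \<rho> n (TOrc t) = Seq (to_com \<rho> n t) (Call (reg n) (Var (reg n)))"

text \<open>One step of \<^const>\<open>time\<close> costs at most 20 steps of the compiled program.\<close>

definition computes ::
    "procedure \<Rightarrow> (data \<Rightarrow> nat) \<Rightarrow> com \<Rightarrow> nat \<Rightarrow> state \<Rightarrow> data list \<Rightarrow> nat \<Rightarrow> data \<Rightarrow> bool" where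
  "computes B T c n s q k v \<longleftrightarrow> (\<exists>m s'. exec B c s q m s' \<and> m \<le> 20 * k + sum_list (map T q) \<and>
    s' (reg n) = v \<and> (\<forall>j<n. s' (reg j) = s (reg j)))"

lemma computesE:
  assumes "computes B T c n s q k v"
  obtains m s' where "exec B c s q m s'" "m \<le> 20 * k + sum_list (map T q)"
    "s' (reg n) = v" "\<And>j. j < n \<Longrightarrow> s' (reg j) = s (reg j)"
  using assms unfolding computes_def by blast

lemma computesI:
  assumes "exec B c s q' m s'" "q' = q" "m \<le> 20 * k + sum_list (map T q)"
    "s' (reg n) = v" "\<And>j. j < n \<Longrightarrow> s' (reg j) = s (reg j)"
  shows "computes B T c n s q k v"
  using assms unfolding computes_def by blast

lemma elems_step: "d \<noteq> Null \<Longrightarrow> elems d = fst_data d # elems (snd_data d)"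
  by (cases d) auto

lemma elems_eq_Nil: "elems d = [] \<longleftrightarrow> d = Null"
  by (cases d) auto

lemma steps_un_exp [simp]: "steps (un_exp f e) = 1 + steps e"
  by (cases f) auto

lemma steps_bin_exp [simp]: "steps (bin_exp f d e) = 1 + steps d + steps e"
  by (cases f) auto

lemma val_un_exp [simp]: "val (un_exp f e) s = un_sem f (val e s)"
  by (cases f) auto

lemma val_bin_exp [simp]: "val (bin_exp f d e) s = bin_sem f (val d s) (val e s)"
  by (cases f) auto

text \<open>\<open>s0\<close> is a snapshot of the registers below \<open>n\<close>, fixed while the
  state \<open>s\<close> changes in the induction. The set \<open>A\<close> limits the premise on
  the body to requests on which the procedure is known to halt. The summand 2 is the final failing
  test; an iteration adds 13 steps to those of its body, which the unit in \<open>fold_time\<close>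
  covers.\<close>

lemma computes_loop:
  assumes body: "\<And>s x acc. s (reg n) = acc \<Longrightarrow> s (reg (n + 2)) = x \<Longrightarrow>
      (\<forall>j<n. s (reg j) = s0 (reg j)) \<Longrightarrow> set (g x acc) \<subseteq> A \<Longrightarrow>
      computes B T c (n + 3) s (g x acc) (h x acc) (f x acc)"
    and "set (fold_log f g (elems d) acc) \<subseteq> A"
    and "s (reg n) = acc" "s (reg (n + 1)) = d" "\<forall>j<n. s (reg j) = s0 (reg j)"
  shows "\<exists>m s'. exec B (Loop (Var (reg (n + 1)))
      (Seq (Assign (reg (n + 2)) (Fst (Var (reg (n + 1)))))
      (Seq (Assign (reg (n + 1)) (Snd (Var (reg (n + 1)))))
      (Seq c (Assign (reg n) (Var (reg (n + 3)))))))) s (fold_log f g (elems d) acc) m s' \<and>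
    m \<le> 2 + 20 * fold_time f h (elems d) acc + sum_list (map T (fold_log f g (elems d) acc)) \<and>
    s' (reg n) = fold f (elems d) acc \<and> (\<forall>j<n. s' (reg j) = s0 (reg j))"
  using assms(2-)
proof (induction "elems d" arbitrary: d acc s)
  case Nil
  then have "d = Null" by (metis elems_eq_Nil)
  with Nil show ?case
    by (intro exI[of _ 2] exI[of _ s]) (auto intro: LoopFalse[of "Var (reg (n + 1))", simplified] simp: numeral_2_eq_2)
next
  case (Cons x xs)
  then have d: "d \<noteq> Null" by auto
  then have x: "x = fst_data d" and xs: "xs = elems (snd_data d)"
    using elems_step[OF d] Cons(2) by auto
  note d_eq = elems_step[OF d]
  let ?s1 = "s(reg (n + 2) := fst_data d)"
  let ?s2 = "?s1(reg (n + 1) := snd_data d)"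
  have "computes B T c (n + 3) ?s2 (g x acc) (h x acc) (f x acc)"
    by (rule body) (use Cons.prems d_eq x in auto)
  then obtain m s3 where e3: "exec B c ?s2 (g x acc) m s3"
    and m: "m \<le> 20 * h x acc + sum_list (map T (g x acc))"
    and v: "s3 (reg (n + 3)) = f x acc" "\<And>j. j < n + 3 \<Longrightarrow> s3 (reg j) = ?s2 (reg j)"
    by (rule computesE) blast
  let ?s4 = "s3(reg n := f x acc)"
  have "\<exists>m s'. exec B (Loop (Var (reg (n + 1)))
      (Seq (Assign (reg (n + 2)) (Fst (Var (reg (n + 1)))))
      (Seq (Assign (reg (n + 1)) (Snd (Var (reg (n + 1)))))
      (Seq c (Assign (reg n) (Var (reg (n + 3)))))))) ?s4
      (fold_log f g (elems (snd_data d)) (f x acc)) m s' \<and>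
    m \<le> 2 + 20 * fold_time f h (elems (snd_data d)) (f x acc) +
      sum_list (map T (fold_log f g (elems (snd_data d)) (f x acc))) \<and>
    s' (reg n) = fold f (elems (snd_data d)) (f x acc) \<and> (\<forall>j<n. s' (reg j) = s0 (reg j))"
    by (rule Cons.hyps(1)) (use xs v Cons.prems d_eq x in auto)
  then obtain m' s' where e': "exec B (Loop (Var (reg (n + 1)))
      (Seq (Assign (reg (n + 2)) (Fst (Var (reg (n + 1)))))
      (Seq (Assign (reg (n + 1)) (Snd (Var (reg (n + 1)))))
      (Seq c (Assign (reg n) (Var (reg (n + 3)))))))) ?s4
      (fold_log f g (elems (snd_data d)) (f x acc)) m' s'"
    and m': "m' \<le> 2 + 20 * fold_time f h (elems (snd_data d)) (f x acc) +
      sum_list (map T (fold_log f g (elems (snd_data d)) (f x acc)))"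
    and r': "s' (reg n) = fold f (elems (snd_data d)) (f x acc)" "\<forall>j<n. s' (reg j) = s0 (reg j)"
    by blast
  have a1: "exec B (Assign (reg (n + 2)) (Fst (Var (reg (n + 1))))) s [] (Suc (Suc (Suc 0))) ?s1"
    using exec.Assign[of B "reg (n + 2)" "Fst (Var (reg (n + 1)))" s] Cons.prems by simp
  have a2: "exec B (Assign (reg (n + 1)) (Snd (Var (reg (n + 1))))) ?s1 [] (Suc (Suc (Suc 0))) ?s2"
    using exec.Assign[of B "reg (n + 1)" "Snd (Var (reg (n + 1)))" ?s1] Cons.prems by simp
  have a3: "exec B (Assign (reg n) (Var (reg (n + 3)))) s3 [] (Suc (Suc 0)) ?s4"
    using exec.Assign[of B "reg n" "Var (reg (n + 3))" s3] v by simp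
  note b = exec.Seq[OF a1 exec.Seq[OF a2 exec.Seq[OF e3 a3]]]
  have "val (Var (reg (n + 1))) s \<noteq> Null"
    using d Cons.prems by simp
  note l = exec.LoopTrue[OF this b e']
  show ?case
    by (rule exI, rule exI, rule conjI)
      (use l m m' r' x in \<open>auto simp: d_eq\<close>)
qed

text \<open>The induction carries that all variables live in registers below \<open>n\<close>: the
  code of a subterm may overwrite anything from \<open>n\<close> on without touching them. The
  procedure is constrained only on inputs that are really requested, since elsewhere it may
  diverge.\<close>

lemma computes_to_com:
  assumes "scoped (length \<rho>) t" "length env = length \<rho>"
    and "\<And>i. i < length \<rho> \<Longrightarrow> \<rho> ! i < n \<and> s (reg (\<rho> ! i)) = env ! i"
    and "\<And>x. x \<in> set (calls R t env) \<Longrightarrow> B x (T x) (R x)"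
  shows "computes B T (to_com \<rho> n t) n s (calls R t env) (time R t env) (ev R t env)"
  using assms
proof (induction t arbitrary: \<rho> n s env)
  case (TVar i)
  show ?case unfolding to_com.simps
    by (rule computesI[OF exec.Assign[of B "reg n" "Var (reg (\<rho> ! i))" s]]) (use TVar in auto)
next
  case TNull
  show ?case unfolding to_com.simps
    by (rule computesI[OF exec.Assign[of B "reg n" "NullE" s]]) auto
next
  case (TLit i)
  show ?case unfolding to_com.simps
    by (rule computesI[OF exec.Assign[of B "reg n" "Lit i" s]]) (use TLit in auto)
next
  case (TUn f t)
  have "computes B T (to_com \<rho> n t) n s (calls R t env) (time R t env) (ev R t env)"
    by (rule TUn.IH) (use TUn.prems in auto)
  then obtain m s' where e: "exec B (to_com \<rho> n t) s (calls R t env) m s'"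
    and m: "m \<le> 20 * time R t env + sum_list (map T (calls R t env))"
    and v: "s' (reg n) = ev R t env" "\<And>j. j < n \<Longrightarrow> s' (reg j) = s (reg j)"
    by (rule computesE) blast
  show ?case unfolding to_com.simps
    by (rule computesI[OF exec.Seq[OF e exec.Assign[of B "reg n" "un_exp f (Var (reg n))" s']]])
      (use m v in \<open>auto simp: algebra_simps\<close>)
next
  case (TBin f t u)
  have "computes B T (to_com \<rho> n t) n s (calls R t env) (time R t env) (ev R t env)"
    by (rule TBin.IH(1)) (use TBin.prems in auto)
  then obtain m s' where e: "exec B (to_com \<rho> n t) s (calls R t env) m s'"
    and m: "m \<le> 20 * time R t env + sum_list (map T (calls R t env))"
    and v: "s' (reg n) = ev R t env" "\<And>j. j < n \<Longrightarrow> s' (reg j) = s (reg j)"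
    by (rule computesE) blast
  have "computes B T (to_com \<rho> (n + 1) u) (n + 1) s' (calls R u env) (time R u env) (ev R u env)"
    by (rule TBin.IH(2)) (use TBin.prems v in \<open>auto simp: less_Suc_eq\<close>)
  then obtain m' s'' where e': "exec B (to_com \<rho> (n + 1) u) s' (calls R u env) m' s''"
    and m': "m' \<le> 20 * time R u env + sum_list (map T (calls R u env))"
    and v': "s'' (reg (n + 1)) = ev R u env" "\<And>j. j < n + 1 \<Longrightarrow> s'' (reg j) = s' (reg j)"
    by (rule computesE) blast
  note a = exec.Assign[of B "reg n" "bin_exp f (Var (reg n)) (Var (reg (n + 1)))" s'']
  show ?case unfolding to_com.simps
    by (rule computesI[OF exec.Seq[OF e exec.Seq[OF e' a]]])
      (use m v m' v' in \<open>auto simp: algebra_simps\<close>)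
next
  case (TIf c t u)
  have "computes B T (to_com \<rho> n c) n s (calls R c env) (time R c env) (ev R c env)"
    by (rule TIf.IH(1)) (use TIf.prems in auto)
  then obtain m s' where e: "exec B (to_com \<rho> n c) s (calls R c env) m s'"
    and m: "m \<le> 20 * time R c env + sum_list (map T (calls R c env))"
    and v: "s' (reg n) = ev R c env" "\<And>j. j < n \<Longrightarrow> s' (reg j) = s (reg j)"
    by (rule computesE) blast
  show ?case
  proof (cases "ev R c env = Null")
    case False
    have "computes B T (to_com \<rho> n t) n s' (calls R t env) (time R t env) (ev R t env)"
      by (rule TIf.IH(2)) (use TIf.prems v False in auto)
    then obtain m' s'' where e': "exec B (to_com \<rho> n t) s' (calls R t env) m' s''"
      and m': "m' \<le> 20 * time R t env + sum_list (map T (calls R t env))"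
      and v': "s'' (reg n) = ev R t env" "\<And>j. j < n \<Longrightarrow> s'' (reg j) = s' (reg j)"
      by (rule computesE) blast
    have c: "val (Var (reg n)) s' \<noteq> Null" using v False by simp
    show ?thesis unfolding to_com.simps
      by (rule computesI[OF exec.Seq[OF e exec.CondTrue[OF c e', of "to_com \<rho> n u"]]])
      (use m v m' v' False in \<open>auto simp: algebra_simps\<close>)
  next
    case True
    have "computes B T (to_com \<rho> n u) n s' (calls R u env) (time R u env) (ev R u env)"
      by (rule TIf.IH(3)) (use TIf.prems v True in auto)
    then obtain m' s'' where e': "exec B (to_com \<rho> n u) s' (calls R u env) m' s''"
      and m': "m' \<le> 20 * time R u env + sum_list (map T (calls R u env))"
      and v': "s'' (reg n) = ev R u env" "\<And>j. j < n \<Longrightarrow> s'' (reg j) = s' (reg j)"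
      by (rule computesE) blast
    have c: "val (Var (reg n)) s' = Null" using v True by simp
    show ?thesis unfolding to_com.simps
      by (rule computesI[OF exec.Seq[OF e exec.CondFalse[OF c e', of "to_com \<rho> n t"]]])
      (use m v m' v' True in \<open>auto simp: algebra_simps\<close>)
  qed
next
  case (TLet t u)
  have "computes B T (to_com \<rho> n t) n s (calls R t env) (time R t env) (ev R t env)"
    by (rule TLet.IH(1)) (use TLet.prems in auto)
  then obtain m s' where e: "exec B (to_com \<rho> n t) s (calls R t env) m s'"
    and m: "m \<le> 20 * time R t env + sum_list (map T (calls R t env))"
    and v: "s' (reg n) = ev R t env" "\<And>j. j < n \<Longrightarrow> s' (reg j) = s (reg j)"
    by (rule computesE) blast
  let ?env = "env @ [ev R t env]"
  have "computes B T (to_com (\<rho> @ [n]) (n + 1) u) (n + 1) s' (calls R u ?env) (time R u ?env) (ev R u ?env)"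
    by (rule TLet.IH(2)) (use TLet.prems v in \<open>auto simp: nth_append less_Suc_eq\<close>)
  then obtain m' s'' where e': "exec B (to_com (\<rho> @ [n]) (n + 1) u) s' (calls R u ?env) m' s''"
    and m': "m' \<le> 20 * time R u ?env + sum_list (map T (calls R u ?env))"
    and v': "s'' (reg (n + 1)) = ev R u ?env" "\<And>j. j < n + 1 \<Longrightarrow> s'' (reg j) = s' (reg j)"
    by (rule computesE) blast
  show ?case unfolding to_com.simps
    by (rule computesI[OF exec.Seq[OF e exec.Seq[OF e' exec.Assign[of B "reg n" "Var (reg (n + 1))" s'']]]])
      (use m v m' v' in \<open>auto simp: algebra_simps\<close>)
next
  case (TFold l i b)
  have "computes B T (to_com \<rho> n i) n s (calls R i env) (time R i env) (ev R i env)"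
    by (rule TFold.IH(2)) (use TFold.prems in auto)
  then obtain m s' where e: "exec B (to_com \<rho> n i) s (calls R i env) m s'"
    and m: "m \<le> 20 * time R i env + sum_list (map T (calls R i env))"
    and v: "s' (reg n) = ev R i env" "\<And>j. j < n \<Longrightarrow> s' (reg j) = s (reg j)"
    by (rule computesE) blast
  have "computes B T (to_com \<rho> (n + 1) l) (n + 1) s' (calls R l env) (time R l env) (ev R l env)"
    by (rule TFold.IH(1)) (use TFold.prems v in \<open>auto simp: less_Suc_eq\<close>)
  then obtain m' s'' where e': "exec B (to_com \<rho> (n + 1) l) s' (calls R l env) m' s''"
    and m': "m' \<le> 20 * time R l env + sum_list (map T (calls R l env))"
    and v': "s'' (reg (n + 1)) = ev R l env" "\<And>j. j < n + 1 \<Longrightarrow> s'' (reg j) = s' (reg j)"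
    by (rule computesE) blast
  let ?f = "\<lambda>x acc. ev R b (env @ [acc, x])"
  let ?g = "\<lambda>x acc. calls R b (env @ [acc, x])"
  let ?h = "\<lambda>x acc. time R b (env @ [acc, x])"
  let ?xs = "elems (ev R l env)" and ?a = "ev R i env"
  \<comment> \<open>Register \<open>n\<close> holds the accumulator, \<open>n + 1\<close> the rest
    of the list and \<open>n + 2\<close> the current element; the body sees the first and the last
    and works from \<open>n + 3\<close> on.\<close>
  let ?\<rho> = "\<rho> @ [n, n + 2]"
  have loc: "?\<rho> ! j < n + 3 \<and> s1 (reg (?\<rho> ! j)) = (env @ [s1 (reg n), s1 (reg (n + 2))]) ! j"
    if s1: "\<forall>j<n. s1 (reg j) = s'' (reg j)" and j: "j < length ?\<rho>" for s1 j
  proof -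
    from j consider "j < length \<rho>" | "j = length \<rho>" | "j = Suc (length \<rho>)"
      by fastforce
    then show ?thesis
    proof cases
      case 1
      with TFold.prems(2) TFold.prems(3)[of j] s1 v(2)[of "\<rho> ! j"] v'(2)[of "\<rho> ! j"] show ?thesis
        by (auto simp: nth_append)
    qed (use TFold.prems(2) in \<open>simp_all add: nth_append\<close>)
  qed
  have body: "computes B T (to_com ?\<rho> (n + 3) b) (n + 3) s1 (?g x acc) (?h x acc) (?f x acc)"
    if s1: "s1 (reg n) = acc" "s1 (reg (n + 2)) = x" "\<forall>j<n. s1 (reg j) = s'' (reg j)"
      and g: "set (?g x acc) \<subseteq> {x. B x (T x) (R x)}" for s1 x acc
    by (rule TFold.IH(3)) (use TFold.prems g loc[OF s1(3), unfolded s1] in auto)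
  obtain m3 s3 where e3: "exec B (Loop (Var (reg (n + 1)))
      (Seq (Assign (reg (n + 2)) (Fst (Var (reg (n + 1)))))
      (Seq (Assign (reg (n + 1)) (Snd (Var (reg (n + 1)))))
      (Seq (to_com ?\<rho> (n + 3) b) (Assign (reg n) (Var (reg (n + 3)))))))) s''
      (fold_log ?f ?g ?xs ?a) m3 s3"
    and m3: "m3 \<le> 2 + 20 * fold_time ?f ?h ?xs ?a + sum_list (map T (fold_log ?f ?g ?xs ?a))"
    and v3: "s3 (reg n) = fold ?f ?xs ?a" "\<forall>j<n. s3 (reg j) = s'' (reg j)"
    using computes_loop[of n s'' ?g "{x. B x (T x) (R x)}" B T "to_com ?\<rho> (n + 3) b" ?h ?f
        "ev R l env" ?a s'', OF body] TFold.prems(4) v v' by fastforce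
  show ?case unfolding to_com.simps
    by (rule computesI[OF exec.Seq[OF e exec.Seq[OF e' e3]]])
      (use m v m' v' m3 v3 in \<open>auto simp: algebra_simps\<close>)
next
  case (TSub js t)
  have "computes B T (to_com (map ((!) \<rho>) js) n t) n s (calls R t (map ((!) env) js))
      (time R t (map ((!) env) js)) (ev R t (map ((!) env) js))"
    by (rule TSub.IH) (use TSub.prems in auto)
  then show ?case by simp
next
  case (TOrc t)
  have "computes B T (to_com \<rho> n t) n s (calls R t env) (time R t env) (ev R t env)"
    by (rule TOrc.IH) (use TOrc.prems in auto)
  then obtain m s' where e: "exec B (to_com \<rho> n t) s (calls R t env) m s'"
    and m: "m \<le> 20 * time R t env + sum_list (map T (calls R t env))"
    and v: "s' (reg n) = ev R t env" "\<And>j. j < n \<Longrightarrow> s' (reg j) = s (reg j)"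
    by (rule computesE) blast
  let ?v = "ev R t env"
  have c: "B (val (Var (reg n)) s') (T ?v) (R ?v)"
    using v TOrc.prems(4)[of ?v] by simp
  show ?case unfolding to_com.simps
    by (rule computesI[OF exec.Seq[OF e exec.Call[where e = "Var (reg n)" and B = B and s = s' and x = "reg n", OF c]]])
      (use m v in \<open>auto simp: algebra_simps\<close>)
qed

definition compile :: "tm \<Rightarrow> com" where
  "compile t = Seq (Assign (reg 0) (Var ''in'')) (Seq (to_com [0] 1 t)
    (Assign ''out'' (Var (reg 1))))"

lemma runsI:
  assumes "exec B c ((\<lambda>_. Null)(''in'' := d)) q n s"
  shows "runs B c d q n (s ''out'')"
  using assms unfolding runs_def by blast

lemma runs_compile:
  assumes "scoped 1 t" and "\<And>x. x \<in> set (calls R t [d]) \<Longrightarrow> B x (T x) (R x)"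
  shows "\<exists>n. runs B (compile t) d (calls R t [d]) n (ev R t [d]) \<and>
    n \<le> 20 * time R t [d] + 6 + sum_list (map T (calls R t [d]))"
proof -
  let ?s = "(\<lambda>_. Null)(''in'' := d)"
  let ?s' = "?s(reg 0 := d)"
  have "computes B T (to_com [0] 1 t) 1 ?s' (calls R t [d]) (time R t [d]) (ev R t [d])"
    by (rule computes_to_com) (use assms in auto)
  then obtain m s' where e: "exec B (to_com [0] 1 t) ?s' (calls R t [d]) m s'"
    and m: "m \<le> 20 * time R t [d] + sum_list (map T (calls R t [d]))"
    and v: "s' (reg 1) = ev R t [d]"
    by (rule computesE) blast
  have e': "exec B (Assign (reg 0) (Var ''in'')) ?s [] (Suc (Suc 0)) ?s'"
    using exec.Assign[of B "reg 0" "Var ''in''" ?s] by simp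
  from runsI[OF exec.Seq[OF e' exec.Seq[OF e exec.Assign[of B "''out''" "Var (reg 1)" s']]]]
  \<comment> \<open>Two assignments of two steps each and two sequencings make the 6.\<close>
  have "runs B (compile t) d (calls R t [d]) (m + 6) (ev R t [d])"
    using v by (simp add: compile_def eval_nat_numeral)
  with m show ?thesis
    by (intro exI[of _ "m + 6"]) auto
qed

section \<open>Polynomial bounds\<close>

definition poly_bounded :: "(nat \<Rightarrow> nat) \<Rightarrow> bool" where
  "poly_bounded g \<longleftrightarrow> (\<exists>p :: nat poly. \<forall>n. g n \<le> poly p n)"

lemma poly_bounded_const [intro]: "poly_bounded (\<lambda>_. c)"
  unfolding poly_bounded_def by (rule exI[of _ "[:c:]"]) simp

lemma poly_bounded_id [intro]: "poly_bounded (\<lambda>n. n)"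
  unfolding poly_bounded_def by (rule exI[of _ "[:0, 1:]"]) simp

lemma poly_bounded_add [intro]: "poly_bounded g \<Longrightarrow> poly_bounded h \<Longrightarrow> poly_bounded (\<lambda>n. g n + h n)"
  unfolding poly_bounded_def
proof (elim exE)
  fix p q :: "nat poly"
  assume "\<forall>n. g n \<le> poly p n" "\<forall>n. h n \<le> poly q n"
  then show "\<exists>p. \<forall>n. g n + h n \<le> poly p n"
    by (intro exI[of _ "p + q"]) (simp add: add_mono)
qed

lemma poly_bounded_mult [intro]: "poly_bounded g \<Longrightarrow> poly_bounded h \<Longrightarrow> poly_bounded (\<lambda>n. g n * h n)"
  unfolding poly_bounded_def
proof (elim exE)
  fix p q :: "nat poly"
  assume "\<forall>n. g n \<le> poly p n" "\<forall>n. h n \<le> poly q n"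
  then show "\<exists>p. \<forall>n. g n * h n \<le> poly p n"
    by (intro exI[of _ "p * q"]) (simp add: mult_mono)
qed

text \<open>Natural coefficients give monotonicity, which carries a bound from the size of a request
  to the size of the whole instance.\<close>

lemma poly_mono_nat: "m \<le> n \<Longrightarrow> poly p m \<le> poly p n" for p :: "nat poly"
  by (induction p) (auto intro!: mult_mono add_mono)

section \<open>Powers of two are computable\<close>

definition pow2_com :: com where
  "pow2_com = Seq (Assign ''out'' (Lit 1)) (Loop (Leq (Lit 1) (Var ''in''))
    (Seq (Assign ''out'' (Add (Var ''out'') (Var ''out'')))
      (Assign ''in'' (Sub (Var ''in'') (Lit 1)))))"

text \<open>This is the function of the parameter in the FPT bound. The language cannot multiply, so
  the program doubles by addition, with \<open>''out''\<close> times 2 to the power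
  \<open>''in''\<close> as the loop invariant.\<close>

lemma computable_pow2: "computable (\<lambda>m. 2 ^ m)"
proof -
  let ?B = "\<lambda>_ _ _. False"
  let ?L = "Loop (Leq (Lit 1) (Var ''in''))
    (Seq (Assign ''out'' (Add (Var ''out'') (Var ''out'')))
      (Assign ''in'' (Sub (Var ''in'') (Lit 1))))"
  have loop: "\<exists>n s'. exec ?B ?L s [] n s' \<and> s' ''out'' = Num (a * 2 ^ m)"
    if "s ''in'' = Num (real m)" "s ''out'' = Num a" for s m a
    using that
  proof (induction m arbitrary: s a)
    case 0
    with exec.LoopFalse[of "Leq (Lit 1) (Var ''in'')" s ?B] show ?case
      by fastforce
  next
    case (Suc m)
    let ?s1 = "s(''out'' := Num (a + a))"
    let ?s2 = "?s1(''in'' := Num (real m))"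
    have "exec ?B (Assign ''out'' (Add (Var ''out'') (Var ''out''))) s [] 4 ?s1"
      using exec.Assign[of ?B "''out''" "Add (Var ''out'') (Var ''out'')" s] Suc.prems
      by (simp add: eval_nat_numeral)
    moreover have "exec ?B (Assign ''in'' (Sub (Var ''in'') (Lit 1))) ?s1 [] 4 ?s2"
      using exec.Assign[of ?B "''in''" "Sub (Var ''in'') (Lit 1)" ?s1] Suc.prems
      by (simp add: eval_nat_numeral)
    ultimately have b: "exec ?B (Seq (Assign ''out'' (Add (Var ''out'') (Var ''out'')))
      (Assign ''in'' (Sub (Var ''in'') (Lit 1)))) s [] (1 + 4 + 4) ?s2"
      using exec.Seq by fastforce
    have c: "val (Leq (Lit 1) (Var ''in'')) s \<noteq> Null"
      using Suc.prems by simp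
    have "\<exists>n s'. exec ?B ?L ?s2 [] n s' \<and> s' ''out'' = Num ((a + a) * 2 ^ m)"
      by (rule Suc.IH) auto
    then obtain n s' where "exec ?B ?L ?s2 [] n s'" "s' ''out'' = Num ((a + a) * 2 ^ m)"
      by blast
    with exec.LoopTrue[OF c b] show ?case
      by (fastforce simp: algebra_simps)
  qed
  have "\<exists>n. proc pow2_com (Num (real m)) n (Num (real (2 ^ m)))" for m
  proof -
    let ?s = "(\<lambda>_. Null)(''in'' := Num (real m))"
    have e: "exec ?B (Assign ''out'' (Lit 1)) ?s [] (1 + steps (Lit 1)) (?s(''out'' := Num 1))"
      using exec.Assign[of ?B "''out''" "Lit 1" ?s] by simp
    obtain n s' where l: "exec ?B ?L (?s(''out'' := Num 1)) [] n s'" "s' ''out'' = Num (1 * 2 ^ m)"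
      using loop[of "?s(''out'' := Num 1)" m 1] by auto
    from exec.Seq[OF e l(1)] l(2) show ?thesis
      unfolding proc_def runs_def pow2_com_def by fastforce
  qed
  then show ?thesis unfolding computable_def by blast
qed

section \<open>Data and basic terms\<close>

lemma elems_list_data [simp]: "elems (list_data ds) = ds"
  by (induction ds) auto

lemma elems_nats_data [simp]: "elems (nats_data ns) = map nat_data ns"
  by (simp add: nats_data_def)

lemma dsize_pos: "1 \<le> dsize d"
  by (cases d) auto

lemma length_elems: "length (elems d) \<le> dsize d"
  by (induction d rule: elems.induct) (use dsize_pos in \<open>auto simp: le_Suc_eq\<close>)

lemma dsize_elems: "x \<in> set (elems d) \<Longrightarrow> dsize x \<le> dsize d"
  by (induction d rule: elems.induct) auto

lemma dsize_fst: "dsize (fst_data d) \<le> dsize d"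
  by (cases d) auto

lemma dsize_snd: "dsize (snd_data d) \<le> dsize d"
  by (cases d) auto

lemma dsize_nat_data [simp]: "dsize (nat_data n) = 1"
  by (simp add: nat_data_def)

lemma dsize_list_data_const: "(\<And>x. x \<in> set xs \<Longrightarrow> dsize (f x) = c) \<Longrightarrow>
    dsize (list_data (map f xs)) = 1 + length xs * (1 + c)"
  by (induction xs) auto

text \<open>The invariant is indexed by the number of the iteration because accumulators grow, the
  settled list of Dijkstra by at most one per round and the list of guesses by a factor of two; the
  body then has no time bound uniform in the accumulator.\<close>

lemma fold_time_le:
  assumes "I k b" and "\<And>j x b. k \<le> j \<Longrightarrow> j < k + length xs \<Longrightarrow> x \<in> set xs \<Longrightarrow> I j b \<Longrightarrow>
    I (Suc j) (f x b) \<and> g x b \<le> C"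
  shows "fold_time f g xs b \<le> length xs * (C + 1)"
  using assms
proof (induction xs arbitrary: k b)
  case (Cons x xs)
  have "I (Suc k) (f x b)" "g x b \<le> C"
    using Cons.prems(2)[of k x b] Cons.prems(1) by auto
  moreover have "fold_time f g xs (f x b) \<le> length xs * (C + 1)"
  proof (rule Cons.IH[of "Suc k"])
    show "I (Suc k) (f x b)" by fact
    show "I (Suc j) (f y c) \<and> g y c \<le> C"
      if "Suc k \<le> j" "j < Suc k + length xs" "y \<in> set xs" "I j c" for j y c
      using that by (intro Cons.prems(2)) auto
  qed
  ultimately show ?case by simp
qed simp

lemma fold_time_le_uniform:
  assumes "\<And>x b. x \<in> set xs \<Longrightarrow> g x b \<le> C"
  shows "fold_time f g xs b \<le> length xs * (C + 1)"
  by (rule fold_time_le[where I = "\<lambda>_ _. True" and k = 0]) (use assms in auto)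

lemma fold_invariant:
  assumes "I k b" and "\<And>j x b. k \<le> j \<Longrightarrow> j < k + length xs \<Longrightarrow> x \<in> set xs \<Longrightarrow> I j b \<Longrightarrow> I (Suc j) (f x b)"
  shows "I (k + length xs) (fold f xs b)"
  using assms
proof (induction xs arbitrary: k b)
  case (Cons x xs)
  have "I (Suc k) (f x b)"
    using Cons.prems(2)[of k x b] Cons.prems(1) by auto
  then have "I (Suc k + length xs) (fold f xs (f x b))"
    by (rule Cons.IH) (use Cons.prems(2) in auto)
  then show ?case by simp
qed simp

abbreviation tfst :: "tm \<Rightarrow> tm" where "tfst \<equiv> TUn UFst"
abbreviation tsnd :: "tm \<Rightarrow> tm" where "tsnd \<equiv> TUn USnd"
abbreviation tpair :: "tm \<Rightarrow> tm \<Rightarrow> tm" where "tpair \<equiv> TBin BPair"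
abbreviation tleq :: "tm \<Rightarrow> tm \<Rightarrow> tm" where "tleq \<equiv> TBin BLeq"

text \<open>Atoms can only be compared by \<open>Leq\<close>, and trees not at all, so equality of
  numbers is tested by antisymmetry.\<close>

definition teq :: "tm \<Rightarrow> tm \<Rightarrow> tm" where
  "teq a b = TIf (tleq a b) (tleq b a) TNull"

lemma ev_teq:
  assumes "ev R a env = nat_data m" "ev R b env = nat_data n"
  shows "ev R (teq a b) env \<noteq> Null \<longleftrightarrow> m = n"
  using assms by (auto simp: teq_def nat_data_def)

lemma scoped_teq [simp]: "scoped k (teq a b) \<longleftrightarrow> scoped k a \<and> scoped k b"
  by (auto simp: teq_def)

lemma call_free_teq [simp]: "call_free (teq a b) \<longleftrightarrow> call_free a \<and> call_free b"
  by (auto simp: teq_def)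

section \<open>Dijkstra's algorithm\<close>

type_synonym quad = "nat \<times> nat \<times> nat \<times> real"

fun qhead :: "quad \<Rightarrow> nat" where "qhead (a, x, y, c) = y"
fun qtail :: "quad \<Rightarrow> nat" where "qtail (a, x, y, c) = x"
fun qcost :: "quad \<Rightarrow> real" where "qcost (a, x, y, c) = c"

text \<open>These are walks: neither vertices nor arcs need be distinct. An arc carries its own
  name, so parallel arcs stay apart.\<close>

fun chain :: "nat \<Rightarrow> quad list \<Rightarrow> nat \<Rightarrow> bool" where
  "chain u [] v \<longleftrightarrow> u = v"
| "chain u (q # qs) v \<longleftrightarrow> qtail q = u \<and> chain (qhead q) qs v"

abbreviation qlen :: "quad list \<Rightarrow> real" where
  "qlen qs \<equiv> sum_list (map qcost qs)"

text \<open>The search runs backwards from the target, so that the arcs of a path are consed in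
  order.  An entry \<open>(v, d, p)\<close> of the list of settled vertices records the distance \<open>d\<close> from \<open>v\<close>
  to the target and a shortest path \<open>p\<close>.\<close>

type_synonym entry = "nat \<times> real \<times> nat list"

text \<open>Like \<open>scan\<close>, a fold because the term language has no other loop. The last
  hit wins; the keys of a settled list are distinct by \<open>dijkstra_inv\<close>.\<close>

definition lookup :: "nat \<Rightarrow> entry list \<Rightarrow> (real \<times> nat list) option" where
  "lookup v S = fold (\<lambda>(u, r) acc. if v = u then Some r else acc) S None"

fun candidate :: "entry list \<Rightarrow> quad \<Rightarrow> entry option" where
  "candidate S (a, x, y, c) = (case lookup y S of None \<Rightarrow> None
    | Some (d, p) \<Rightarrow> if lookup x S = None then Some (x, d + c, a # p) else None)"

fun better :: "entry option \<Rightarrow> entry option \<Rightarrow> entry option" where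
  "better None b = b"
| "better e None = e"
| "better (Some (x, d, p)) (Some (x', d', p')) =
    (if d' \<le> d then Some (x', d', p') else Some (x, d, p))"

definition scan :: "quad list \<Rightarrow> entry list \<Rightarrow> entry option" where
  "scan es S = fold (\<lambda>q. better (candidate S q)) es None"

definition settle :: "quad list \<Rightarrow> entry list \<Rightarrow> entry list" where
  "settle es S = (case scan es S of None \<Rightarrow> S | Some e \<Rightarrow> e # S)"

lemma lookup_None_iff: "lookup v S = None \<longleftrightarrow> v \<notin> fst ` set S"
  unfolding lookup_def
proof (induction S rule: rev_induct)
  case (snoc e S)
  then show ?case by (cases e) auto
qed simp

lemma lookup_SomeD: "lookup v S = Some r \<Longrightarrow> (v, r) \<in> set S"
  unfolding lookup_def
proof (induction S rule: rev_induct)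
  case (snoc e S)
  then show ?case by (cases e) (auto split: if_splits)
qed simp

lemma scan_snoc: "scan (es @ [q]) S = better (candidate S q) (scan es S)"
  by (simp add: scan_def)

lemma scan_None_iff: "scan es S = None \<longleftrightarrow> (\<forall>q\<in>set es. candidate S q = None)"
proof (induction es rule: rev_induct)
  case Nil
  then show ?case by (simp add: scan_def)
next
  case (snoc q es)
  then show ?case
    by (cases "candidate S q"; cases "scan es S") (auto simp: scan_snoc)
qed

lemma scan_SomeD:
  "scan es S = Some (x, d, p) \<Longrightarrow> (\<exists>q\<in>set es. candidate S q = Some (x, d, p)) \<and>
    (\<forall>q\<in>set es. \<forall>x' d' p'. candidate S q = Some (x', d', p') \<longrightarrow> d \<le> d')"
proof (induction es arbitrary: x d p rule: rev_induct)
  case Nil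
  then show ?case by (simp add: scan_def)
next
  case (snoc q es)
  show ?case
  proof (cases "candidate S q")
    case None
    with snoc.prems have "scan es S = Some (x, d, p)" by (simp add: scan_snoc)
    from snoc.IH[OF this] None show ?thesis by auto
  next
    case (Some e)
    obtain x' d' p' where e: "e = (x', d', p')" by (cases e) auto
    show ?thesis
    proof (cases "scan es S")
      case None
      then have "\<forall>q\<in>set es. candidate S q = None" by (simp add: scan_None_iff)
      with None Some e snoc.prems show ?thesis by (auto simp: scan_snoc)
    next
      case s: (Some e')
      obtain x2 d2 p2 where e': "e' = (x2, d2, p2)" by (cases e') auto
      note IH = snoc.IH[OF s[unfolded e']]
      show ?thesis
      proof (cases "d2 \<le> d'")
        case True
        then have "x2 = x" "d2 = d" "p2 = p"
          using snoc.prems by (simp_all add: scan_snoc Some s e e')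
        with IH True Some e show ?thesis by auto
      next
        case False
        then have eq: "x' = x" "d' = d" "p' = p"
          using snoc.prems by (simp_all add: scan_snoc Some s e e')
        have "d \<le> d3" if "q' \<in> set es" "candidate S q' = Some (x3, d3, p3)" for q' x3 d3 p3
        proof -
          have "d2 \<le> d3" using IH that by blast
          with False eq show ?thesis by simp
        qed
        with Some e eq show ?thesis by (auto simp del: candidate.simps)
      qed
    qed
  qed
qed

text \<open>Follow the walk to the first arc that enters \<open>K\<close>. The part before it has
  nonnegative cost and can be cut off.\<close>

lemma chain_crossing:
  assumes "chain u qs t" "u \<notin> K" "t \<in> K" "\<forall>q\<in>set qs. 0 \<le> qcost q"
  shows "\<exists>q\<in>set qs. \<exists>qs'. qtail q \<notin> K \<and> qhead q \<in> K \<and> set qs' \<subseteq> set qs \<and>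
    chain (qhead q) qs' t \<and> qcost q + qlen qs' \<le> qlen qs"
  using assms
proof (induction qs arbitrary: u)
  case (Cons q qs)
  show ?case
  proof (cases "qhead q \<in> K")
    case True
    with Cons.prems show ?thesis by (intro bexI[of _ q] exI[of _ qs]) auto
  next
    case False
    then obtain q' qs' where "q' \<in> set qs" "qtail q' \<notin> K" "qhead q' \<in> K" "set qs' \<subseteq> set qs"
      "chain (qhead q') qs' t" "qcost q' + qlen qs' \<le> qlen qs"
      using Cons.IH[of "qhead q"] Cons.prems by auto
    with Cons.prems show ?thesis
      by (intro bexI[of _ q'] exI[of _ qs']) auto
  qed
qed simp

text \<open>The stored path is simple but is compared with all walks. That its vertices lie in
  \<open>K\<close> is what keeps it simple when an arc from a vertex outside \<open>K\<close> is put
  in front.\<close>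

definition settled :: "quad set \<Rightarrow> nat \<Rightarrow> nat set \<Rightarrow> entry \<Rightarrow> bool" where
  "settled E t K = (\<lambda>(v, d, p). \<exists>qs. set qs \<subseteq> E \<and> chain v qs t \<and> distinct (v # map qhead qs) \<and>
    insert v (qhead ` set qs) \<subseteq> K \<and> p = map fst qs \<and> d = qlen qs \<and>
    (\<forall>qs'. set qs' \<subseteq> E \<longrightarrow> chain v qs' t \<longrightarrow> d \<le> qlen qs'))"

definition dijkstra_inv :: "quad set \<Rightarrow> nat set \<Rightarrow> nat \<Rightarrow> entry list \<Rightarrow> bool" where
  "dijkstra_inv E V t S \<longleftrightarrow> t \<in> fst ` set S \<and> distinct (map fst S) \<and> fst ` set S \<subseteq> V \<and>
    (\<forall>e\<in>set S. settled E t (fst ` set S) e)"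

lemma settled_mono: "settled E t K e \<Longrightarrow> K \<subseteq> K' \<Longrightarrow> settled E t K' e"
  unfolding settled_def by (cases e) (auto 0 4)

text \<open>Where the walk enters the settled set, the settled distance of the head is at most the
  cost of the rest, so the candidate of that arc is no dearer than the walk. Applied to a newly
  settled vertex this proves its distance optimal; applied when no candidate is left it proves
  unsettled vertices unreachable.\<close>

lemma crossing_candidate:
  assumes inv: "dijkstra_inv E V t S" and nonneg: "\<forall>q\<in>E. 0 \<le> qcost q"
    and qs: "set qs \<subseteq> E" "chain u qs t" "u \<notin> fst ` set S"
  shows "\<exists>q\<in>E. \<exists>x d p. candidate S q = Some (x, d, p) \<and> d \<le> qlen qs"
proof -
  have "t \<in> fst ` set S" using inv by (simp add: dijkstra_inv_def)
  then obtain q qs' where q: "q \<in> set qs" "qtail q \<notin> fst ` set S" "qhead q \<in> fst ` set S"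
    "set qs' \<subseteq> set qs" "chain (qhead q) qs' t" "qcost q + qlen qs' \<le> qlen qs"
    using chain_crossing[OF qs(2,3)] nonneg qs(1) by blast
  obtain a x y c where qeq: "q = (a, x, y, c)" by (cases q) auto
  obtain d p where l: "lookup y S = Some (d, p)"
    using q(3) qeq lookup_None_iff[of y S] by (cases "lookup y S") auto
  then have "settled E t (fst ` set S) (y, d, p)"
    using inv lookup_SomeD by (auto simp: dijkstra_inv_def)
  then have "d \<le> qlen qs'"
    using q qs(1) qeq unfolding settled_def by (auto simp: subset_iff)
  moreover have "lookup x S = None"
    using q(2) qeq by (simp add: lookup_None_iff)
  ultimately show ?thesis
    using q(1,6) qs(1) qeq l by (intro bexI[of _ q] exI[of _ x] exI[of _ "d + c"] exI[of _ "a # p"]) auto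
qed

lemma settle_inv:
  assumes inv: "dijkstra_inv (set es) V t S" and nonneg: "\<forall>q\<in>set es. 0 \<le> qcost q"
    and tails: "qtail ` set es \<subseteq> V"
  shows "dijkstra_inv (set es) V t (settle es S)"
proof (cases "scan es S")
  case None
  with inv show ?thesis by (simp add: settle_def)
next
  case (Some e)
  obtain x d p where e: "e = (x, d, p)" by (cases e) auto
  from scan_SomeD[OF Some[unfolded e]] obtain q where q: "q \<in> set es"
    "candidate S q = Some (x, d, p)"
    and min: "\<And>q x' d' p'. q \<in> set es \<Longrightarrow> candidate S q = Some (x', d', p') \<Longrightarrow> d \<le> d'"
    by blast
  obtain a y c where qeq: "q = (a, x, y, c)"
    using q(2) by (cases q) (auto split: option.splits if_splits)
  obtain d0 p0 where l: "lookup y S = Some (d0, p0)" "lookup x S = None"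
    and d: "d = d0 + c" "p = a # p0"
    using q(2) qeq by (auto split: option.splits if_splits)
  have xK: "x \<notin> fst ` set S" using l by (simp add: lookup_None_iff)
  let ?K = "fst ` set (e # S)"
  have "settled (set es) t (fst ` set S) (y, d0, p0)"
    using inv lookup_SomeD[OF l(1)] by (auto simp: dijkstra_inv_def)
  then obtain qs where qs: "set qs \<subseteq> set es" "chain y qs t" "distinct (y # map qhead qs)"
    "insert y (qhead ` set qs) \<subseteq> fst ` set S" "p0 = map fst qs" "d0 = qlen qs"
    unfolding settled_def by auto
  \<comment> \<open>Every walk from \<open>x\<close> costs at least some candidate, and
    \<open>d\<close> is the least candidate.\<close>
  have "d \<le> qlen qs'" if "set qs' \<subseteq> set es" "chain x qs' t" for qs'
    using crossing_candidate[OF inv nonneg that xK] min by force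
  then have "settled (set es) t ?K e"
    unfolding settled_def e prod.case
  proof (intro exI[of _ "q # qs"] conjI)
    show "distinct (x # map qhead (q # qs))"
      using qs(3,4) xK qeq by auto
    show "insert x (qhead ` set (q # qs)) \<subseteq> fst ` set ((x, d, p) # S)"
      using qs(4) qeq by auto
  qed (use qs q(1) qeq d in auto)
  moreover have "settled (set es) t ?K e'" if "e' \<in> set S" for e'
    using inv that by (auto simp: dijkstra_inv_def intro: settled_mono)
  moreover have "x \<in> V" using tails q(1) qeq by force
  ultimately show ?thesis
    using inv xK by (auto simp: dijkstra_inv_def settle_def Some e)
qed

definition settle_all :: "nat list \<Rightarrow> quad list \<Rightarrow> nat \<Rightarrow> entry list" where
  "settle_all vs es t = fold (\<lambda>_. settle es) vs [(t, 0, [])]"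

text \<open>A round without a candidate changes nothing, any other round settles a new vertex. With
  the target settled at the start, as many productive rounds as \<open>vs\<close> has entries would
  settle one vertex too many, so at the end no candidate is left.\<close>

lemma settle_all_inv:
  assumes nonneg: "\<forall>q\<in>set es. 0 \<le> qcost q"
    and tails: "qtail ` set es \<subseteq> set vs" and t: "t \<in> set vs"
  shows "dijkstra_inv (set es) (set vs) t (settle_all vs es t)" "scan es (settle_all vs es t) = None"
proof -
  let ?I = "\<lambda>j S. dijkstra_inv (set es) (set vs) t S \<and> (scan es S = None \<or> length S = Suc j)"
  have "0 \<le> qlen qs" if "set qs \<subseteq> set es" for qs
    using that nonneg by (intro sum_list_nonneg) (unfold set_map, blast)
  then have "?I 0 [(t, 0, [])]"
    using t by (auto simp: dijkstra_inv_def settled_def intro!: exI[of _ "[]"])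
  then have "?I (0 + length vs) (settle_all vs es t)"
    unfolding settle_all_def
  proof (rule fold_invariant)
    fix j x S
    assume "?I j S"
    then show "?I (Suc j) (settle es S)"
      using settle_inv[OF _ nonneg tails] by (auto simp: settle_def split: option.splits)
  qed
  moreover have "length (settle_all vs es t) \<noteq> Suc (length vs)"
    if "dijkstra_inv (set es) (set vs) t (settle_all vs es t)"
  proof -
    from that have "length (settle_all vs es t) = card (fst ` set (settle_all vs es t))"
      by (metis dijkstra_inv_def distinct_card length_map set_map)
    also have "\<dots> \<le> card (set vs)"
      using that by (intro card_mono) (auto simp: dijkstra_inv_def)
    also have "\<dots> \<le> length vs" by (rule card_length)
    finally show ?thesis by simp
  qed
  ultimately show "dijkstra_inv (set es) (set vs) t (settle_all vs es t)"
    "scan es (settle_all vs es t) = None" by auto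
qed

lemma settle_all_correct:
  assumes nonneg: "\<forall>q\<in>set es. 0 \<le> qcost q"
    and tails: "qtail ` set es \<subseteq> set vs" and t: "t \<in> set vs"
  shows "lookup s (settle_all vs es t) = None \<Longrightarrow> set qs \<subseteq> set es \<Longrightarrow> \<not> chain s qs t"
    and "lookup s (settle_all vs es t) = Some (d, p) \<Longrightarrow> \<exists>qs. set qs \<subseteq> set es \<and> chain s qs t \<and>
      distinct (s # map qhead qs) \<and> p = map fst qs \<and>
      (\<forall>qs'. set qs' \<subseteq> set es \<longrightarrow> chain s qs' t \<longrightarrow> qlen qs \<le> qlen qs')"
proof -
  note inv = settle_all_inv[OF assms]
  show "\<not> chain s qs t" if "lookup s (settle_all vs es t) = None" "set qs \<subseteq> set es"
  proof
    assume "chain s qs t"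
    from crossing_candidate[OF inv(1) nonneg that(2) this that(1)[unfolded lookup_None_iff]]
    obtain q x d p where "q \<in> set es" "candidate (settle_all vs es t) q = Some (x, d, p)"
      by blast
    with inv(2)[unfolded scan_None_iff] show False by (metis option.distinct(1))
  qed
  assume "lookup s (settle_all vs es t) = Some (d, p)"
  from lookup_SomeD[OF this] inv(1)
  have "settled (set es) t (fst ` set (settle_all vs es t)) (s, d, p)"
    by (auto simp: dijkstra_inv_def)
  then show "\<exists>qs. set qs \<subseteq> set es \<and> chain s qs t \<and>
      distinct (s # map qhead qs) \<and> p = map fst qs \<and>
      (\<forall>qs'. set qs' \<subseteq> set es \<longrightarrow> chain s qs' t \<longrightarrow> qlen qs \<le> qlen qs')"
    unfolding settled_def by blast
qed

section \<open>Dijkstra's algorithm as a term: encoding, value, running time\<close>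

fun quad_data :: "quad \<Rightarrow> data" where
  "quad_data (a, x, y, c) = list_data [nat_data a, nat_data x, nat_data y, Num c]"

fun entry_data :: "entry \<Rightarrow> data" where
  "entry_data (v, d, p) = Pair (nat_data v) (Pair (Num d) (nats_data p))"

text \<open>\<open>Null\<close> serves as \<open>None\<close>; every encoder used with it yields a
  pair, so \<open>TIf\<close> can tell the cases apart.\<close>

fun opt_data :: "('a \<Rightarrow> data) \<Rightarrow> 'a option \<Rightarrow> data" where
  "opt_data f None = Null"
| "opt_data f (Some x) = f x"

text \<open>Environments: \<open>[v, S]\<close>, then \<open>[S, es]\<close>, then \<open>[s, t, vs, es]\<close>.\<close>

definition t_lookup :: tm where
  "t_lookup = TFold (TVar 1) TNull
    (TIf (teq (TVar 0) (tfst (TVar 3))) (tsnd (TVar 3)) (TVar 2))"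

text \<open>Levels 2 and 3 are the best candidate so far and the current arc; then come the head of
  the arc, the result of looking it up, the tail and the new distance.\<close>

definition t_scan :: tm where
  "t_scan = TFold (TVar 1) TNull
    (TLet (tfst (tsnd (tsnd (TVar 3))))
    (TLet (TSub [4, 0] t_lookup)
    (TLet (tfst (tsnd (TVar 3)))
    (TIf (TVar 5)
      (TIf (TSub [6, 0] t_lookup) (TVar 2)
        (TLet (TBin BAdd (tfst (TVar 5)) (tfst (tsnd (tsnd (tsnd (TVar 3))))))
        (TIf (TIf (TVar 2) (tleq (tfst (tsnd (TVar 2))) (TVar 7)) TNull)
          (TVar 2)
          (tpair (TVar 6) (tpair (TVar 7) (tpair (tfst (TVar 3)) (tsnd (TVar 5))))))))
      (TVar 2)))))"

definition t_dijkstra :: tm where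
  "t_dijkstra =
    TLet (TFold (TVar 2) (tpair (tpair (TVar 1) (tpair (TLit 0) TNull)) TNull)
      (TLet (TSub [4, 3] t_scan) (TIf (TVar 6) (tpair (TVar 6) (TVar 4)) (TVar 4))))
    (TLet (TSub [0, 4] t_lookup) (TIf (TVar 5) (tpair (tsnd (TVar 5)) TNull) TNull))"

text \<open>Simulation of a loop: an encoding that commutes with one step commutes with the fold. It
  reduces the value of most \<open>TFold\<close> terms to a single iteration.\<close>

lemma fold_encoded:
  assumes "\<And>x b. x \<in> set xs \<Longrightarrow> f x (enc b) = enc (g x b)"
  shows "fold f xs (enc b) = enc (fold g xs b)"
  using assms by (induction xs arbitrary: b) auto

abbreviation dist_data :: "real \<times> nat list \<Rightarrow> data" where
  "dist_data \<equiv> \<lambda>(d, p). Pair (Num d) (nats_data p)"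

lemma ev_t_lookup:
  "ev R t_lookup [nat_data v, list_data (map entry_data S)] = opt_data dist_data (lookup v S)"
proof -
  have "fold (\<lambda>x acc. ev R (TIf (teq (TVar 0) (tfst (TVar 3))) (tsnd (TVar 3)) (TVar 2))
      ([nat_data v, list_data (map entry_data S)] @ [acc, entry_data x])) S (opt_data dist_data None)
    = opt_data dist_data (lookup v S)"
    unfolding lookup_def
  proof (rule fold_encoded, goal_cases)
    case (1 x b)
    obtain u d p where x: "x = (u, d, p)" by (cases x) auto
    show ?case
      using ev_teq[of R "TVar 0" "[nat_data v, list_data (map entry_data S)] @ [opt_data dist_data b, entry_data x]" v
          "tfst (TVar 3)" u]
      by (simp add: x)
  qed
  then show ?thesis
    by (simp add: t_lookup_def fold_map comp_def)
qed

lemma ev_t_scan: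
  "ev R t_scan [list_data (map entry_data S), list_data (map quad_data es)] =
    opt_data entry_data (scan es S)"
proof -
  \<comment> \<open>The loop body gets a name and is unfolded only where a single iteration is
    evaluated.\<close>
  obtain b where b: "t_scan = TFold (TVar 1) TNull b" by (simp add: t_scan_def)
  have "fold (\<lambda>x acc. ev R b ([list_data (map entry_data S), list_data (map quad_data es)] @
      [acc, quad_data x])) es (opt_data entry_data None) = opt_data entry_data (scan es S)"
    unfolding scan_def
  proof (rule fold_encoded, goal_cases)
    case (1 q e)
    obtain a x y c where q: "q = (a, x, y, c)" by (cases q) auto
    show ?case
      using b
      by (cases e)
        (auto simp: t_scan_def q ev_t_lookup nats_data_def split: option.splits prod.splits)
  qed
  then show ?thesis
    by (simp add: b fold_map comp_def)
qed

lemma ev_t_dijkstra: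
  "ev R t_dijkstra [nat_data s, nat_data t, nats_data vs, list_data (map quad_data es)] =
    opt_data (\<lambda>(d, p). some_data (nats_data p)) (lookup s (settle_all vs es t))"
proof -
  obtain b where b: "t_dijkstra = TLet (TFold (TVar 2)
      (tpair (tpair (TVar 1) (tpair (TLit 0) TNull)) TNull) b)
      (TLet (TSub [0, 4] t_lookup) (TIf (TVar 5) (tpair (tsnd (TVar 5)) TNull) TNull))"
    by (simp add: t_dijkstra_def)
  let ?env = "[nat_data s, nat_data t, nats_data vs, list_data (map quad_data es)]"
  have "fold (\<lambda>x acc. ev R b (?env @ [acc, nat_data x])) vs (list_data (map entry_data [(t, 0, [])]))
    = list_data (map entry_data (settle_all vs es t))"
    unfolding settle_all_def
  proof (rule fold_encoded, goal_cases)
    case (1 v S)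
    show ?case
      using b by (auto simp: t_dijkstra_def ev_t_scan settle_def split: option.splits)
  qed
  then show ?thesis
    by (cases "lookup s (settle_all vs es t)")
      (auto simp: b fold_map comp_def nats_data_def ev_t_lookup some_data_def)
qed

lemma time_TFold_le:
  assumes "\<And>x acc. x \<in> set (elems (ev R l env)) \<Longrightarrow> time R b (env @ [acc, x]) \<le> C"
  shows "time R (TFold l i b) env \<le>
    1 + time R i env + time R l env + length (elems (ev R l env)) * (C + 1)"
  unfolding time.simps by (intro add_left_mono fold_time_le_uniform assms)

lemma time_t_lookup: "time R t_lookup [v, S] \<le> 3 + 20 * length (elems S)"
  unfolding t_lookup_def
  by (rule order_trans[OF time_TFold_le[where C = 19]]) (simp_all add: teq_def)

lemma time_t_scan:
  "time R t_scan [S, es] \<le> 3 + length (elems es) * (60 + 40 * length (elems S))"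
  unfolding t_scan_def
proof (rule order_trans[OF time_TFold_le[where C = "59 + 40 * length (elems S)"]], goal_cases)
  case (1 x b)
  show ?case
    using time_t_lookup[of R "fst_data (snd_data (snd_data x))" S]
      time_t_lookup[of R "fst_data (snd_data x)" S]
    by simp
qed simp

text \<open>At most n rounds, each looking up both ends of up to n arcs among at most n + 1 settled
  vertices, then one more lookup for the source.\<close>

definition dijkstra_bound :: "nat \<Rightarrow> nat" where
  "dijkstra_bound n = 100 + 20 * (n + 2) + n * (20 + n * (60 + 40 * (n + 1)))"

text \<open>Arbitrary trees are allowed and only the lengths of their element lists matter, so that
  no decoding of the input enters the time analysis.\<close>

lemma time_t_dijkstra:
  assumes "length (elems vs) \<le> n" "length (elems es) \<le> n"
  shows "time R t_dijkstra [s, t, vs, es] \<le> dijkstra_bound n"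
proof -
  obtain b where b: "t_dijkstra = TLet (TFold (TVar 2)
      (tpair (tpair (TVar 1) (tpair (TLit 0) TNull)) TNull) b)
      (TLet (TSub [0, 4] t_lookup) (TIf (TVar 5) (tpair (tsnd (TVar 5)) TNull) TNull))"
    by (simp add: t_dijkstra_def)
  let ?f = "\<lambda>x acc. ev R b ([s, t, vs, es] @ [acc, x])"
  let ?S0 = "Pair (Pair t (Pair (Num 0) Null)) Null"
  let ?I = "\<lambda>j S. length (elems S) \<le> Suc j"
  have step: "?I (Suc j) (?f x S)" if "?I j S" for j x S
    using b that by (auto simp: t_dijkstra_def)
  have l: "length (elems (fold ?f (elems vs) ?S0)) \<le> Suc (length (elems vs))"
    using fold_invariant[where I = ?I and k = 0 and f = ?f and xs = "elems vs" and b = ?S0, OF _ step]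
    by simp
  have "fold_time ?f (\<lambda>x acc. time R b ([s, t, vs, es] @ [acc, x])) (elems vs) ?S0
      \<le> length (elems vs) * (19 + n * (60 + 40 * (n + 1)) + 1)"
  proof (rule fold_time_le[where I = ?I and k = 0])
    fix j x S
    assume j: "j < 0 + length (elems vs)" and S: "?I j S"
    have "time R b ([s, t, vs, es] @ [S, x]) \<le> 10 + time R t_scan [S, es]"
      using b by (auto simp: t_dijkstra_def)
    also have "\<dots> \<le> 10 + (3 + n * (60 + 40 * (n + 1)))"
    proof -
      have "length (elems es) * (60 + 40 * length (elems S)) \<le> n * (60 + 40 * (n + 1))"
        by (intro mult_le_mono) (use j S assms in auto)
      with time_t_scan[of R S es] show ?thesis by linarith
    qed
    finally show "?I (Suc j) (?f x S) \<and>
        time R b ([s, t, vs, es] @ [S, x]) \<le> 19 + n * (60 + 40 * (n + 1))"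
      using step[OF S] by simp
  qed simp
  also have "\<dots> \<le> n * (20 + n * (60 + 40 * (n + 1)))"
    using assms(1) by (simp add: mult_le_mono)
  finally have f: "fold_time ?f (\<lambda>x acc. time R b ([s, t, vs, es] @ [acc, x])) (elems vs) ?S0
      \<le> n * (20 + n * (60 + 40 * (n + 1)))" .
  have "time R t_lookup [s, fold ?f (elems vs) ?S0] \<le> 3 + 20 * (n + 2)"
  proof (rule order_trans[OF time_t_lookup])
    have "length (elems (fold ?f (elems vs) ?S0)) \<le> n + 2"
      by (rule order_trans[OF l]) (use assms(1) in simp)
    then show "3 + 20 * length (elems (fold ?f (elems vs) ?S0)) \<le> 3 + 20 * (n + 2)"
      by (intro add_left_mono mult_left_mono) simp_all
  qed
  with f show ?thesis
    by (simp add: b dijkstra_bound_def)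
qed

lemma poly_bounded_dijkstra_bound: "poly_bounded dijkstra_bound"
  unfolding dijkstra_bound_def
  by (intro poly_bounded_add poly_bounded_mult poly_bounded_const poly_bounded_id)

text \<open>Successors instead of a numeral are the form to which simplification brings the length
  of a \<open>TSub\<close> list.\<close>

lemma scoped_t_dijkstra: "scoped (Suc (Suc (Suc (Suc 0)))) t_dijkstra"
proof -
  have "scoped 4 t_dijkstra"
    by (simp add: t_dijkstra_def t_scan_def t_lookup_def)
  moreover have "4 = Suc (Suc (Suc (Suc 0)))" by simp
  ultimately show ?thesis by (rule back_subst)
qed

lemma call_free_t_dijkstra: "call_free t_dijkstra"
  by (simp add: t_dijkstra_def t_scan_def t_lookup_def)

section \<open>Paths as chains\<close>

lemma chain_iff_cas:
  "chain u (map (\<lambda>a. (a, tail G a, head G a, c a)) p) v \<longleftrightarrow> pre_digraph.cas G u p v"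
  by (induction p arbitrary: u) (auto simp: pre_digraph.cas.simps)

text \<open>The vertices of a walk are its source and the heads of its arcs, which is how simplicity
  is expressed for chains.\<close>

lemma apath_iff_cas:
  "pre_digraph.apath G u p v \<longleftrightarrow> u \<in> verts G \<and> set p \<subseteq> arcs G \<and> pre_digraph.cas G u p v \<and>
    distinct (u # map (head G) p)"
proof -
  interpret pre_digraph G .
  have "awalk_verts u p = u # map (head G) p" if "cas u p v"
    using that by (induction p arbitrary: u) auto
  then show ?thesis by (auto simp: apath_def awalk_def)
qed

definition dipaths :: "(nat, nat) pre_digraph \<Rightarrow> nat \<Rightarrow> nat \<Rightarrow> nat list set" where
  "dipaths G s t = {p. pre_digraph.apath G s p t}"

definition upaths :: "(nat, nat) ugraph \<Rightarrow> nat \<Rightarrow> nat \<Rightarrow> nat list set" where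
  "upaths G s t = {p. upath G s p t}"

lemma dipaths_subset:
  assumes "wf_digraph G" "p \<in> dipaths G s t"
  shows "set p \<subseteq> arcs G" "distinct p"
proof -
  interpret wf_digraph G by fact
  show "set p \<subseteq> arcs G" "distinct p"
    using assms(2) by (auto simp: dipaths_def apath_def awalk_def distinct_verts_imp_distinct)
qed

lemma dipaths_restrict:
  assumes "B \<subseteq> arcs G"
  shows "dipaths (G\<lparr>arcs := B\<rparr>) s t = {p \<in> dipaths G s t. set p \<subseteq> B}"
proof -
  have "pre_digraph.cas (G\<lparr>arcs := B\<rparr>) = pre_digraph.cas G"
    by (rule compatible_cas) (simp add: compatible_def)
  with assms show ?thesis
    by (auto simp: dipaths_def apath_iff_cas)
qed

text \<open>Dijkstra minimises over walks, the specification over paths. The two minima agree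
  because every path is a walk of the same cost and the walk returned is simple. Both kinds of graph
  use this bridge.\<close>

lemma sp_answer_chains:
  assumes le: "\<And>p. p \<in> paths \<Longrightarrow> \<exists>qs. set qs \<subseteq> E \<and> chain s qs t \<and> qlen qs = sum_list (map c p)"
    and ge: "\<And>qs. set qs \<subseteq> E \<Longrightarrow> chain s qs t \<Longrightarrow> distinct (s # map qhead qs) \<Longrightarrow>
      map fst qs \<in> paths \<and> sum_list (map c (map fst qs)) = qlen qs"
    and none: "r = Null \<Longrightarrow> \<forall>qs. set qs \<subseteq> E \<longrightarrow> \<not> chain s qs t"
    and some: "r \<noteq> Null \<Longrightarrow> \<exists>qs. set qs \<subseteq> E \<and> chain s qs t \<and>
      distinct (s # map qhead qs) \<and> r = some_data (nats_data (map fst qs)) \<and>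
      (\<forall>qs'. set qs' \<subseteq> E \<longrightarrow> chain s qs' t \<longrightarrow> qlen qs \<le> qlen qs')"
  shows "sp_answer paths c r"
proof (cases "r = Null")
  case True
  with le none have "paths = {}" by blast
  with True show ?thesis by (simp add: sp_answer_def)
next
  case False
  from some[OF this] obtain qs where qs: "set qs \<subseteq> E" "chain s qs t"
    "distinct (s # map qhead qs)" "r = some_data (nats_data (map fst qs))"
    and min: "\<And>qs'. set qs' \<subseteq> E \<Longrightarrow> chain s qs' t \<Longrightarrow> qlen qs \<le> qlen qs'"
    by blast
  note p = ge[OF qs(1-3)]
  have "sum_list (map c (map fst qs)) \<le> sum_list (map c p')" if "p' \<in> paths" for p'
    using le[OF that] min p by force
  with p qs(4) show ?thesis
    unfolding sp_answer_def by (auto intro!: bexI[of _ "map fst qs"])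
qed

lemma ev_t_dijkstra_cases:
  assumes "\<forall>q\<in>set es. 0 \<le> qcost q" "qtail ` set es \<subseteq> set vs" "t \<in> set vs"
    and r: "r = ev R t_dijkstra [nat_data s, nat_data t, nats_data vs, list_data (map quad_data es)]"
  shows "r = Null \<Longrightarrow> \<forall>qs. set qs \<subseteq> set es \<longrightarrow> \<not> chain s qs t"
    and "r \<noteq> Null \<Longrightarrow> \<exists>qs. set qs \<subseteq> set es \<and> chain s qs t \<and>
      distinct (s # map qhead qs) \<and> r = some_data (nats_data (map fst qs)) \<and>
      (\<forall>qs'. set qs' \<subseteq> set es \<longrightarrow> chain s qs' t \<longrightarrow> qlen qs \<le> qlen qs')"
proof -
  note c = settle_all_correct[OF assms(1-3), of s]
  show "\<forall>qs. set qs \<subseteq> set es \<longrightarrow> \<not> chain s qs t" if "r = Null"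
    using that c(1) unfolding r ev_t_dijkstra
    by (cases "lookup s (settle_all vs es t)") (auto simp: some_data_def)
  show "\<exists>qs. set qs \<subseteq> set es \<and> chain s qs t \<and>
      distinct (s # map qhead qs) \<and> r = some_data (nats_data (map fst qs)) \<and>
      (\<forall>qs'. set qs' \<subseteq> set es \<longrightarrow> chain s qs' t \<longrightarrow> qlen qs \<le> qlen qs')" if "r \<noteq> Null"
  proof -
    from that obtain d p where l: "lookup s (settle_all vs es t) = Some (d, p)"
      unfolding r ev_t_dijkstra by (cases "lookup s (settle_all vs es t)") auto
    from c(2)[OF l] show ?thesis
      unfolding r ev_t_dijkstra l by auto
  qed
qed

section \<open>Polynomial shortest path algorithms\<close>

definition t_shortest_dipath :: tm where
  "t_shortest_dipath =
    TLet (tfst (TVar 0)) (TLet (tfst (tsnd (TVar 0)))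
    (TLet (tfst (tfst (tsnd (tsnd (TVar 0))))) (TLet (tsnd (tfst (tsnd (tsnd (TVar 0)))))
    (TSub [1, 2, 3, 4] t_dijkstra))))"

text \<open>An undirected edge is replaced by two arcs with the same name.\<close>

definition t_bidirect :: tm where
  "t_bidirect = TFold (TVar 0) TNull (tpair (TVar 2) (tpair
    (tpair (tfst (TVar 2)) (tpair (tfst (tsnd (tsnd (TVar 2))))
      (tpair (tfst (tsnd (TVar 2))) (tsnd (tsnd (tsnd (TVar 2))))))) (TVar 1)))"

definition t_shortest_upath :: tm where
  "t_shortest_upath =
    TLet (tfst (TVar 0)) (TLet (tfst (tsnd (TVar 0)))
    (TLet (tfst (tfst (tsnd (tsnd (TVar 0))))) (TLet (tsnd (tfst (tsnd (tsnd (TVar 0)))))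
    (TLet (TSub [4] t_bidirect) (TSub [1, 2, 3, 5] t_dijkstra)))))"

text \<open>A call-free term has an empty log, so its compiled program runs even with a procedure
  that never halts, as \<open>proc\<close> demands.\<close>

lemma polynomial_algorithm_compile:
  assumes t: "scoped 1 t" "call_free t"
    and correct: "\<And>I d. I \<in> instances X \<Longrightarrow> encodes X I d \<Longrightarrow> answers X I (ev R t [d])"
    and time: "\<And>d. time R t [d] \<le> g (dsize d)" and g: "poly_bounded g"
  shows "polynomial_algorithm (compile t) X"
proof -
  have "poly_bounded (\<lambda>n. 20 * g n + 6)"
    using g by (intro poly_bounded_add poly_bounded_mult poly_bounded_const)
  then obtain p :: "nat poly" where p: "\<And>n. 20 * g n + 6 \<le> poly p n"
    by (auto simp: poly_bounded_def)
  have "\<exists>n r. proc (compile t) d n r \<and> answers X I r \<and> n \<le> poly p (dsize d)"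
    if I: "I \<in> instances X" "encodes X I d" for I d
  proof -
    obtain n where "runs (\<lambda>_ _ _. False) (compile t) d [] n (ev R t [d])"
      and n: "n \<le> 20 * time R t [d] + 6"
      using runs_compile[OF t(1), of R d "\<lambda>_ _ _. False" "\<lambda>_. 0"] calls_call_free[OF t(2)] by auto
    moreover have "n \<le> poly p (dsize d)"
      using n p[of "dsize d"] time[of d] by linarith
    ultimately show ?thesis
      using correct[OF I] unfolding proc_def by blast
  qed
  then show ?thesis unfolding polynomial_algorithm_def by blast
qed

lemma dsize_graph_part:
  "length (elems (fst_data (fst_data (snd_data (snd_data d))))) \<le> dsize d"
  "length (elems (snd_data (fst_data (snd_data (snd_data d))))) \<le> dsize d"
  by (meson dsize_fst dsize_snd length_elems order_trans)+

lemma polynomial_shortest_dipath: "polynomial_algorithm (compile t_shortest_dipath) shortest_dipath"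
proof (rule polynomial_algorithm_compile[where R = "\<lambda>_. Null" and g = "\<lambda>n. 30 + dijkstra_bound n"])
  fix I d
  assume I: "I \<in> instances shortest_dipath" "encodes shortest_dipath I d"
  let ?G = "graph I" and ?c = "cost I"
  let ?q = "\<lambda>a. (a, tail ?G a, head ?G a, ?c a)"
  interpret fin_digraph ?G using I by (simp add: shortest_dipath_def)
  from I(2) obtain vs as where vs: "set vs = verts ?G" and as: "set as = arcs ?G"
    and d: "d = list_data [nat_data (source I), nat_data (target I),
      Pair (nats_data vs) (list_data (map quad_data (map ?q as)))]"
    by (auto simp: shortest_dipath_def sp_code_def digraph_code_def comp_def)
  let ?es = "map ?q as"
  have st: "source I \<in> verts ?G" "target I \<in> verts ?G" and nonneg: "\<forall>a\<in>arcs ?G. 0 \<le> ?c a"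
    using I(1) by (auto simp: shortest_dipath_def)
  let ?r = "ev (\<lambda>_. Null) t_shortest_dipath [d]"
  have r: "?r = ev (\<lambda>_. Null) t_dijkstra
      [nat_data (source I), nat_data (target I), nats_data vs, list_data (map quad_data ?es)]"
    by (simp add: t_shortest_dipath_def d)
  have es: "\<forall>q\<in>set ?es. 0 \<le> qcost q" "qtail ` set ?es \<subseteq> set vs" "target I \<in> set vs"
    using as vs st nonneg by auto
  note D = ev_t_dijkstra_cases[OF es r]
  \<comment> \<open>An arc determines its quadruple, so a chain is recovered from its list of
    names.\<close>
  have eq: "qs = map ?q (map fst qs)" if "set qs \<subseteq> set ?es" for qs
    using that by (induction qs) auto
  have "sp_answer (dipaths ?G (source I) (target I)) ?c ?r"
  proof (rule sp_answer_chains[OF _ _ D])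
    fix p
    assume "p \<in> dipaths ?G (source I) (target I)"
    then show "\<exists>qs. set qs \<subseteq> set ?es \<and> chain (source I) qs (target I) \<and>
        qlen qs = sum_list (map ?c p)"
      using as by (intro exI[of _ "map ?q p"])
        (auto simp: dipaths_def apath_iff_cas chain_iff_cas comp_def)
  next
    fix qs
    assume qs: "set qs \<subseteq> set ?es" "chain (source I) qs (target I)" "distinct (source I # map qhead qs)"
    define p where "p = map fst qs"
    have q: "qs = map ?q p" using eq[OF qs(1)] by (simp add: p_def)
    have "p \<in> dipaths ?G (source I) (target I)"
      using qs as st unfolding q dipaths_def apath_iff_cas
      by (auto simp: chain_iff_cas comp_def)
    then show "map fst qs \<in> dipaths ?G (source I) (target I) \<and>
        sum_list (map ?c (map fst qs)) = qlen qs"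
      by (simp add: q comp_def)
  qed
  then show "answers shortest_dipath I ?r"
    by (simp add: shortest_dipath_def dipaths_def)
next
  fix d
  show "time (\<lambda>_. Null) t_shortest_dipath [d] \<le> 30 + dijkstra_bound (dsize d)"
    using time_t_dijkstra[OF dsize_graph_part[of d], of "\<lambda>_. Null" "fst_data d" "fst_data (snd_data d)"]
    by (simp add: t_shortest_dipath_def)
next
  show "poly_bounded (\<lambda>n. 30 + dijkstra_bound n)"
    by (intro poly_bounded_add poly_bounded_const poly_bounded_dijkstra_bound)
qed (use scoped_t_dijkstra call_free_t_dijkstra in \<open>auto simp: t_shortest_dipath_def\<close>)

text \<open>Recursive counterpart of the indexed condition in \<open>upath\<close>, fit for
  induction along a chain.\<close>

fun traces :: "('v, 'e) ugraph \<Rightarrow> 'v list \<Rightarrow> 'e list \<Rightarrow> bool" where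
  "traces G [v] [] \<longleftrightarrow> True"
| "traces G (u # v # vs) (e # p) \<longleftrightarrow> ends G e = {u, v} \<and> traces G (v # vs) p"
| "traces G _ _ \<longleftrightarrow> False"

lemma traces_iff_nth:
  "traces G vs p \<longleftrightarrow> length vs = length p + 1 \<and> (\<forall>i<length p. ends G (p ! i) = {vs ! i, vs ! (i + 1)})"
  by (induction G vs p rule: traces.induct) (auto simp: All_less_Suc2)

lemma upath_iff_traces:
  "upath G u p v \<longleftrightarrow> (\<exists>vs. traces G vs p \<and> hd vs = u \<and> last vs = v \<and> distinct vs \<and>
    set vs \<subseteq> nodes G \<and> set p \<subseteq> edges G)"
  unfolding upath_def traces_iff_nth by blast

lemma upaths_subset: "p \<in> upaths G s t \<Longrightarrow> set p \<subseteq> edges G"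
  by (auto simp: upaths_def upath_def)

text \<open>A repeated edge would have the same ends at two positions, but the vertices of a path do
  not repeat.\<close>

lemma distinct_upaths:
  assumes "p \<in> upaths G s t"
  shows "distinct p"
proof -
  from assms obtain vs where vs: "length vs = length p + 1" "distinct vs"
    "\<And>i. i < length p \<Longrightarrow> ends G (p ! i) = {vs ! i, vs ! (i + 1)}"
    by (auto simp: upaths_def upath_def)
  have "p ! i \<noteq> p ! j" if "i < j" "j < length p" for i j
  proof
    assume "p ! i = p ! j"
    then have "vs ! i \<in> {vs ! j, vs ! (j + 1)}"
      using vs(3)[of i] vs(3)[of j] that by auto
    with vs(1,2) that show False
      by (auto simp: nth_eq_iff_index_eq)
  qed
  then show ?thesis
    by (metis distinct_conv_nth nat_neq_iff)
qed

lemma upaths_restrict: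
  assumes "B \<subseteq> edges G"
  shows "upaths (G\<lparr>edges := B\<rparr>) s t = {p \<in> upaths G s t. set p \<subseteq> B}"
  using assms by (auto simp: upaths_def upath_def)

text \<open>For each edge the chain takes the orientation in which the path traverses it.\<close>

lemma traces_chain:
  assumes "traces G vs p" "set p \<subseteq> edges G" "\<forall>e\<in>edges G. ends G e = {x e, y e}"
  shows "\<exists>qs. set qs \<subseteq> (\<Union>e\<in>edges G. {(e, x e, y e, c e), (e, y e, x e, c e)}) \<and>
    chain (hd vs) qs (last vs) \<and> qlen qs = sum_list (map c p)"
  using assms
proof (induction G vs p rule: traces.induct)
  case (1 G v)
  then show ?case by (intro exI[of _ "[]"]) auto
next
  case (2 G u v vs e p)
  from 2 obtain qs where "set qs \<subseteq> (\<Union>e\<in>edges G. {(e, x e, y e, c e), (e, y e, x e, c e)})"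
    "chain v qs (last (v # vs))" "qlen qs = sum_list (map c p)"
    by auto
  moreover have "x e = u \<and> y e = v \<or> x e = v \<and> y e = u"
    using 2 by (auto simp: doubleton_eq_iff)
  moreover have "e \<in> edges G" using 2 by auto
  ultimately show ?case
    by (intro exI[of _ "(e, u, v, c e) # qs"]) auto
qed auto

lemma chain_traces:
  assumes "set qs \<subseteq> (\<Union>e\<in>edges G. {(e, x e, y e, c e), (e, y e, x e, c e)})" "chain u qs v"
    and "\<forall>e\<in>edges G. ends G e = {x e, y e}"
  shows "traces G (u # map qhead qs) (map fst qs) \<and> last (u # map qhead qs) = v \<and>
    set (map fst qs) \<subseteq> edges G \<and> sum_list (map c (map fst qs)) = qlen qs"
  using assms
proof (induction qs arbitrary: u)
  case (Cons q qs)
  then show ?case by (auto simp: insert_commute)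
qed simp

lemma ev_t_bidirect:
  "ev R t_bidirect [list_data (map quad_data (map (\<lambda>e. (e, x e, y e, c e)) as))] =
    list_data (map quad_data (fold (\<lambda>e acc. (e, x e, y e, c e) # (e, y e, x e, c e) # acc) as []))"
proof -
  have "fold (\<lambda>e acc. Pair (quad_data (e, x e, y e, c e)) (Pair (quad_data (e, y e, x e, c e)) acc)) as
      (list_data (map quad_data [])) =
    list_data (map quad_data (fold (\<lambda>e acc. (e, x e, y e, c e) # (e, y e, x e, c e) # acc) as []))"
    by (rule fold_encoded) simp
  then show ?thesis by (simp add: t_bidirect_def fold_map comp_def)
qed

lemma length_t_bidirect: "length (elems (ev R t_bidirect [es])) = 2 * length (elems es)"
proof -
  obtain b where b: "b = tpair (TVar 2) (tpair
    (tpair (tfst (TVar 2)) (tpair (tfst (tsnd (tsnd (TVar 2))))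
      (tpair (tfst (tsnd (TVar 2))) (tsnd (tsnd (tsnd (TVar 2))))))) (TVar 1))" by blast
  have "length (elems (fold (\<lambda>x acc. ev R b ([es] @ [acc, x])) xs acc)) =
      2 * length xs + length (elems acc)" for xs acc
    by (induction xs arbitrary: acc) (auto simp: b)
  from this[of "elems es" Null] show ?thesis
    by (simp add: t_bidirect_def b)
qed

lemma time_t_bidirect: "time R t_bidirect [es] \<le> 3 + 40 * length (elems es)"
  unfolding t_bidirect_def
  by (rule order_trans[OF time_TFold_le[where C = 39]]) simp_all

lemma polynomial_shortest_upath: "polynomial_algorithm (compile t_shortest_upath) shortest_upath"
proof (rule polynomial_algorithm_compile[where R = "\<lambda>_. Null" and
      g = "\<lambda>n. 30 + 40 * n + dijkstra_bound (2 * n)"])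
  fix I d
  assume I: "I \<in> instances shortest_upath" "encodes shortest_upath I d"
  let ?G = "graph I" and ?c = "cost I"
  from I(2) obtain vs as x y where vs: "set vs = nodes ?G" and as: "set as = edges ?G"
    and xy: "\<forall>e\<in>edges ?G. ends ?G e = {x e, y e}"
    and d: "d = list_data [nat_data (source I), nat_data (target I),
      Pair (nats_data vs) (list_data (map quad_data (map (\<lambda>e. (e, x e, y e, ?c e)) as)))]"
    by (auto simp: shortest_upath_def sp_code_def ugraph_code_def comp_def)
  define es where "es = fold (\<lambda>e acc. (e, x e, y e, ?c e) # (e, y e, x e, ?c e) # acc) as []"
  have "set (fold (\<lambda>e acc. (e, x e, y e, ?c e) # (e, y e, x e, ?c e) # acc) bs acc) =
      set acc \<union> (\<Union>e\<in>set bs. {(e, x e, y e, ?c e), (e, y e, x e, ?c e)})" for bs acc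
    by (induction bs arbitrary: acc) auto
  then have set_es: "set es = (\<Union>e\<in>edges ?G. {(e, x e, y e, ?c e), (e, y e, x e, ?c e)})"
    by (simp add: es_def as)
  have fin: "fin_ugraph ?G" and st: "source I \<in> nodes ?G" "target I \<in> nodes ?G"
    and nonneg: "\<forall>a\<in>edges ?G. 0 \<le> ?c a"
    using I(1) by (auto simp: shortest_upath_def)
  have xy_nodes: "x e \<in> nodes ?G" "y e \<in> nodes ?G" if "e \<in> edges ?G" for e
    using fin xy that unfolding fin_ugraph_def by (metis doubleton_eq_iff)+
  let ?r = "ev (\<lambda>_. Null) t_shortest_upath [d]"
  define el where "el = list_data (map quad_data (map (\<lambda>e. (e, x e, y e, ?c e)) as))"
  have d': "d = list_data [nat_data (source I), nat_data (target I), Pair (nats_data vs) el]"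
    unfolding el_def by (rule d)
  have bi: "ev (\<lambda>_. Null) t_bidirect [el] = list_data (map quad_data es)"
    unfolding el_def es_def by (rule ev_t_bidirect)
  have r: "?r = ev (\<lambda>_. Null) t_dijkstra
      [nat_data (source I), nat_data (target I), nats_data vs, list_data (map quad_data es)]"
    by (simp add: t_shortest_upath_def d' bi)
  have es: "\<forall>q\<in>set es. 0 \<le> qcost q" "qtail ` set es \<subseteq> set vs" "target I \<in> set vs"
    using vs st nonneg xy_nodes by (auto simp: set_es)
  have heads: "qhead ` set es \<subseteq> nodes ?G"
    using xy_nodes by (auto simp: set_es)
  note D = ev_t_dijkstra_cases[OF es r]
  have "sp_answer (upaths ?G (source I) (target I)) ?c ?r"
  proof (rule sp_answer_chains[OF _ _ D])
    fix p
    assume "p \<in> upaths ?G (source I) (target I)"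
    then obtain us where us: "traces ?G us p" "hd us = source I" "last us = target I"
      "set p \<subseteq> edges ?G"
      by (auto simp: upaths_def upath_iff_traces)
    from traces_chain[OF us(1,4) xy, of ?c]
    show "\<exists>qs. set qs \<subseteq> set es \<and> chain (source I) qs (target I) \<and> qlen qs = sum_list (map ?c p)"
      unfolding set_es us(2,3) .
  next
    fix qs
    assume qs: "set qs \<subseteq> set es" "chain (source I) qs (target I)" "distinct (source I # map qhead qs)"
    note t = chain_traces[OF qs(1)[unfolded set_es] qs(2) xy]
    have "set (source I # map qhead qs) \<subseteq> nodes ?G"
      using image_mono[OF qs(1), of qhead] heads st by simp
    with t qs(3) have "map fst qs \<in> upaths ?G (source I) (target I)"
      unfolding upaths_def upath_iff_traces mem_Collect_eq
      by (intro exI[of _ "source I # map qhead qs"]) auto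
    with t show "map fst qs \<in> upaths ?G (source I) (target I) \<and>
        sum_list (map ?c (map fst qs)) = qlen qs"
      by blast
  qed
  then show "answers shortest_upath I ?r"
    by (simp add: shortest_upath_def upaths_def)
next
  fix d
  let ?R = "\<lambda>_. Null"
  let ?vs = "fst_data (fst_data (snd_data (snd_data d)))"
  let ?es = "snd_data (fst_data (snd_data (snd_data d)))"
  \<comment> \<open>Each edge became two arcs, hence the bound at twice the size.\<close>
  have "time ?R t_dijkstra [fst_data d, fst_data (snd_data d), ?vs, ev ?R t_bidirect [?es]]
      \<le> dijkstra_bound (2 * dsize d)"
    by (rule time_t_dijkstra) (use dsize_graph_part[of d] in \<open>auto simp: length_t_bidirect\<close>)
  moreover have "time ?R t_bidirect [?es] \<le> 3 + 40 * dsize d"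
    using time_t_bidirect[of ?R ?es] dsize_graph_part(2)[of d] by linarith
  ultimately show "time ?R t_shortest_upath [d] \<le> 30 + 40 * dsize d + dijkstra_bound (2 * dsize d)"
    by (simp add: t_shortest_upath_def)
next
  show "poly_bounded (\<lambda>n. 30 + 40 * n + dijkstra_bound (2 * n))"
    unfolding dijkstra_bound_def
    by (intro poly_bounded_add poly_bounded_mult poly_bounded_const poly_bounded_id)
qed (use scoped_t_dijkstra call_free_t_dijkstra in \<open>auto simp: t_shortest_upath_def t_bidirect_def\<close>)

section \<open>Reduction to shortest paths\<close>

text \<open>All multi-colored arcs get cost 0, not only the guessed ones: the others are deleted by
  \<open>restrict\<close>, so the weights can be the same for all guesses.\<close>

definition reduced_cost :: "nat set \<Rightarrow> (nat \<Rightarrow> real) \<Rightarrow> nat \<Rightarrow> real" where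
  "reduced_cost M c a = (if a \<in> M then 0 else max 0 (c a))"

lemma sum_UN_le:
  fixes f :: "'a \<Rightarrow> real"
  assumes "finite I" "\<And>i. i \<in> I \<Longrightarrow> finite (S i)" "\<And>a. 0 \<le> f a"
  shows "sum f (\<Union>i\<in>I. S i) \<le> (\<Sum>i\<in>I. sum f (S i))"
  using assms(1,2)
proof (induction I rule: finite_induct)
  case (insert i I)
  then have "sum f (S i \<union> (\<Union>i\<in>I. S i)) \<le> sum f (S i) + sum f (\<Union>i\<in>I. S i)"
    using assms(3) by (subst sum_Un) (auto intro: sum_nonneg)
  with insert show ?case by simp
qed simp

text \<open>Multi-colored arcs are paid for once, by \<open>X\<close>; the others belong to a single class, so that
  the costs of the paths of different classes add up inside \<open>A\<close>.  Arcs of nonpositive cost are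
  taken for free.\<close>

lemma superset_cost_le:
  fixes c :: "nat \<Rightarrow> real" and p p' :: "nat \<Rightarrow> nat list"
    and As :: "nat set list"
  defines "M \<equiv> multicolored As"
  defines "w \<equiv> reduced_cost M c"
  assumes fin: "finite E" and A: "A \<subseteq> E" and X: "X = A \<inter> M"
    and p: "\<And>i. i < length As \<Longrightarrow> set (p i) \<inter> M \<subseteq> X"
    and p': "\<And>i. i < length As \<Longrightarrow> set (p' i) \<subseteq> A \<inter> As ! i"
    and dist: "\<And>i. i < length As \<Longrightarrow> distinct (p' i)"
    and le: "\<And>i. i < length As \<Longrightarrow> sum_list (map w (p i)) \<le> sum_list (map w (p' i))"
  shows "sum c {a\<in>E. c a \<le> 0 \<or> a \<in> X \<or> (\<exists>i<length As. a \<in> set (p i))} \<le> sum c A"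
proof -
  let ?k = "length As"
  let ?S = "{a\<in>E. c a \<le> 0 \<or> a \<in> X \<or> (\<exists>i<?k. a \<in> set (p i))}"
  let ?c = "\<lambda>a. max 0 (c a)" and ?n = "\<lambda>a. min 0 (c a)"
  have finA: "finite A" using fin A finite_subset by blast
  have finX: "finite X" using finA X by simp
  \<comment> \<open>Positive and negative parts of the cost are compared separately: the former
    through the paths, the latter because the set built here contains every arc of negative
    cost.\<close>
  have split: "sum c B = sum ?c B + sum ?n B" for B
    unfolding sum.distrib[symmetric] by (intro sum.cong) auto
  have sum_w: "sum w (set q) = sum ?c (set q - M)" for q
    by (rule sum.mono_neutral_cong_right) (auto simp: w_def reduced_cost_def)
  have w_nonneg: "0 \<le> w a" for a by (simp add: w_def reduced_cost_def)
  have path: "sum ?c (set (p i) - M) \<le> sum ?c (set (p' i) - M)" if "i < ?k" for i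
  proof -
    \<comment> \<open>As far as this lemma knows, \<open>p i\<close> may repeat arcs, which only
      increases its list sum; \<open>p' i\<close> is distinct, so its two sums coincide.\<close>
    have "sum w (set q) \<le> sum_list (map w q)" for q
    proof (induction q)
      case (Cons a q)
      then show ?case using w_nonneg[of a] by (cases "a \<in> set q") (auto simp: insert_absorb)
    qed simp
    then have "sum w (set (p i)) \<le> sum_list (map w (p i))" .
    also have "\<dots> \<le> sum_list (map w (p' i))" by (rule le[OF that])
    also have "\<dots> = sum w (set (p' i))"
      using dist[OF that] by (rule sum_list_distinct_conv_sum_set)
    finally show ?thesis by (simp only: sum_w)
  qed
  have disj: "(set (p' i) - M) \<inter> (set (p' j) - M) = {}" if "i < ?k" "j < ?k" "i \<noteq> j" for i j
    using p'[OF that(1)] p'[OF that(2)] that unfolding M_def multicolored_def by blast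
  let ?U = "\<Union>i<?k. set (p i) - M" and ?U' = "\<Union>i<?k. set (p' i) - M"
  have "sum ?c ?S = sum ?c {a \<in> ?S. 0 < c a}"
  proof (rule sum.mono_neutral_right)
    show "finite ?S" using fin by simp
    show "{a \<in> ?S. 0 < c a} \<subseteq> ?S" by blast
    show "\<forall>a\<in>?S - {a \<in> ?S. 0 < c a}. ?c a = 0" by auto
  qed
  also have "\<dots> \<le> sum ?c (X \<union> ?U)"
  proof (rule sum_mono2)
    show "{a \<in> ?S. 0 < c a} \<subseteq> X \<union> ?U" using p by fastforce
  qed (use finX in auto)
  also have "\<dots> \<le> sum ?c X + sum ?c ?U"
    using finX by (subst sum_Un) (auto intro: sum_nonneg)
  \<comment> \<open>Subadditivity suffices on this side; additivity is used below for the paths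
    inside \<open>A\<close>.\<close>
  also have "sum ?c ?U \<le> (\<Sum>i<?k. sum ?c (set (p i) - M))"
    by (rule sum_UN_le) auto
  also have "\<dots> \<le> (\<Sum>i<?k. sum ?c (set (p' i) - M))"
    by (rule sum_mono) (use path in simp)
  also have "\<dots> = sum ?c ?U'"
    using disj by (intro sum.UNION_disjoint[symmetric]) auto
  also have "sum ?c X + sum ?c ?U' = sum ?c (X \<union> ?U')"
    using X finX by (intro sum.union_disjoint[symmetric]) auto
  also have "\<dots> \<le> sum ?c A"
    using p' X finA by (intro sum_mono2) auto
  finally have "sum ?c ?S \<le> sum ?c A" by simp
  moreover have "sum ?n ?S = sum ?n E"
    using fin by (intro sum.mono_neutral_left) auto
  moreover have "sum ?n E \<le> sum ?n A"
  proof -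
    have "sum ?n E = sum ?n A + sum ?n (E - A)"
      using fin A by (metis add.commute sum.subset_diff)
    moreover have "sum ?n (E - A) \<le> 0" by (intro sum_nonpos) auto
    ultimately show ?thesis by simp
  qed
  ultimately show ?thesis by (simp only: split)
qed

section \<open>Counting classes and enumerating guesses\<close>

definition count_lists :: "'a \<Rightarrow> 'a list list \<Rightarrow> nat" where
  "count_lists a ls = length (filter (\<lambda>l. a \<in> set l) ls)"

lemma count_lists_ge_1: "1 \<le> count_lists a ls \<longleftrightarrow> (\<exists>l\<in>set ls. a \<in> set l)"
  unfolding count_lists_def by (induction ls) auto

text \<open>Positions are counted, not sets: an arc of two equal classes counts twice, in agreement
  with \<open>multicolored\<close>.\<close>

lemma count_lists_ge_2: "2 \<le> count_lists a ls \<longleftrightarrow> a \<in> multicolored (map set ls)"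
proof -
  let ?I = "{i. i < length ls \<and> a \<in> set (ls ! i)}"
  have "finite ?I" by simp
  then have "\<not> card ?I \<le> Suc 0 \<longleftrightarrow> (\<exists>i\<in>?I. \<exists>j\<in>?I. i \<noteq> j)"
    by (subst card_le_Suc0_iff_eq) auto
  moreover have "count_lists a ls = card ?I"
    by (simp add: count_lists_def length_filter_conv_card)
  ultimately show ?thesis by (auto simp: multicolored_def cong: conj_cong)
qed

text \<open>Every list is both kept and extended, so the number of guesses doubles exactly; the
  exact number of requests rests on this.\<close>

definition add_element :: "'a \<Rightarrow> 'a list list \<Rightarrow> 'a list list" where
  "add_element m Xs = fold (\<lambda>X acc. X # (m # X) # acc) Xs []"

definition sublists :: "'a list \<Rightarrow> 'a list list" where
  "sublists ms = fold add_element ms [[]]"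

lemma set_add_element: "set (add_element m Xs) = set Xs \<union> (#) m ` set Xs"
proof -
  have "set (fold (\<lambda>X acc. X # (m # X) # acc) Xs acc) = set acc \<union> set Xs \<union> (#) m ` set Xs" for acc
    by (induction Xs arbitrary: acc) auto
  then show ?thesis by (simp add: add_element_def)
qed

lemma length_add_element: "length (add_element m Xs) = 2 * length Xs"
proof -
  have "length (fold (\<lambda>X acc. X # (m # X) # acc) Xs acc) = length acc + 2 * length Xs" for acc
    by (induction Xs arbitrary: acc) auto
  then show ?thesis by (simp add: add_element_def)
qed

lemma length_sublists: "length (sublists ms) = 2 ^ length ms"
  unfolding sublists_def
  by (induction ms rule: rev_induct) (auto simp: length_add_element)

lemma sublists_subset: "X \<in> set (sublists ms) \<Longrightarrow> set X \<subseteq> set ms \<and> length X \<le> length ms"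
  unfolding sublists_def
proof (induction ms arbitrary: X rule: rev_induct)
  case (snoc m ms)
  then show ?case by (fastforce simp: set_add_element)
qed simp

lemma sublists_complete: "Y \<subseteq> set ms \<Longrightarrow> \<exists>X\<in>set (sublists ms). set X = Y"
  unfolding sublists_def
proof (induction ms arbitrary: Y rule: rev_induct)
  case (snoc m ms)
  have "Y - {m} \<subseteq> set ms" using snoc.prems by auto
  then obtain X where X: "X \<in> set (fold add_element ms [[]])" "set X = Y - {m}"
    using snoc.IH by blast
  show ?case
  proof (cases "m \<in> Y")
    case True
    with X show ?thesis by (intro bexI[of _ "m # X"]) (auto simp: set_add_element)
  next
    case False
    with X show ?thesis by (intro bexI[of _ X]) (auto simp: set_add_element)
  qed
qed simp

text \<open>The tree \<open>vs\<close> is passed on unchanged and need not be decoded.\<close>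

locale ssp_run =
  fixes R :: "data \<Rightarrow> data" and s t :: nat and vs :: data and as :: "nat list"
    and x y :: "nat \<Rightarrow> nat" and c :: "nat \<Rightarrow> real" and cls :: "nat list list" and paths :: "nat list set"
  assumes distinct_as: "distinct as" and set_as: "set as = (\<Union>l\<in>set cls. set l)"
    and paths_subset: "p \<in> paths \<Longrightarrow> set p \<subseteq> set as" and paths_distinct: "p \<in> paths \<Longrightarrow> distinct p"
    and R_answers: "distinct bs \<Longrightarrow> set bs \<subseteq> set as \<Longrightarrow> (\<And>a. a \<in> set bs \<Longrightarrow> 0 \<le> w a) \<Longrightarrow>
      sp_answer {p \<in> paths. set p \<subseteq> set bs} w (R (list_data [nat_data s, nat_data t,
        Pair vs (list_data (map (\<lambda>a. quad_data (a, x a, y a, w a)) bs))]))"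
begin

definition arc_data :: "(nat \<Rightarrow> real) \<Rightarrow> nat \<Rightarrow> data" where
  "arc_data w = (\<lambda>a. quad_data (a, x a, y a, w a))"

lemma arc_data_simps [simp]:
  "fst_data (arc_data w a) = nat_data a"
  "fst_data (snd_data (arc_data w a)) = nat_data (x a)"
  "fst_data (snd_data (snd_data (arc_data w a))) = nat_data (y a)"
  "fst_data (snd_data (snd_data (snd_data (arc_data w a)))) = Num (w a)"
  "dsize (arc_data w a) = 9"
  by (simp_all add: arc_data_def)

definition request :: "nat list \<Rightarrow> (nat \<Rightarrow> real) \<Rightarrow> data" where
  "request bs w = list_data [nat_data s, nat_data t,
    Pair vs (list_data (map (arc_data w) bs))]"

text \<open>\<open>rev\<close> appears here and in \<open>restrict\<close> and
  \<open>solution\<close> because a fold that conses reverses its list.\<close>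

definition ms :: "nat list" where
  "ms = rev (filter (\<lambda>a. 2 \<le> count_lists a cls) as)"

definition weight :: "nat \<Rightarrow> real" where
  "weight = reduced_cost (set ms) c"

definition restrict :: "nat list \<Rightarrow> nat list \<Rightarrow> nat list" where
  "restrict X l = rev (filter (\<lambda>a. a \<in> set l \<and> (a \<in> set ms \<longrightarrow> a \<in> set X)) as)"

text \<open>The procedure returns a tree; the choice turns it back into a list that has the
  properties granted by \<open>sp_answer\<close>.\<close>

definition path :: "nat list \<Rightarrow> nat list \<Rightarrow> nat list option" where
  "path X l = (if R (request (restrict X l) weight) = Null then None
    else Some (SOME p. R (request (restrict X l) weight) = some_data (nats_data p) \<and> p \<in> paths \<and>
      set p \<subseteq> set (restrict X l) \<and> (\<forall>p'\<in>paths. set p' \<subseteq> set (restrict X l) \<longrightarrow>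
        sum_list (map weight p) \<le> sum_list (map weight p'))))"

lemma set_ms: "set ms = multicolored (map set cls)"
proof -
  have "multicolored (map set cls) \<subseteq> set as"
    unfolding set_as multicolored_def by (auto, metis nth_mem)
  then show ?thesis
    unfolding ms_def set_rev set_filter count_lists_ge_2 by blast
qed

lemma distinct_ms: "distinct ms"
  using distinct_as by (simp add: ms_def)

lemma length_ms: "length ms = card (multicolored (map set cls))"
  using distinct_card[OF distinct_ms] by (simp add: set_ms)

lemma set_restrict: "set (restrict X l) = {a \<in> set as. a \<in> set l \<and> (a \<in> set ms \<longrightarrow> a \<in> set X)}"
  by (auto simp: restrict_def)

lemma weight_nonneg: "0 \<le> weight a"
  by (simp add: weight_def reduced_cost_def)

lemma path_answer:
  "sp_answer {p \<in> paths. set p \<subseteq> set (restrict X l)} weight (R (request (restrict X l) weight))"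
  unfolding request_def arc_data_def
  by (rule R_answers) (use distinct_as weight_nonneg in \<open>auto simp: restrict_def\<close>)

lemma path_None: "path X l = None \<Longrightarrow> p \<in> paths \<Longrightarrow> \<not> set p \<subseteq> set (restrict X l)"
  using path_answer[of X l]
  by (auto simp: path_def sp_answer_def some_data_def split: if_splits)

lemma path_Some:
  assumes "path X l = Some p"
  shows "R (request (restrict X l) weight) = some_data (nats_data p)" "p \<in> paths"
    "set p \<subseteq> set (restrict X l)"
    "p' \<in> paths \<Longrightarrow> set p' \<subseteq> set (restrict X l) \<Longrightarrow>
      sum_list (map weight p) \<le> sum_list (map weight p')"
proof -
  let ?r = "R (request (restrict X l) weight)"
  let ?P = "\<lambda>p. ?r = some_data (nats_data p) \<and> p \<in> paths \<and>
      set p \<subseteq> set (restrict X l) \<and> (\<forall>p'\<in>paths. set p' \<subseteq> set (restrict X l) \<longrightarrow>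
        sum_list (map weight p) \<le> sum_list (map weight p'))"
  have r: "?r \<noteq> Null" and p: "p = (SOME p. ?P p)"
    using assms by (auto simp: path_def split: if_splits)
  have "\<exists>p. ?P p"
    using path_answer[of X l] r unfolding sp_answer_def by (auto split: if_splits)
  then have "?P p" unfolding p by (rule someI_ex)
  then show "?r = some_data (nats_data p)" "p \<in> paths" "set p \<subseteq> set (restrict X l)"
    "p' \<in> paths \<Longrightarrow> set p' \<subseteq> set (restrict X l) \<Longrightarrow>
      sum_list (map weight p) \<le> sum_list (map weight p')"
    by blast+
qed

lemma R_request: "R (request (restrict X l) weight) = opt_data (\<lambda>p. some_data (nats_data p)) (path X l)"
proof (cases "path X l")
  case None
  then show ?thesis by (simp add: path_def split: if_splits)
next
  case (Some p)
  then show ?thesis by (simp add: path_Some(1))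
qed

definition feasible :: "nat list \<Rightarrow> bool" where
  "feasible X \<longleftrightarrow> (\<forall>l\<in>set cls. path X l \<noteq> None)"

text \<open>To be read for feasible \<open>X\<close>, where \<open>the\<close> meets no
  \<open>None\<close>. All of \<open>X\<close> is taken, whether or not a path uses it: its cost is
  charged to the guess.\<close>

definition solution :: "nat list \<Rightarrow> nat list" where
  "solution X = rev (filter (\<lambda>a. c a \<le> 0 \<or> a \<in> set X \<or>
    (\<exists>l\<in>set cls. a \<in> set (the (path X l)))) as)"

lemma solution_subset: "set (solution X) \<subseteq> set as"
  by (auto simp: solution_def)

lemma distinct_solution: "distinct (solution X)"
  using distinct_as by (simp add: solution_def)

lemma solution_feasible:
  assumes "feasible X"
  shows "ssp_feasible (set as) paths (map set cls) (set (solution X))"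
  unfolding ssp_feasible_def
proof (intro conjI allI impI)
  fix i
  assume i: "i < length (map set cls)"
  then have l: "cls ! i \<in> set cls" by simp
  with assms obtain p where p: "path X (cls ! i) = Some p" by (auto simp: feasible_def)
  have "set p \<subseteq> set (solution X)"
    using path_Some(2)[OF p] paths_subset l p by (force simp: solution_def)
  moreover have "set p \<subseteq> set (cls ! i)"
    using path_Some(3)[OF p] by (auto simp: set_restrict)
  ultimately show "\<exists>p\<in>paths. set p \<subseteq> set (solution X) \<inter> map set cls ! i"
    using path_Some(2)[OF p] i by auto
qed (rule solution_subset)

text \<open>With the guess \<open>A \<inter> set ms\<close> no path inside \<open>A\<close> is
  destroyed by the restriction. These paths show that the guess is feasible and bound the weights of
  the paths found; \<open>superset_cost_le\<close> then compares the costs.\<close>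

lemma solution_optimal:
  assumes A: "ssp_feasible (set as) paths (map set cls) A"
  shows "\<exists>X\<in>set (sublists ms). feasible X \<and> sum c (set (solution X)) \<le> sum c A"
proof -
  obtain X where X: "X \<in> set (sublists ms)" "set X = A \<inter> set ms"
    using sublists_complete[of "A \<inter> set ms" ms] by auto
  have A_sub: "A \<subseteq> set as" using A by (simp add: ssp_feasible_def)
  have "\<forall>i<length cls. \<exists>p. p \<in> paths \<and> set p \<subseteq> A \<inter> set (cls ! i)"
    using A by (auto simp: ssp_feasible_def)
  then obtain p' where p': "\<And>i. i < length cls \<Longrightarrow> p' i \<in> paths"
    "\<And>i. i < length cls \<Longrightarrow> set (p' i) \<subseteq> A \<inter> set (cls ! i)"
    by metis
  have sub: "set (p' i) \<subseteq> set (restrict X (cls ! i))" if "i < length cls" for i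
    using p'[OF that] A_sub X(2) by (auto simp: set_restrict)
  have feas: "feasible X"
    unfolding feasible_def using path_None p'(1) sub by (metis in_set_conv_nth)
  define p where "p i = the (path X (cls ! i))" for i
  have p: "path X (cls ! i) = Some (p i)" if "i < length cls" for i
    using feas that by (force simp: feasible_def p_def)
  have "sum c {a \<in> set as. c a \<le> 0 \<or> a \<in> set X \<or> (\<exists>i<length (map set cls). a \<in> set (p i))} \<le> sum c A"
  proof (rule superset_cost_le[where p' = p'])
    fix i
    assume "i < length (map set cls)"
    then have i: "i < length cls" by simp
    show "set (p i) \<inter> multicolored (map set cls) \<subseteq> set X"
      using path_Some(3)[OF p[OF i]] by (auto simp: set_restrict set_ms)
    show "set (p' i) \<subseteq> A \<inter> map set cls ! i"
      using p'(2)[OF i] i by simp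
    show "distinct (p' i)"
      using paths_distinct p'(1)[OF i] .
    show "sum_list (map (reduced_cost (multicolored (map set cls)) c) (p i))
        \<le> sum_list (map (reduced_cost (multicolored (map set cls)) c) (p' i))"
      using path_Some(4)[OF p[OF i] p'(1)[OF i] sub[OF i]] by (simp add: weight_def set_ms)
  qed (use A_sub X set_ms in auto)
  also have "{a \<in> set as. c a \<le> 0 \<or> a \<in> set X \<or> (\<exists>i<length (map set cls). a \<in> set (p i))} =
      set (solution X)"
    by (auto simp: solution_def p_def in_set_conv_nth Bex_def) 
  finally show ?thesis using X(1) feas by blast
qed

end

section \<open>The algorithm for superset-simultaneous paths\<close>

definition t_mem :: tm where
  "t_mem = TFold (TVar 1) TNull (TIf (teq (TVar 0) (TVar 3)) (TLit 1) (TVar 2))"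

definition t_count :: tm where
  "t_count = TFold (TVar 1) (TLit 0)
    (TIf (TSub [0, 3] t_mem) (TBin BAdd (TVar 2) (TLit 1)) (TVar 2))"

text \<open>Environment: \<open>[as, cls]\<close>.\<close>

definition t_multi :: tm where
  "t_multi = TFold (TVar 0) TNull (TLet (tfst (TVar 3))
    (TIf (tleq (TLit 2) (TSub [4, 1] t_count)) (tpair (TVar 4) (TVar 2)) (TVar 2)))"

definition t_sublists :: tm where
  "t_sublists = TFold (TVar 0) (tpair TNull TNull)
    (TFold (TVar 1) TNull (tpair (TVar 4) (tpair (tpair (TVar 2) (TVar 4)) (TVar 3))))"

text \<open>Environment: \<open>[as, l, ms, X]\<close>.\<close>

definition t_restrict :: tm where
  "t_restrict = TFold (TVar 0) TNull (TLet (tfst (TVar 5))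
    (TIf (TSub [6, 1] t_mem)
      (TLet (tfst (tsnd (tsnd (tsnd (TVar 5)))))
      (TLet (TIf (TSub [6, 2] t_mem) (TIf (TSub [6, 3] t_mem) (tpair (TLit 0) TNull) TNull)
          (tpair (TIf (tleq (TVar 7) (TLit 0)) (TLit 0) (TVar 7)) TNull))
      (TIf (TVar 8)
        (tpair (tpair (TVar 6) (tpair (tfst (tsnd (TVar 5))) (tpair (tfst (tsnd (tsnd (TVar 5))))
          (TVar 8)))) (TVar 4))
        (TVar 4))))
      (TVar 4)))"

text \<open>Environment: \<open>[s, t, vs, as, cls, ms, X]\<close>.  The procedure is executed for every class, even
  after a failure, so that the number of executions does not depend on the outcomes.\<close>

definition t_classes :: tm where
  "t_classes = TFold (TVar 4) (tpair (tpair (TVar 6) TNull) TNull)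
    (TLet (TSub [3, 8, 5, 6] t_restrict)
    (TLet (TOrc (tpair (TVar 0) (tpair (TVar 1) (tpair (tpair (TVar 2) (TVar 9)) TNull))))
    (TIf (TVar 7) (TIf (TVar 10) (tpair (tpair (tfst (TVar 10)) (tfst (TVar 7))) TNull) TNull)
      TNull)))"

text \<open>Environment: \<open>[as, ls]\<close>.\<close>

definition t_collect :: tm where
  "t_collect = TFold (TVar 0) (tpair (TLit 0) TNull)
    (TLet (tfst (TVar 3)) (TLet (tfst (tsnd (tsnd (tsnd (TVar 3)))))
    (TIf (TIf (tleq (TVar 5) (TLit 0)) (TLit 1) (tleq (TLit 1) (TSub [4, 1] t_count)))
      (tpair (TBin BAdd (TVar 5) (tfst (TVar 2))) (tpair (TVar 4) (tsnd (TVar 2))))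
      (TVar 2))))"

text \<open>Environment: \<open>[s, t, vs, as, cls, ms]\<close>.\<close>

definition t_best :: tm where
  "t_best = TFold (TSub [5] t_sublists) TNull
    (TLet (TSub [0, 1, 2, 3, 4, 5, 7] t_classes)
    (TIf (TVar 8)
      (TLet (tfst (TVar 8)) (TLet (TSub [3, 9] t_collect)
      (TIf (TIf (TVar 6) (tleq (tfst (TVar 6)) (tfst (TVar 10))) TNull) (TVar 6) (TVar 10))))
      (TVar 6)))"

definition t_superset :: tm where
  "t_superset = TLet (tfst (TVar 0)) (TLet (tfst (tsnd (TVar 0)))
    (TLet (tfst (tfst (tsnd (tsnd (TVar 0))))) (TLet (tsnd (tfst (tsnd (tsnd (TVar 0)))))
    (TLet (tfst (tsnd (tsnd (tsnd (TVar 0))))) (TLet (TSub [4, 5] t_multi)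
    (TLet (TSub [1, 2, 3, 4, 5, 6] t_best)
    (TIf (TVar 7) (tpair (tsnd (TVar 7)) TNull) TNull)))))))"

section \<open>Values and running times of the auxiliary terms\<close>

lemma ev_t_mem: "ev R t_mem [nat_data a, nats_data l] = (if a \<in> set l then Num 1 else Null)"
proof -
  have "fold (\<lambda>b acc. ev R (TIf (teq (TVar 0) (TVar 3)) (TLit 1) (TVar 2))
      ([nat_data a, nats_data l] @ [acc, nat_data b])) l' (if P then Num 1 else Null) =
    (if P \<or> a \<in> set l' then Num 1 else Null)" for l' P
  proof (induction l' arbitrary: P)
    case (Cons b l')
    have "ev R (TIf (teq (TVar 0) (TVar 3)) (TLit 1) (TVar 2))
      ([nat_data a, nats_data l] @ [if P then Num 1 else Null, nat_data b]) =
      (if P \<or> a = b then Num 1 else Null)"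
      using ev_teq[of R "TVar 0" "[nat_data a, nats_data l] @ [if P then Num 1 else Null, nat_data b]" a
        "TVar 3" b] by simp
    with Cons[of "P \<or> a = b"] show ?case by simp
  qed simp
  from this[of l False] show ?thesis
    by (simp add: t_mem_def fold_map comp_def)
qed

lemma ev_t_count:
  "ev R t_count [nat_data a, list_data (map nats_data ls)] = Num (real (count_lists a ls))"
proof -
  have "fold (\<lambda>l acc. ev R (TIf (TSub [0, 3] t_mem) (TBin BAdd (TVar 2) (TLit 1)) (TVar 2))
      ([nat_data a, list_data (map nats_data ls)] @ [acc, nats_data l])) ls (Num (real 0)) =
    Num (real (fold (\<lambda>l n. if a \<in> set l then n + 1 else n) ls 0))"
    by (rule fold_encoded) (simp add: ev_t_mem)
  moreover have "fold (\<lambda>l n. if a \<in> set l then n + 1 else n) ls' n = n + count_lists a ls'" for ls' n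
    by (induction ls' arbitrary: n) (auto simp: count_lists_def)
  ultimately show ?thesis
    by (simp add: t_count_def fold_map comp_def)
qed

lemma fold_filter_push:
  "fold (\<lambda>a acc. if P a then f a # acc else acc) as acc = rev (map f (filter P as)) @ acc"
  by (induction as arbitrary: acc) auto

lemma ev_t_sublists: "ev R t_sublists [nats_data ms] = list_data (map nats_data (sublists ms))"
proof -
  have inner: "fold (\<lambda>X acc. Pair (nats_data X) (Pair (Pair (nat_data m) (nats_data X)) acc)) Xs
      (list_data (map nats_data [])) = list_data (map nats_data (add_element m Xs))" for m Xs
    unfolding add_element_def by (rule fold_encoded) (simp add: nats_data_def)
  have "fold (\<lambda>m acc. ev R
        (TFold (TVar 1) TNull (tpair (TVar 4) (tpair (tpair (TVar 2) (TVar 4)) (TVar 3))))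
        ([nats_data ms] @ [acc, nat_data m])) ms
      (list_data (map nats_data [[]])) = list_data (map nats_data (sublists ms))"
    unfolding sublists_def
    by (rule fold_encoded) (use inner in \<open>simp add: fold_map comp_def\<close>)
  then show ?thesis
    by (simp add: t_sublists_def fold_map comp_def nats_data_def)
qed

lemma time_t_mem: "time R t_mem [a, l] \<le> 3 + 20 * length (elems l)"
  unfolding t_mem_def
  by (rule order_trans[OF time_TFold_le[where C = 19]]) (simp_all add: teq_def)

text \<open>Up to n + 1 lists, because \<open>t_collect\<close> counts in the paths of at most n
  classes and in the guess.\<close>

definition count_bound :: "nat \<Rightarrow> nat" where
  "count_bound n = 3 + (n + 1) * (20 + 20 * n)"

lemma time_t_count:
  assumes "length (elems ls) \<le> n + 1" "\<And>l. l \<in> set (elems ls) \<Longrightarrow> length (elems l) \<le> n"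
  shows "time R t_count [a, ls] \<le> count_bound n"
  unfolding t_count_def
proof (rule order_trans[OF time_TFold_le[where C = "19 + 20 * n"]], goal_cases)
  case (1 l acc)
  have "length (elems l) \<le> n" using 1 assms(2) by simp
  with time_t_mem[of R a l] show ?case by simp
next
  case 2
  have "length (elems ls) * (19 + 20 * n + 1) \<le> (n + 1) * (20 + 20 * n)"
    using assms(1) by (intro mult_le_mono) auto
  then show ?case by (simp add: count_bound_def)
qed

definition multi_bound :: "nat \<Rightarrow> nat" where
  "multi_bound n = 3 + n * (20 + count_bound n)"

lemma time_t_multi:
  assumes "length (elems as) \<le> n" "length (elems ls) \<le> n + 1"
    "\<And>l. l \<in> set (elems ls) \<Longrightarrow> length (elems l) \<le> n"
  shows "time R t_multi [as, ls] \<le> multi_bound n"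
  unfolding t_multi_def
proof (rule order_trans[OF time_TFold_le[where C = "19 + count_bound n"]], goal_cases)
  case (1 a acc)
  show ?case using time_t_count[OF assms(2,3), of R "fst_data a"] by simp
next
  case 2
  have "length (elems as) * (19 + count_bound n + 1) \<le> n * (20 + count_bound n)"
    using assms(1) by (intro mult_le_mono) auto
  then show ?case by (simp add: multi_bound_def)
qed

text \<open>After j rounds the accumulator has \<open>2 ^ j\<close> entries, so each of the
  \<open>length ms\<close> rounds costs at most a constant multiple of \<open>2 ^ length ms\<close>,
  up to an additive constant.\<close>

lemma time_t_sublists: "time R t_sublists [nats_data ms] \<le> 2 ^ length ms * (10 + length ms * 30)"
proof -
  let ?b = "TFold (TVar 1) TNull (tpair (TVar 4) (tpair (tpair (TVar 2) (TVar 4)) (TVar 3)))"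
  let ?f = "\<lambda>x acc. ev R ?b ([nats_data ms] @ [acc, x])"
  let ?I = "\<lambda>j acc. length (elems acc) = 2 ^ j"
  have len: "length (elems (fold (\<lambda>x acc. Pair x (Pair (Pair m x) acc)) xs acc)) =
      2 * length xs + length (elems acc)" for m xs acc
    by (induction xs arbitrary: acc) auto
  have "fold_time ?f (\<lambda>x acc. time R ?b ([nats_data ms] @ [acc, x])) (elems (nats_data ms)) (Pair Null Null)
      \<le> length (elems (nats_data ms)) * (3 + 2 ^ length ms * 20 + 1)"
  proof (rule fold_time_le[where I = ?I and k = 0])
    fix j m acc
    assume j: "j < 0 + length (elems (nats_data ms))" and I: "?I j acc"
    have "?I (Suc j) (?f m acc)" using I by (simp add: len)
    moreover have "time R ?b ([nats_data ms] @ [acc, m]) \<le> 3 + 2 ^ length ms * 20"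
    proof (rule order_trans[OF time_TFold_le[where C = 19]], goal_cases)
      case 2
      have "(2::nat) ^ j \<le> 2 ^ length ms" using j by (intro power_increasing) auto
      then have "length (elems acc) * (19 + 1) \<le> 2 ^ length ms * 20" using I by simp
      then show ?case by simp
    qed simp
    ultimately show "?I (Suc j) (?f m acc) \<and>
        time R ?b ([nats_data ms] @ [acc, m]) \<le> 3 + 2 ^ length ms * 20" ..
  qed simp
  then have "time R t_sublists [nats_data ms] \<le> 5 + length ms * (4 + 2 ^ length ms * 20)"
    by (simp add: t_sublists_def algebra_simps)
  also have "\<dots> \<le> 2 ^ length ms * (10 + length ms * 30)"
  proof -
    have "1 \<le> (2::nat) ^ length ms" by simp
    \<comment> \<open>The lower-order part is absorbed into the exponential factor, which is at
      least 1.\<close>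
    then have "4 * length ms + 5 \<le> 2 ^ length ms * (4 * length ms + 5)"
      by (metis mult.commute mult_1_right mult_le_mono2)
    then show ?thesis by (simp add: algebra_simps)
  qed
  finally show ?thesis .
qed

definition restrict_bound :: "nat \<Rightarrow> nat" where
  "restrict_bound n = 3 + n * (60 + 60 * n)"

lemma time_t_restrict:
  assumes "length (elems as) \<le> n" "length (elems l) \<le> n" "length (elems ms) \<le> n" "length (elems X) \<le> n"
  shows "time R t_restrict [as, l, ms, X] \<le> restrict_bound n"
  unfolding t_restrict_def
proof (rule order_trans[OF time_TFold_le[where C = "59 + 60 * n"]], goal_cases)
  case (1 a acc)
  have "time R t_mem [fst_data a, l] \<le> 3 + 20 * n" "time R t_mem [fst_data a, ms] \<le> 3 + 20 * n"
    "time R t_mem [fst_data a, X] \<le> 3 + 20 * n"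
    by (rule order_trans[OF time_t_mem], use assms in simp)+
  then show ?case by simp
next
  case 2
  have "length (elems as) * (59 + 60 * n + 1) \<le> n * (60 + 60 * n)"
    using assms(1) by (intro mult_le_mono) auto
  then show ?case by (simp add: restrict_bound_def)
qed

definition classes_bound :: "nat \<Rightarrow> nat" where
  "classes_bound n = 10 + n * (40 + restrict_bound n)"

lemma time_t_classes:
  assumes "length (elems as) \<le> n" "length (elems cls) \<le> n"
    "\<And>l. l \<in> set (elems cls) \<Longrightarrow> length (elems l) \<le> n"
    "length (elems ms) \<le> n" "length (elems X) \<le> n"
  shows "time R t_classes [s, t, vs, as, cls, ms, X] \<le> classes_bound n"
  unfolding t_classes_def
proof (rule order_trans[OF time_TFold_le[where C = "39 + restrict_bound n"]], goal_cases)
  case (1 l acc)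
  then have "length (elems l) \<le> n" using assms(3) by simp
  from time_t_restrict[OF assms(1) this assms(4,5), of R] show ?case by simp
next
  case 2
  have "length (elems cls) * (39 + restrict_bound n + 1) \<le> n * (40 + restrict_bound n)"
    using assms(2) by (intro mult_le_mono) auto
  then show ?case by (simp add: classes_bound_def trans_le_add2)
qed

definition collect_bound :: "nat \<Rightarrow> nat" where
  "collect_bound n = 10 + n * (40 + count_bound n)"

lemma time_t_collect:
  assumes "length (elems as) \<le> n" "length (elems ls) \<le> n + 1"
    "\<And>l. l \<in> set (elems ls) \<Longrightarrow> length (elems l) \<le> n"
  shows "time R t_collect [as, ls] \<le> collect_bound n"
  unfolding t_collect_def
proof (rule order_trans[OF time_TFold_le[where C = "39 + count_bound n"]], goal_cases)
  case (1 a acc)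
  show ?case using time_t_count[OF assms(2,3), of R "fst_data a"] by simp
next
  case 2
  have "length (elems as) * (39 + count_bound n + 1) \<le> n * (40 + count_bound n)"
    using assms(1) by (intro mult_le_mono) auto
  then show ?case by (simp add: collect_bound_def trans_le_add2)
qed

lemma call_free_t_mem: "call_free t_mem"
  by (simp add: t_mem_def)

lemma call_free_t_count: "call_free t_count"
  by (simp add: t_count_def call_free_t_mem)

lemma call_free_t_multi: "call_free t_multi"
  by (simp add: t_multi_def call_free_t_count)

lemma call_free_t_sublists: "call_free t_sublists"
  by (simp add: t_sublists_def)

lemma call_free_t_restrict: "call_free t_restrict"
  by (simp add: t_restrict_def call_free_t_mem)

lemma call_free_t_collect: "call_free t_collect"
  by (simp add: t_collect_def call_free_t_count)

lemma scoped_t_superset: "scoped 1 t_superset"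
  by (simp add: t_superset_def t_best_def t_collect_def t_classes_def t_restrict_def t_sublists_def
      t_multi_def t_count_def t_mem_def)

context ssp_run begin

abbreviation "as_data \<equiv> list_data (map (arc_data c) as)"
abbreviation "cls_data \<equiv> list_data (map nats_data cls)"

definition "instance_data = list_data [nat_data s, nat_data t, Pair vs as_data, cls_data]"

lemma ev_t_multi: "ev R t_multi [as_data, cls_data] = nats_data ms"
proof -
  obtain b where b: "t_multi = TFold (TVar 0) TNull b" by (simp add: t_multi_def)
  have "fold (\<lambda>a acc. ev R b ([as_data, cls_data] @ [acc, arc_data c a])) as
      (nats_data []) =
    nats_data (fold (\<lambda>a acc. if 2 \<le> count_lists a cls then a # acc else acc) as [])"
  proof (rule fold_encoded, goal_cases)
    case (1 a acc)
    have "2 \<le> real (count_lists a cls) \<longleftrightarrow> 2 \<le> count_lists a cls" by linarith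
    then show ?case using b by (auto simp: t_multi_def ev_t_count nats_data_def)
  qed
  also have "\<dots> = nats_data ms"
    using fold_filter_push[of "\<lambda>a. 2 \<le> count_lists a cls" "\<lambda>a. a" as "[]"] by (simp add: ms_def)
  finally show ?thesis
    by (simp add: b fold_map comp_def nats_data_def)
qed

text \<open>Level 8 of the loop is \<open>Null\<close> for a forbidden arc and otherwise the list
  with the reduced cost as its only element: an option and the end of the new arc record in
  one.\<close>

lemma ev_t_restrict:
  "ev R t_restrict [as_data, nats_data l, nats_data ms, nats_data X] =
    list_data (map (arc_data weight) (restrict X l))"
proof -
  let ?env = "[as_data, nats_data l, nats_data ms, nats_data X]"
  let ?enc = "\<lambda>bs. list_data (map (arc_data weight) bs)"
  let ?P = "\<lambda>a. a \<in> set l \<and> (a \<in> set ms \<longrightarrow> a \<in> set X)"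
  obtain b where b: "t_restrict = TFold (TVar 0) TNull b" by (simp add: t_restrict_def)
  have "fold (\<lambda>a acc. ev R b (?env @ [acc, arc_data c a])) as (?enc []) =
    ?enc (fold (\<lambda>a acc. if ?P a then a # acc else acc) as [])"
  proof (rule fold_encoded, goal_cases)
    case (1 a acc)
    show ?case
      using b by (auto simp: t_restrict_def ev_t_mem weight_def reduced_cost_def max_def arc_data_def)
  qed
  also have "\<dots> = ?enc (restrict X l)"
    using fold_filter_push[of ?P "\<lambda>a. a" as "[]"] by (simp add: restrict_def)
  finally show ?thesis
    by (simp add: b fold_map comp_def)
qed

text \<open>The guess is appended as if it were one more path, so that \<open>t_collect\<close>
  picks up its arcs by the same membership count.\<close>

definition class_paths :: "nat list \<Rightarrow> nat list list option" where
  "class_paths X = (if feasible X then Some (rev (map (\<lambda>l. the (path X l)) cls) @ [X]) else None)"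

lemma ev_t_classes:
  "ev R t_classes [nat_data s, nat_data t, vs, as_data, cls_data, nats_data ms, nats_data X] =
    opt_data (\<lambda>ls. Pair (list_data (map nats_data ls)) Null) (class_paths X)"
proof -
  let ?env = "[nat_data s, nat_data t, vs, as_data, cls_data, nats_data ms, nats_data X]"
  let ?enc = "opt_data (\<lambda>ls. Pair (list_data (map nats_data ls)) Null)"
  let ?g = "\<lambda>l acc. case path X l of None \<Rightarrow> None | Some p \<Rightarrow> map_option ((#) p) acc"
  obtain b where b: "t_classes = TFold (TVar 4) (tpair (tpair (TVar 6) TNull) TNull) b"
    by (simp add: t_classes_def)
  have "fold (\<lambda>l acc. ev R b (?env @ [acc, nats_data l])) cls (?enc (Some [X])) =
    ?enc (fold ?g cls (Some [X]))"
  proof (rule fold_encoded, goal_cases)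
    case (1 l acc)
    have "R (Pair (nat_data s) (Pair (nat_data t) (Pair (Pair vs
        (list_data (map (arc_data weight) (restrict X l)))) Null))) =
      opt_data (\<lambda>p. some_data (nats_data p)) (path X l)"
      using R_request[of X l] by (simp add: request_def)
    then show ?case
      using b by (cases acc; cases "path X l")
        (auto simp: t_classes_def ev_t_restrict some_data_def)
  qed
  also have "fold ?g cls' acc = (if \<forall>l\<in>set cls'. path X l \<noteq> None
      then map_option (\<lambda>ls. rev (map (\<lambda>l. the (path X l)) cls') @ ls) acc else None)" for cls' acc
  proof (induction cls' arbitrary: acc)
    case (Cons l cls')
    then show ?case by (cases "path X l"; cases acc) auto
  next
    case Nil
    show ?case by (cases acc) auto
  qed
  then have "fold ?g cls (Some [X]) = class_paths X"
    by (simp add: class_paths_def feasible_def)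
  finally show ?thesis
    by (simp add: b fold_map comp_def)
qed

lemma calls_t_classes:
  "calls R t_classes [nat_data s, nat_data t, vs, as_data, cls_data, nats_data ms, nats_data X] =
    map (\<lambda>l. request (restrict X l) weight) cls"
proof -
  let ?env = "[nat_data s, nat_data t, vs, as_data, cls_data, nats_data ms, nats_data X]"
  obtain b where b: "t_classes = TFold (TVar 4) (tpair (tpair (TVar 6) TNull) TNull) b"
    by (simp add: t_classes_def)
  have "calls R b (?env @ [acc, nats_data l]) = [request (restrict X l) weight]" for acc l
    using b by (auto simp: t_classes_def calls_call_free[OF call_free_t_restrict] ev_t_restrict request_def
       )
  then have "fold_log f (\<lambda>l acc. calls R b (?env @ [acc, l])) (map nats_data cls') acc =
      map (\<lambda>l. request (restrict X l) weight) cls'" for f cls' acc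
    by (induction cls' arbitrary: acc) auto
  then show ?thesis by (simp add: b)
qed

abbreviation cost_data :: "nat list \<Rightarrow> data" where
  "cost_data A \<equiv> Pair (Num (sum_list (map c A))) (nats_data A)"

lemma ev_t_collect:
  "ev R t_collect [as_data, list_data (map nats_data ls)] =
    cost_data (rev (filter (\<lambda>a. c a \<le> 0 \<or> (\<exists>l\<in>set ls. a \<in> set l)) as))"
proof -
  let ?env = "[as_data, list_data (map nats_data ls)]"
  let ?P = "\<lambda>a. c a \<le> 0 \<or> (\<exists>l\<in>set ls. a \<in> set l)"
  obtain b where b: "t_collect = TFold (TVar 0) (tpair (TLit 0) TNull) b" by (simp add: t_collect_def)
  have "fold (\<lambda>a acc. ev R b (?env @ [acc, arc_data c a])) as (cost_data []) =
    cost_data (fold (\<lambda>a acc. if ?P a then a # acc else acc) as [])"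
  proof (rule fold_encoded, goal_cases)
    case (1 a acc)
    have "1 \<le> real (count_lists a ls) \<longleftrightarrow> (\<exists>l\<in>set ls. a \<in> set l)"
      unfolding count_lists_ge_1[symmetric] by linarith
    then show ?case
      using b by (auto simp: t_collect_def ev_t_count nats_data_def)
  qed
  also have "\<dots> = cost_data (rev (filter ?P as))"
    using fold_filter_push[of ?P "\<lambda>a. a" as "[]"] by simp
  finally show ?thesis
    by (simp add: b fold_map comp_def nats_data_def)
qed

lemma class_paths_solution:
  assumes "class_paths X = Some ls"
  shows "rev (filter (\<lambda>a. c a \<le> 0 \<or> (\<exists>l\<in>set ls. a \<in> set l)) as) = solution X"
proof -
  have "(\<exists>l\<in>set ls. a \<in> set l) \<longleftrightarrow> a \<in> set X \<or> (\<exists>l\<in>set cls. a \<in> set (the (path X l)))" for a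
    using assms by (auto simp: class_paths_def split: if_splits)
  then show ?thesis by (simp add: solution_def)
qed

definition total_cost :: "nat list \<Rightarrow> real" where
  "total_cost X = sum_list (map c (solution X))"

lemma total_cost_eq: "total_cost X = sum c (set (solution X))"
  unfolding total_cost_def by (rule sum_list_distinct_conv_sum_set[OF distinct_solution])

text \<open>One round of the loop in \<open>t_best\<close>, on guesses instead of codes.\<close>

fun improve :: "nat list \<Rightarrow> nat list option \<Rightarrow> nat list option" where
  "improve X None = (if feasible X then Some X else None)"
| "improve X (Some Y) = (if feasible X \<and> \<not> total_cost Y \<le> total_cost X then Some X else Some Y)"

lemma fold_improve:
  shows "fold improve Xs None = None \<Longrightarrow> \<forall>X\<in>set Xs. \<not> feasible X"
    and "fold improve Xs None = Some Y \<Longrightarrow> Y \<in> set Xs \<and> feasible Y \<and>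
      (\<forall>X\<in>set Xs. feasible X \<longrightarrow> total_cost Y \<le> total_cost X)"
proof (induction Xs arbitrary: Y rule: rev_induct)
  case (snoc X Xs)
  {
    case 1
    with snoc(1) show ?case
      by (cases "fold improve Xs None") (auto split: if_splits)
  next
    case 2
    show ?case
    proof (cases "fold improve Xs None")
      case None
      with 2 snoc(1)[OF None] show ?thesis by (auto split: if_splits)
    next
      case (Some Z)
      with 2 snoc(2)[OF Some] show ?thesis by (fastforce split: if_splits)
    qed
  }
qed auto

definition best :: "nat list option" where
  "best = fold improve (sublists ms) None"

lemma ev_t_best:
  "ev R t_best [nat_data s, nat_data t, vs, as_data, cls_data, nats_data ms] =
    opt_data (\<lambda>X. cost_data (solution X)) best"
proof -
  let ?env = "[nat_data s, nat_data t, vs, as_data, cls_data, nats_data ms]"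
  let ?enc = "opt_data (\<lambda>X. cost_data (solution X))"
  obtain b where b: "t_best = TFold (TSub [5] t_sublists) TNull b" by (simp add: t_best_def)
  have "fold (\<lambda>X acc. ev R b (?env @ [acc, nats_data X])) (sublists ms) (?enc None) = ?enc best"
    unfolding best_def
  proof (rule fold_encoded, goal_cases)
    case (1 X acc)
    show ?case
    proof (cases "class_paths X")
      case None
      then have "\<not> feasible X" by (simp add: class_paths_def split: if_splits)
      with None show ?thesis
        using b by (cases acc) (auto simp: t_best_def ev_t_classes)
    next
      case (Some ls)
      then have "feasible X" by (simp add: class_paths_def split: if_splits)
      with Some show ?thesis
        using b class_paths_solution[OF Some]
        by (cases acc) (auto simp: t_best_def ev_t_classes ev_t_collect total_cost_def)
    qed
  qed
  then show ?thesis
    by (simp add: b ev_t_sublists fold_map comp_def)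
qed

lemma ev_t_superset:
  "ev R t_superset [instance_data] = opt_data (\<lambda>X. some_data (nats_data (solution X))) best"
  by (cases best)
    (simp_all add: instance_data_def t_superset_def ev_t_multi ev_t_best some_data_def)

theorem t_superset_answer:
  "ssp_answer (set as) paths (map set cls) c (ev R t_superset [instance_data])"
proof (cases best)
  case None
  then have "\<not> (\<exists>A. ssp_feasible (set as) paths (map set cls) A)"
    using fold_improve(1)[of "sublists ms"] solution_optimal by (auto simp: best_def)
  with None show ?thesis by (simp add: ssp_answer_def ev_t_superset)
next
  case (Some X)
  then have X: "feasible X" and min: "\<And>Y. Y \<in> set (sublists ms) \<Longrightarrow> feasible Y \<Longrightarrow> total_cost X \<le> total_cost Y"
    using fold_improve(2)[of "sublists ms" X] by (auto simp: best_def)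
  have "sum c (set (solution X)) \<le> sum c A" if "ssp_feasible (set as) paths (map set cls) A" for A
    using solution_optimal[OF that] min by (force simp: total_cost_eq)
  moreover have "set_code (set (solution X)) (nats_data (solution X))"
    unfolding set_code_def using distinct_solution by blast
  ultimately show ?thesis
    using solution_feasible[OF X] unfolding ssp_answer_def ev_t_superset Some by auto
qed

text \<open>What is requested depends on the guess and the class but on no accumulator, hence on no
  earlier answer. The number of requests and their form can be read off.\<close>

lemma calls_t_superset:
  "calls R t_superset [instance_data] =
    concat (map (\<lambda>X. map (\<lambda>l. request (restrict X l) weight) cls) (sublists ms))"
proof -
  let ?env = "[nat_data s, nat_data t, vs, as_data, cls_data, nats_data ms]"
  obtain b where b: "t_best = TFold (TSub [5] t_sublists) TNull b" by (simp add: t_best_def)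
  have "calls R b (?env @ [acc, nats_data X]) = map (\<lambda>l. request (restrict X l) weight) cls" for acc X
    using b by (auto simp: t_best_def calls_call_free[OF call_free_t_collect] calls_t_classes
       )
  then have "fold_log f (\<lambda>X acc. calls R b (?env @ [acc, X])) (map nats_data Xs) acc =
      concat (map (\<lambda>X. map (\<lambda>l. request (restrict X l) weight) cls) Xs)" for f Xs acc
    by (induction Xs arbitrary: acc) auto
  then have "calls R t_best ?env =
      concat (map (\<lambda>X. map (\<lambda>l. request (restrict X l) weight) cls) (sublists ms))"
    by (simp add: b calls_call_free[OF call_free_t_sublists] ev_t_sublists)
  then show ?thesis
    by (simp add: instance_data_def t_superset_def calls_call_free[OF call_free_t_multi] ev_t_multi)
qed

lemma length_calls_t_superset:
  "length (calls R t_superset [instance_data]) = length cls * 2 ^ card (multicolored (map set cls))"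
  unfolding calls_t_superset length_concat
  by (simp add: comp_def sum_list_triv length_sublists length_ms)

lemma calls_t_superset_request:
  assumes "d \<in> set (calls R t_superset [instance_data])"
  shows "\<exists>bs w. d = request bs w \<and> distinct bs \<and> set bs \<subseteq> set as \<and> (\<forall>a. 0 \<le> w a)"
proof -
  from assms obtain X l where "d = request (restrict X l) weight"
    by (auto simp: calls_t_superset)
  moreover have "distinct (restrict X l)" "set (restrict X l) \<subseteq> set as"
    using distinct_as by (auto simp: restrict_def)
  ultimately show ?thesis using weight_nonneg by blast
qed

text \<open>An arc record has size 9 whatever its cost, and a request keeps the vertex tree, has no
  more arcs than the instance and drops the classes.\<close>

lemma dsize_request:
  assumes "distinct bs" "set bs \<subseteq> set as"
  shows "dsize (request bs w) \<le> dsize instance_data"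
proof -
  have "length bs \<le> length as"
    using card_mono[OF _ assms(2)] distinct_card[OF assms(1)] distinct_card[OF distinct_as] by simp
  moreover have "dsize (list_data (map (arc_data v) bs)) = 1 + length bs * (1 + 9)"
    for v bs by (rule dsize_list_data_const) simp
  ultimately show ?thesis
    by (simp add: request_def instance_data_def)
qed

end

definition superset_bound :: "nat \<Rightarrow> nat" where
  "superset_bound n = 200 + 30 * n + multi_bound n + classes_bound n + collect_bound n"

lemma poly_bounded_superset_bound: "poly_bounded superset_bound"
  unfolding superset_bound_def multi_bound_def classes_bound_def collect_bound_def
    count_bound_def restrict_bound_def
  by (intro poly_bounded_add poly_bounded_mult poly_bounded_const poly_bounded_id)

context ssp_run begin

lemma length_ms_le: "length ms \<le> length as"
  by (simp add: ms_def)

text \<open>The exponential factor enters through the enumeration of the guesses and the number of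
  rounds of \<open>t_best\<close>; a single round is polynomial, the steps inside the procedure not
  being counted here.\<close>

lemma time_t_superset:
  assumes n: "length as \<le> n" "length cls \<le> n" "\<And>l. l \<in> set cls \<Longrightarrow> length l \<le> n"
  shows "time R t_superset [instance_data] \<le> 2 ^ length ms * superset_bound n"
proof -
  let ?env = "[nat_data s, nat_data t, vs, as_data, cls_data, nats_data ms]"
  obtain b where b: "t_best = TFold (TSub [5] t_sublists) TNull b" by (simp add: t_best_def)
  let ?C = "50 + classes_bound n + collect_bound n"
  have ms: "length ms \<le> n" using length_ms_le n(1) by simp
  have body: "time R b (?env @ [acc, nats_data X]) \<le> ?C" if X: "X \<in> set (sublists ms)" for X acc
  proof -
    have lX: "length X \<le> n" using sublists_subset[OF X] ms by auto
    have cl: "time R t_classes (?env @ [nats_data X]) \<le> classes_bound n"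
      by (simp, rule time_t_classes) (use n ms lX in auto)
    show ?thesis
    proof (cases "class_paths X")
      case None
      with cl b show ?thesis
        by (auto simp: t_best_def ev_t_classes)
    next
      case (Some ls)
      then have feas: "feasible X" and ls: "ls = rev (map (\<lambda>l. the (path X l)) cls) @ [X]"
        by (auto simp: class_paths_def split: if_splits)
      \<comment> \<open>The lists are the paths and the guess; a path repeats no arc, so it is no
        longer than \<open>as\<close>.\<close>
      have "length l \<le> n" if "l \<in> set ls" for l
      proof -
        have "length p \<le> n" if "path X l' = Some p" for p l'
          using path_Some(2)[OF that] paths_subset paths_distinct distinct_as n(1)
          by (metis List.finite_set card_mono distinct_card le_trans)
        with that feas lX show ?thesis
          by (auto simp: ls feasible_def)
      qed
      moreover have "length ls \<le> n + 1" using n(2) by (simp add: ls)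
      ultimately have co: "time R t_collect [as_data, list_data (map nats_data ls)] \<le> collect_bound n"
        by (intro time_t_collect) (use n(1) in auto)
      from cl co b Some show ?thesis
        by (auto simp add: t_best_def ev_t_classes)
    qed
  qed
  have "time R t_best ?env \<le> 1 + time R TNull ?env + time R (TSub [5] t_sublists) ?env +
      length (elems (ev R (TSub [5] t_sublists) ?env)) * (?C + 1)"
    unfolding b
  proof (rule time_TFold_le, goal_cases)
    case (1 z acc)
    then obtain X where "X \<in> set (sublists ms)" "z = nats_data X"
      by (auto simp: ev_t_sublists)
    then show ?case using body by blast
  qed
  also have "\<dots> \<le> 2 + 2 ^ length ms * (10 + length ms * 30) + 2 ^ length ms * (?C + 1)"
    using time_t_sublists[of R ms] by (simp add: ev_t_sublists length_sublists)
  finally have best: "time R t_best ?env \<le>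
      2 + 2 ^ length ms * (10 + length ms * 30) + 2 ^ length ms * (?C + 1)" .
  have multi: "time R t_multi [as_data, cls_data] \<le> multi_bound n"
    by (rule time_t_multi) (use n in auto)
  have "time R t_superset [instance_data] \<le>
      60 + time R t_multi [as_data, cls_data] + time R t_best ?env"
    by (simp add: instance_data_def t_superset_def ev_t_multi)
  also have "\<dots> \<le> (62 + multi_bound n) + 2 ^ length ms * (10 + length ms * 30) + 2 ^ length ms * (?C + 1)"
    using multi best by linarith
  also have "\<dots> \<le> 2 ^ length ms * (62 + multi_bound n) + 2 ^ length ms * (10 + n * 30) +
      2 ^ length ms * (?C + 1)"
    using ms by (intro add_mono mult_le_mono) auto
  also have "\<dots> = 2 ^ length ms * ((62 + multi_bound n) + (10 + n * 30) + (?C + 1))"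
    by (simp only: distrib_left)
  also have "\<dots> \<le> 2 ^ length ms * superset_bound n"
    by (intro mult_le_mono) (auto simp: superset_bound_def)
  finally show ?thesis .
qed

end

section \<open>Directed and undirected instances\<close>

text \<open>Covers digraphs and undirected graphs alike: \<open>x\<close> and \<open>y\<close> give the ends of an arc or
  edge, in the order in which the encoding \<open>d\<close> lists them.\<close>

definition presents ::
    "'i problem \<Rightarrow> 'j problem \<Rightarrow> ('j \<Rightarrow> 'i \<Rightarrow> bool) \<Rightarrow> 'i \<Rightarrow> data \<Rightarrow> nat \<Rightarrow> nat \<Rightarrow> data \<Rightarrow> nat list \<Rightarrow>
      (nat \<Rightarrow> nat) \<Rightarrow> (nat \<Rightarrow> nat) \<Rightarrow> (nat \<Rightarrow> real) \<Rightarrow> nat list list \<Rightarrow> nat list set \<Rightarrow> bool" where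
  "presents X Y Q I d s t vs as x y c cls paths \<longleftrightarrow>
    distinct as \<and> set as = (\<Union>l\<in>set cls. set l) \<and> (\<forall>p\<in>paths. set p \<subseteq> set as \<and> distinct p) \<and>
    d = list_data [nat_data s, nat_data t,
      Pair vs (list_data (map (\<lambda>a. quad_data (a, x a, y a, c a)) as)),
      list_data (map nats_data cls)] \<and>
    (\<forall>r. ssp_answer (set as) paths (map set cls) c r \<longrightarrow> answers X I r) \<and>
    (\<forall>bs w. distinct bs \<longrightarrow> set bs \<subseteq> set as \<longrightarrow> (\<forall>a\<in>set bs. 0 \<le> w a) \<longrightarrow>
      (\<exists>J\<in>instances Y. Q J I \<and> encodes Y J (list_data [nat_data s, nat_data t,
          Pair vs (list_data (map (\<lambda>a. quad_data (a, x a, y a, w a)) bs))]) \<and>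
        (\<forall>r. answers Y J r \<longrightarrow> sp_answer {p \<in> paths. set p \<subseteq> set bs} w r)))"

text \<open>Everything that distinguishes the two kinds of graph is hidden in
  \<open>presents\<close>. Only the last claim asks \<open>Q\<close> for a time bound; the others
  hold for any correct \<open>Q\<close>.\<close>

lemma superset_correct:
  fixes X :: "'g ssp_instance problem"
  assumes pres: "\<And>I d. I \<in> instances X \<Longrightarrow> encodes X I d \<Longrightarrow>
      \<exists>s t vs as x y c cls paths. presents X Y Rel I d s t vs as x y c cls paths \<and>
        classes I = map set cls"
    and Q: "algorithm Q Y"
  shows "solves (proc Q) (compile t_superset) X"
    and "executes (proc Q) (compile t_superset) X
      (\<lambda>I. num_colors I * 2 ^ num_multicolored I) Y Rel"
    and "polynomial_algorithm Q Y \<Longrightarrow> fpt_algorithm (proc Q) (compile t_superset) X num_multicolored"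
proof -
  \<comment> \<open>Output and time of \<open>Q\<close> as total functions, meaningful on inputs on
    which \<open>Q\<close> halts; determinism makes them its actual output and time.\<close>
  define R where "R d = (SOME r. \<exists>n. proc Q d n r)" for d
  define T where "T d = (SOME n. proc Q d n (R d))" for d
  have run: "proc Q e (T e) (R e)" if "proc Q e n r" for e n r
  proof -
    have "\<exists>n. proc Q e n (R e)"
      unfolding R_def by (rule someI_ex) (use that in blast)
    then show ?thesis unfolding T_def by (rule someI_ex)
  qed
  have Y: "proc Q e (T e) (R e) \<and> answers Y J (R e)" if J: "J \<in> instances Y" "encodes Y J e" for J e
  proof -
    obtain n r where nr: "proc Q e n r" "answers Y J r"
      using Q J unfolding algorithm_def by blast
    with run[OF nr(1)] proc_deterministic[OF nr(1) run[OF nr(1)]] show ?thesis by simp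
  qed
  \<comment> \<open>One run with its answer, its requests and its time, from which all three claims
    are read off.\<close>
  have main: "\<exists>q n r. runs (proc Q) (compile t_superset) d q n r \<and> answers X I r \<and>
      length q = num_colors I * 2 ^ num_multicolored I \<and>
      (\<forall>e\<in>set q. \<exists>J\<in>instances Y. encodes Y J e \<and> Rel J I \<and> dsize e \<le> dsize d) \<and>
      n \<le> 20 * (2 ^ num_multicolored I * superset_bound (dsize d)) + 6 + sum_list (map T q) \<and>
      num_colors I \<le> dsize d"
    if I: "I \<in> instances X" "encodes X I d" for I d
  proof -
    from pres[OF I] obtain s t vs as x y c cls paths
      where p: "presents X Y Rel I d s t vs as x y c cls paths" and cls: "classes I = map set cls"
      by blast
    have p_basic: "distinct as" "set as = (\<Union>l\<in>set cls. set l)"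
      "\<And>p. p \<in> paths \<Longrightarrow> set p \<subseteq> set as" "\<And>p. p \<in> paths \<Longrightarrow> distinct p"
      using p unfolding presents_def by blast+
    have sub: "\<exists>J\<in>instances Y. Rel J I \<and> encodes Y J (list_data [nat_data s, nat_data t,
          Pair vs (list_data (map (\<lambda>a. quad_data (a, x a, y a, w a)) bs))]) \<and>
        (\<forall>r. answers Y J r \<longrightarrow> sp_answer {p \<in> paths. set p \<subseteq> set bs} w r)"
      if "distinct bs" "set bs \<subseteq> set as" "\<And>a. a \<in> set bs \<Longrightarrow> 0 \<le> w a" for bs w
      using p that unfolding presents_def by blast
    interpret ssp_run R s t vs as x y c cls paths
    proof
      show "sp_answer {p \<in> paths. set p \<subseteq> set bs} w (R (list_data [nat_data s, nat_data t,
          Pair vs (list_data (map (\<lambda>a. quad_data (a, x a, y a, w a)) bs))]))"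
        if "distinct bs" "set bs \<subseteq> set as" "\<And>a. a \<in> set bs \<Longrightarrow> 0 \<le> w a" for bs w
        using sub[of bs w, OF that] Y by blast
    qed (fact p_basic)+
    have d: "d = instance_data"
      using p unfolding presents_def instance_data_def arc_data_def by blast
    have num: "num_colors I = length cls" "num_multicolored I = length ms"
      by (simp_all add: num_colors_def num_multicolored_def cls length_ms)
    let ?q = "calls R t_superset [d]"
    have q: "\<exists>J\<in>instances Y. encodes Y J e \<and> Rel J I \<and> dsize e \<le> dsize d" if "e \<in> set ?q" for e
    proof -
      from calls_t_superset_request[OF that[unfolded d]] obtain bs w where
        e: "e = request bs w" "distinct bs" "set bs \<subseteq> set as" "\<forall>a. 0 \<le> w a" by blast
      with sub[OF e(2,3), of w] dsize_request[OF e(2,3), of w] show ?thesis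
        unfolding d request_def arc_data_def by auto
    qed
    have sizes: "length as \<le> dsize d" "length cls \<le> dsize d"
      using length_elems[of as_data] length_elems[of cls_data] by (simp_all add: d instance_data_def)
    have "length l \<le> dsize d" if "l \<in> set cls" for l
    proof -
      have "length l \<le> dsize (nats_data l)" using length_elems[of "nats_data l"] by simp
      also have "\<dots> \<le> dsize cls_data" using that by (intro dsize_elems) simp
      also have "\<dots> \<le> dsize d" by (simp add: d instance_data_def)
      finally show ?thesis .
    qed
    from time_t_superset[OF sizes this]
    have time: "time R t_superset [d] \<le> 2 ^ num_multicolored I * superset_bound (dsize d)"
      unfolding num d by simp
    have "proc Q e (T e) (R e)" if "e \<in> set ?q" for e
      using q[OF that] Y by blast
    from runs_compile[where R = R and d = d and B = "proc Q" and T = T, OF scoped_t_superset this]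
    obtain n where n: "runs (proc Q) (compile t_superset) d ?q n (ev R t_superset [d])"
      "n \<le> 20 * time R t_superset [d] + 6 + sum_list (map T ?q)"
      by blast
    have answer: "answers X I (ev R t_superset [d])"
      using p t_superset_answer unfolding presents_def d by blast
    have len: "length ?q = num_colors I * 2 ^ num_multicolored I"
      using length_calls_t_superset unfolding num d length_ms .
    have "n \<le> 20 * (2 ^ num_multicolored I * superset_bound (dsize d)) + 6 + sum_list (map T ?q)"
      using n(2) time by linarith
    moreover have "num_colors I \<le> dsize d"
      using sizes(2) num(1) by simp
    ultimately show ?thesis
      using n(1) answer len q by (intro exI conjI ballI) assumption+
  qed
  show "solves (proc Q) (compile t_superset) X"
    unfolding solves_def using main by blast
  show "executes (proc Q) (compile t_superset) X
      (\<lambda>I. num_colors I * 2 ^ num_multicolored I) Y Rel"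
    unfolding executes_def
  proof (intro ballI allI impI)
    fix I d q n r
    assume I: "I \<in> instances X" and *: "encodes X I d \<and> runs (proc Q) (compile t_superset) d q n r"
    from main[OF I, of d] * obtain q' n' r' where
      q': "runs (proc Q) (compile t_superset) d q' n' r'"
        "length q' = num_colors I * 2 ^ num_multicolored I"
        "\<forall>e\<in>set q'. \<exists>J\<in>instances Y. encodes Y J e \<and> Rel J I"
      by blast
    \<comment> \<open>The claim concerns every run; determinism identifies it with the run just
      found.\<close>
    have "q = q'"
      using runs_deterministic[OF _ conjunct2[OF *] q'(1)] proc_deterministic by blast
    with q' show "length q = num_colors I * 2 ^ num_multicolored I \<and>
        (\<forall>x\<in>set q. \<exists>J\<in>instances Y. encodes Y J x \<and> Rel J I)"
      by blast
  qed
  show "fpt_algorithm (proc Q) (compile t_superset) X num_multicolored" if "polynomial_algorithm Q Y"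
  proof -
    from that obtain p :: "nat poly" where p: "\<And>J e. J \<in> instances Y \<Longrightarrow> encodes Y J e \<Longrightarrow>
        \<exists>n r. proc Q e n r \<and> answers Y J r \<and> n \<le> poly p (dsize e)"
      unfolding polynomial_algorithm_def by blast
    have T_le: "T e \<le> poly p m" if J: "J \<in> instances Y" "encodes Y J e" and m: "dsize e \<le> m" for J e m
    proof -
      obtain n r where nr: "proc Q e n r" "n \<le> poly p (dsize e)" using p[OF J] by blast
      with proc_deterministic[OF nr(1) run[OF nr(1)]] poly_mono_nat[OF m, of p] show ?thesis by simp
    qed
    have "poly_bounded (poly p)" unfolding poly_bounded_def by blast
    then have "poly_bounded (\<lambda>N. 20 * superset_bound N + 6 + N * poly p N)"
      by (intro poly_bounded_add poly_bounded_mult poly_bounded_const poly_bounded_id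
          poly_bounded_superset_bound)
    then obtain p' :: "nat poly" where p': "\<And>N. 20 * superset_bound N + 6 + N * poly p N \<le> poly p' N"
      unfolding poly_bounded_def by blast
    have "\<exists>q n r. runs (proc Q) (compile t_superset) d q n r \<and> answers X I r \<and>
        n \<le> 2 ^ num_multicolored I * poly p' (dsize d)"
      if I: "I \<in> instances X" "encodes X I d" for I d
    proof -
      let ?N = "dsize d" and ?L = "2 ^ num_multicolored I :: nat"
      from main[OF I] obtain q n r where r: "runs (proc Q) (compile t_superset) d q n r" "answers X I r"
        and len: "length q = num_colors I * ?L"
        and q: "\<forall>e\<in>set q. \<exists>J\<in>instances Y. encodes Y J e \<and> Rel J I \<and> dsize e \<le> ?N"
        and n: "n \<le> 20 * (?L * superset_bound ?N) + 6 + sum_list (map T q)"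
        and k: "num_colors I \<le> ?N"
        by blast
      have "sum_list (map T q) \<le> sum_list (map (\<lambda>_. poly p ?N) q)"
        by (rule sum_list_mono) (use q T_le in blast)
      also have "\<dots> = length q * poly p ?N" by (simp add: sum_list_triv)
      \<comment> \<open>The classes are listed in the input, so their number is at most its
        size.\<close>
      also have "\<dots> \<le> (?N * ?L) * poly p ?N"
        unfolding len using k by (intro mult_le_mono) auto
      finally have "n \<le> 20 * (?L * superset_bound ?N) + 6 + ?L * (?N * poly p ?N)"
        using n by (simp add: ac_simps)
      also have "\<dots> \<le> ?L * (20 * superset_bound ?N) + ?L * 6 + ?L * (?N * poly p ?N)"
        by simp
      also have "\<dots> = ?L * (20 * superset_bound ?N + 6 + ?N * poly p ?N)"
        by (simp only: distrib_left)
      also have "\<dots> \<le> ?L * poly p' ?N"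
        by (intro mult_le_mono p') simp
      finally show ?thesis using r by blast
    qed
    then show ?thesis
      unfolding fpt_algorithm_def solves_in_time_def using computable_pow2 by blast
  qed
qed

lemma list_all2_set_code:
  "list_all2 set_code As ds \<Longrightarrow> \<exists>cls. As = map set cls \<and> ds = map nats_data cls"
proof (induction rule: list_all2_induct)
  case Nil
  show ?case by simp
next
  case (Cons A As d ds)
  from Cons(1) obtain l where "A = set l" "d = nats_data l" by (auto simp: set_code_def)
  with Cons(3) show ?case by (metis list.simps(9))
qed

text \<open>A request is the subgraph with the same vertices and the arcs \<open>bs\<close>, under
  costs \<open>w\<close>; its paths are those paths of the graph that stay in
  \<open>bs\<close>.\<close>

lemma presents_dipaths:
  assumes "I \<in> instances superset_simultaneous_dipaths" "encodes superset_simultaneous_dipaths I d"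
  shows "\<exists>s t vs as x y c cls paths. presents superset_simultaneous_dipaths shortest_dipath
      (\<lambda>J I. subgraph (graph J) (graph I)) I d s t vs as x y c cls paths \<and> classes I = map set cls"
proof -
  let ?G = "graph I" and ?s = "source I" and ?t = "target I"
  interpret fin_digraph ?G using assms(1) by (simp add: superset_simultaneous_dipaths_def)
  have st: "?s \<in> verts ?G" "?t \<in> verts ?G" and un: "arcs ?G = \<Union>(set (classes I))"
    using assms(1) by (auto simp: superset_simultaneous_dipaths_def)
  obtain g cs where g: "digraph_code ?G (cost I) g" and cs: "list_all2 set_code (classes I) cs"
    and d: "d = list_data [nat_data ?s, nat_data ?t, g, list_data cs]"
    using assms(2) by (auto simp: superset_simultaneous_dipaths_def ssp_code_def)
  obtain cls where cls: "classes I = map set cls" "cs = map nats_data cls"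
    using list_all2_set_code[OF cs] by blast
  obtain us as where us: "distinct us" "set us = verts ?G" and as: "distinct as" "set as = arcs ?G"
    and g_eq: "g = Pair (nats_data us)
      (list_data (map (\<lambda>a. quad_data (a, tail ?G a, head ?G a, cost I a)) as))"
    using g by (auto simp: digraph_code_def)
  have sub: "\<exists>J\<in>instances shortest_dipath. subgraph (graph J) ?G \<and>
      encodes shortest_dipath J (list_data [nat_data ?s, nat_data ?t, Pair (nats_data us)
        (list_data (map (\<lambda>a. quad_data (a, tail ?G a, head ?G a, w a)) bs))]) \<and>
      (\<forall>r. answers shortest_dipath J r \<longrightarrow> sp_answer {p \<in> dipaths ?G ?s ?t. set p \<subseteq> set bs} w r)"
    if bs: "distinct bs" "set bs \<subseteq> set as" "\<forall>a\<in>set bs. 0 \<le> w a" for bs w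
  proof (rule bexI, intro conjI)
    let ?H = "?G\<lparr>arcs := set bs\<rparr>"
    let ?J = "\<lparr>graph = ?H, source = ?s, target = ?t, cost = w\<rparr>"
    have wf: "fin_digraph ?H"
      by unfold_locales (use bs(2) as(2) in auto)
    show "?J \<in> instances shortest_dipath"
      using wf st bs(3) by (simp add: shortest_dipath_def)
    have "wf_digraph ?H" using wf by (simp add: fin_digraph_def)
    then show "subgraph (graph ?J) ?G"
      using bs(2) as(2) wf_digraph by (simp add: subgraph_def compatible_def)
    have "digraph_code ?H w (Pair (nats_data us)
        (list_data (map (\<lambda>a. quad_data (a, tail ?G a, head ?G a, w a)) bs)))"
      unfolding digraph_code_def using us bs(1)
      by (intro exI[of _ us] exI[of _ bs]) simp
    then show "encodes shortest_dipath ?J (list_data [nat_data ?s, nat_data ?t, Pair (nats_data us)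
        (list_data (map (\<lambda>a. quad_data (a, tail ?G a, head ?G a, w a)) bs))])"
      by (auto simp: shortest_dipath_def sp_code_def)
    show "\<forall>r. answers shortest_dipath ?J r \<longrightarrow> sp_answer {p \<in> dipaths ?G ?s ?t. set p \<subseteq> set bs} w r"
      using dipaths_restrict[of "set bs" ?G ?s ?t] bs(2) as(2)
      by (simp add: shortest_dipath_def dipaths_def)
  qed
  have "presents superset_simultaneous_dipaths shortest_dipath (\<lambda>J I. subgraph (graph J) (graph I)) I d
      ?s ?t (nats_data us) as (tail ?G) (head ?G) (cost I) cls (dipaths ?G ?s ?t)"
    unfolding presents_def
  proof (intro conjI)
    show "d = list_data [nat_data ?s, nat_data ?t, Pair (nats_data us)
        (list_data (map (\<lambda>a. quad_data (a, tail ?G a, head ?G a, cost I a)) as)),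
        list_data (map nats_data cls)]"
      unfolding d g_eq cls ..
    show "set as = (\<Union>l\<in>set cls. set l)"
      using as(2) un cls by simp
    show "\<forall>p\<in>dipaths ?G ?s ?t. set p \<subseteq> set as \<and> distinct p"
      using dipaths_subset[OF wf_digraph] as(2) by blast
    show "\<forall>r. ssp_answer (set as) (dipaths ?G ?s ?t) (map set cls) (cost I) r \<longrightarrow>
        answers superset_simultaneous_dipaths I r"
      using as(2) cls by (simp add: superset_simultaneous_dipaths_def dipaths_def)
  qed (use as(1) sub in blast)+
  with cls(1) show ?thesis by blast
qed

lemma presents_upaths:
  assumes "I \<in> instances superset_simultaneous_paths" "encodes superset_simultaneous_paths I d"
  shows "\<exists>s t vs as x y c cls paths. presents superset_simultaneous_paths shortest_upath
      (\<lambda>J I. usubgraph (graph J) (graph I)) I d s t vs as x y c cls paths \<and> classes I = map set cls"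
proof -
  let ?G = "graph I" and ?s = "source I" and ?t = "target I"
  have st: "?s \<in> nodes ?G" "?t \<in> nodes ?G" and un: "edges ?G = \<Union>(set (classes I))"
    and fin: "fin_ugraph ?G"
    using assms(1) by (auto simp: superset_simultaneous_paths_def)
  obtain g cs where g: "ugraph_code ?G (cost I) g" and cs: "list_all2 set_code (classes I) cs"
    and d: "d = list_data [nat_data ?s, nat_data ?t, g, list_data cs]"
    using assms(2) by (auto simp: superset_simultaneous_paths_def ssp_code_def)
  obtain cls where cls: "classes I = map set cls" "cs = map nats_data cls"
    using list_all2_set_code[OF cs] by blast
  obtain us as x y where us: "distinct us" "set us = nodes ?G" and as: "distinct as" "set as = edges ?G"
    and xy: "\<forall>e\<in>edges ?G. ends ?G e = {x e, y e}"
    and g_eq: "g = Pair (nats_data us) (list_data (map (\<lambda>a. quad_data (a, x a, y a, cost I a)) as))"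
    using g by (auto simp: ugraph_code_def)
  have sub: "\<exists>J\<in>instances shortest_upath. usubgraph (graph J) ?G \<and>
      encodes shortest_upath J (list_data [nat_data ?s, nat_data ?t, Pair (nats_data us)
        (list_data (map (\<lambda>a. quad_data (a, x a, y a, w a)) bs))]) \<and>
      (\<forall>r. answers shortest_upath J r \<longrightarrow> sp_answer {p \<in> upaths ?G ?s ?t. set p \<subseteq> set bs} w r)"
    if bs: "distinct bs" "set bs \<subseteq> set as" "\<forall>a\<in>set bs. 0 \<le> w a" for bs w
  proof (rule bexI, intro conjI)
    let ?H = "?G\<lparr>edges := set bs\<rparr>"
    let ?J = "\<lparr>graph = ?H, source = ?s, target = ?t, cost = w\<rparr>"
    have finH: "fin_ugraph ?H"
      using fin bs(2) as(2) by (auto simp: fin_ugraph_def)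
    show "?J \<in> instances shortest_upath"
      using finH st bs(3) by (simp add: shortest_upath_def)
    show "usubgraph (graph ?J) ?G"
      using bs(2) as(2) fin finH by (simp add: usubgraph_def)
    \<comment> \<open>The ends stay in the order of the given encoding, so the same \<open>x\<close>
      and \<open>y\<close> witness that the request encodes the subgraph.\<close>
    have "ugraph_code ?H w (Pair (nats_data us)
        (list_data (map (\<lambda>a. quad_data (a, x a, y a, w a)) bs)))"
      unfolding ugraph_code_def using us bs(1,2) as(2) xy
      by (intro exI[of _ us] exI[of _ bs] exI[of _ x] exI[of _ y]) auto
    then show "encodes shortest_upath ?J (list_data [nat_data ?s, nat_data ?t, Pair (nats_data us)
        (list_data (map (\<lambda>a. quad_data (a, x a, y a, w a)) bs))])"
      by (auto simp: shortest_upath_def sp_code_def)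
    show "\<forall>r. answers shortest_upath ?J r \<longrightarrow> sp_answer {p \<in> upaths ?G ?s ?t. set p \<subseteq> set bs} w r"
      using upaths_restrict[of "set bs" ?G ?s ?t] bs(2) as(2)
      by (simp add: shortest_upath_def upaths_def)
  qed
  have "presents superset_simultaneous_paths shortest_upath (\<lambda>J I. usubgraph (graph J) (graph I)) I d
      ?s ?t (nats_data us) as x y (cost I) cls (upaths ?G ?s ?t)"
    unfolding presents_def
  proof (intro conjI)
    show "d = list_data [nat_data ?s, nat_data ?t, Pair (nats_data us)
        (list_data (map (\<lambda>a. quad_data (a, x a, y a, cost I a)) as)),
        list_data (map nats_data cls)]"
      unfolding d g_eq cls ..
    show "set as = (\<Union>l\<in>set cls. set l)"
      using as(2) un cls by simp
    show "\<forall>p\<in>upaths ?G ?s ?t. set p \<subseteq> set as \<and> distinct p"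
      using upaths_subset distinct_upaths as(2) by blast
    show "\<forall>r. ssp_answer (set as) (upaths ?G ?s ?t) (map set cls) (cost I) r \<longrightarrow>
        answers superset_simultaneous_paths I r"
      using as(2) cls by (simp add: superset_simultaneous_paths_def upaths_def)
  qed (use as(1) sub in blast)+
  with cls(1) show ?thesis by blast
qed

text \<open>The program is \<open>compile t_superset\<close> both times and is chosen before
  \<open>Q\<close>. Inserting the polynomial \<open>Q\<close> that is shown to exist turns the final
  implication into an unconditional FPT algorithm.\<close>

theorem theorem3p4:
  shows "((\<exists>Q. polynomial_algorithm Q shortest_dipath) \<and>
      (\<exists>P. \<forall>Q. algorithm Q shortest_dipath \<longrightarrow>
        solves (proc Q) P superset_simultaneous_dipaths \<and>
        executes (proc Q) P superset_simultaneous_dipaths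
          (\<lambda>I. num_colors I * 2 ^ num_multicolored I)
          shortest_dipath (\<lambda>J I. subgraph (graph J) (graph I)) \<and>
        (polynomial_algorithm Q shortest_dipath \<longrightarrow>
          fpt_algorithm (proc Q) P superset_simultaneous_dipaths num_multicolored))) \<and>
    ((\<exists>Q. polynomial_algorithm Q shortest_upath) \<and>
      (\<exists>P. \<forall>Q. algorithm Q shortest_upath \<longrightarrow>
        solves (proc Q) P superset_simultaneous_paths \<and>
        executes (proc Q) P superset_simultaneous_paths
          (\<lambda>I. num_colors I * 2 ^ num_multicolored I)
          shortest_upath (\<lambda>J I. usubgraph (graph J) (graph I)) \<and>
        (polynomial_algorithm Q shortest_upath \<longrightarrow>
          fpt_algorithm (proc Q) P superset_simultaneous_paths num_multicolored)))"
  using polynomial_shortest_dipath polynomial_shortest_upath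
    superset_correct[OF presents_dipaths] superset_correct[OF presents_upaths]
  by blast

end
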